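(* Let $n\ge 0$ and $\tau=\pm 2^{-n}$. Let $(\sigma,\epsilon),(\sigma',\epsilon')\in \mathrm{QF}^n_{\operatorname{sgn}\tau}\times\{\pm1\}$. There is a braided monoidal equivalence $\mathcal C_{\mathbb R}(\sigma,\epsilon)\simeq\mathcal C_{\mathbb R}(\sigma',\epsilon')$ between the corresponding braidings on $\mathcal C_{\mathbb R}(K_4^n,h^n,\tau)$ if and only if $\epsilon=\epsilon'$. In particular, up to braided equivalence there are exactly two braidings on $\mathcal C_{\mathbb R}(K_4^n,h^n,\tau)$ when $n>0$, or when $n=0$ and $\tau>0$, and there are none otherwise.
   Context: Quadratic forms. $K_4=(\mathbb Z/2\mathbb Z)^2=\langle a,b\rangle$ is written multiplicatively, $h(a^ib^j,a^kb^l)=(-1)^{il+jk}$, and $h^n$ is the orthogonal direct sum of $n$ copies of $h$ on $K_4^n$. A (real) quadratic form on a finite abelian group $A$ is a function $\sigma:A\to\mathbb R^\times$ with $\sigma(x^{-1})=\sigma(x)$ such that $(\delta\sigma)(x,y)=\sigma(xy)/(\sigma(x)\sigma(y))$ is a bicharacter; $\mathrm{QF}(\chi)$ is the set of those with $\delta\sigma=\chi$. For $\sigma\in \mathrm{QF}(h^n)$ the Gauss sum $\Sigma(\sigma)=\sum_{x\in K_4^n}\sigma(x)$ is a nonzero real number; $\operatorname{sgn}(\sigma)$ denotes its sign, and $\mathrm{QF}^n_\pm$ is the set of $\sigma\in \mathrm{QF}(h^n)$ of sign $\pm$ (so $\mathrm{QF}^0_-=\emptyset$). Split real Tambara-Yamagami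 categories. For a finite group $A$, a symmetric nondegenerate bicharacter $\chi:A\times A\to\mathbb R^\times$ and $\tau=\pm1/\sqrt{|A|}$, $\mathcal C_{\mathbb R}(A,\chi,\tau)$ is the skeletal $\mathbb R$-linear fusion category with simple objects $A\sqcup\{m\}$, all with endomorphism algebra $\mathbb R$, fusion rules $a\otimes b=ab$, $a\otimes m=m\otimes a=m$, $m\otimes m=\bigoplus_{a\in A}a$, identity unitors, and associators $\alpha_{a,b,c}=\mathrm{id}$, $\alpha_{a,b,m}=\alpha_{m,a,b}=\mathrm{id}$, $\alpha_{a,m,b}=\chi(a,b)\mathrm{id}_m$, $\alpha_{a,m,m}=\alpha_{m,m,a}=\mathrm{id}$, $\alpha_{m,a,m}=\bigoplus_b\chi(a,b)\mathrm{id}_b$, $\alpha_{m,m,m}=(\tau\chi(a,b)^{-1}\mathrm{id}_m)_{a,b}$. Let $[a]:m\otimes m\to a$ and $[a]^\dagger:a\to m\otimes m$ be the projection and inclusion. For $(\sigma,\epsilon)\in \mathrm{QF}^n_{\operatorname{sgn}\tau}\times\{\pm1\}$, $\mathcal C_{\mathbb R}(\sigma,\epsilon)$ denotes $\mathcal C_{\mathbb R}(K_4^n,h^n,\tau)$ with the braiding $\beta_{a,b}=h^n(a,b)\,\mathrm{id}_{ab}$, $\beta_{a,m}=\beta_{m,a}=\sigma(a)\,\mathrm{id}_m$, $\beta_{m,m}=\sum_{a}\epsilon\,\sigma(a)[a]^\dagger[a]$. Every braiding on $\mathcal C_{\mathbb R}(K_4^n,h^n,\tau)$ is of this form. Equivalences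 are $\mathbb R$-linear braided monoidal equivalences. *)

theory Defs
  imports
    "HOL-Algebra.Product_Groups"
    "Jordan_Normal_Form.Matrix"
begin

section \<open>Real quadratic forms on $K_4^n$\<close>

definition bicharacter :: "('a, 'b) monoid_scheme \<Rightarrow> ('a \<Rightarrow> 'a \<Rightarrow> real) \<Rightarrow> bool" where
  "bicharacter A \<chi> \<longleftrightarrow>
     (\<forall>x\<in>carrier A. \<forall>y\<in>carrier A. \<chi> x y \<noteq> 0) \<and>
     (\<forall>x\<in>carrier A. \<forall>y\<in>carrier A. \<forall>z\<in>carrier A.
        \<chi> (x \<otimes>\<^bsub>A\<^esub> y) z = \<chi> x z * \<chi> y z \<and> \<chi> x (y \<otimes>\<^bsub>A\<^esub> z) = \<chi> x y * \<chi> x z)"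

definition coboundary :: "('a, 'b) monoid_scheme \<Rightarrow> ('a \<Rightarrow> real) \<Rightarrow> 'a \<Rightarrow> 'a \<Rightarrow> real" where
  "coboundary A \<sigma> x y = \<sigma> (x \<otimes>\<^bsub>A\<^esub> y) / (\<sigma> x * \<sigma> y)"

definition quadratic_form :: "('a, 'b) monoid_scheme \<Rightarrow> ('a \<Rightarrow> real) \<Rightarrow> bool" where
  "quadratic_form A \<sigma> \<longleftrightarrow>
     \<sigma> \<in> carrier A \<rightarrow>\<^sub>E (UNIV - {0}) \<and>
     (\<forall>x\<in>carrier A. \<sigma> (inv\<^bsub>A\<^esub> x) = \<sigma> x) \<and>
     bicharacter A (coboundary A \<sigma>)"

definition QF :: "('a, 'b) monoid_scheme \<Rightarrow> ('a \<Rightarrow> 'a \<Rightarrow> real) \<Rightarrow> ('a \<Rightarrow> real) set" where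
  "QF A \<chi> = {\<sigma>. quadratic_form A \<sigma> \<and>
                 (\<forall>x\<in>carrier A. \<forall>y\<in>carrier A. coboundary A \<sigma> x y = \<chi> x y)}"

definition gauss_sum :: "('a, 'b) monoid_scheme \<Rightarrow> ('a \<Rightarrow> real) \<Rightarrow> real" where
  "gauss_sum A \<sigma> = (\<Sum>x\<in>carrier A. \<sigma> x)"

(* The pair (i, j) with i, j in {0, 1} stands for a^i b^j. *)

definition K4 :: "(int \<times> int) monoid" where
  "K4 = integer_mod_group 2 \<times>\<times> integer_mod_group 2"

definition h :: "int \<times> int \<Rightarrow> int \<times> int \<Rightarrow> real" where
  "h = (\<lambda>(i, j) (k, l). (- 1) ^ nat (i * l + j * k))"

definition K4_pow :: "nat \<Rightarrow> (nat \<Rightarrow> int \<times> int) monoid" where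
  "K4_pow n = product_group {..<n} (\<lambda>_. K4)"

definition h_pow :: "nat \<Rightarrow> (nat \<Rightarrow> int \<times> int) \<Rightarrow> (nat \<Rightarrow> int \<times> int) \<Rightarrow> real" where
  "h_pow n x y = (\<Prod>i<n. h (x i) (y i))"

definition QF_sgn :: "nat \<Rightarrow> real \<Rightarrow> ((nat \<Rightarrow> int \<times> int) \<Rightarrow> real) set" where
  "QF_sgn n s = {\<sigma> \<in> QF (K4_pow n) (h_pow n). sgn (gauss_sum (K4_pow n) \<sigma>) = s}"


section \<open>Real linear monoidal categories, braidings and braided equivalences\<close>

(* The associator assoc X Y Z goes from (X Y) Z to X (Y Z).  Arrows are assumed to determine their
   source and target, so composition and tensor product take no object arguments. *)

record ('o, 'm) lin_moncat =
  obj :: "'o set"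
  arr :: "'o \<Rightarrow> 'o \<Rightarrow> 'm set"
  ident :: "'o \<Rightarrow> 'm"
  cmp :: "'m \<Rightarrow> 'm \<Rightarrow> 'm" (infixl \<open>\<cdot>\<index>\<close> 65)
  plus_arr :: "'m \<Rightarrow> 'm \<Rightarrow> 'm"
  scale_arr :: "real \<Rightarrow> 'm \<Rightarrow> 'm"
  tens :: "'o \<Rightarrow> 'o \<Rightarrow> 'o" (infixl \<open>\<boxtimes>\<index>\<close> 75)
  tens_arr :: "'m \<Rightarrow> 'm \<Rightarrow> 'm" (infixl \<open>\<boxdot>\<index>\<close> 75)
  unit_obj :: "'o"
  assoc :: "'o \<Rightarrow> 'o \<Rightarrow> 'o \<Rightarrow> 'm"
  lunit :: "'o \<Rightarrow> 'm"
  runit :: "'o \<Rightarrow> 'm"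

definition inverse_arrows ::
    "('o, 'm, 'z) lin_moncat_scheme \<Rightarrow> 'o \<Rightarrow> 'o \<Rightarrow> 'm \<Rightarrow> 'm \<Rightarrow> bool" where
  "inverse_arrows C X Y f g \<longleftrightarrow>
     f \<in> arr C X Y \<and> g \<in> arr C Y X \<and> g \<cdot>\<^bsub>C\<^esub> f = ident C X \<and> f \<cdot>\<^bsub>C\<^esub> g = ident C Y"

definition iso_arrow :: "('o, 'm, 'z) lin_moncat_scheme \<Rightarrow> 'o \<Rightarrow> 'o \<Rightarrow> 'm \<Rightarrow> bool" where
  "iso_arrow C X Y f \<longleftrightarrow> (\<exists>g. inverse_arrows C X Y f g)"

definition inv_arrow :: "('o, 'm, 'z) lin_moncat_scheme \<Rightarrow> 'o \<Rightarrow> 'o \<Rightarrow> 'm \<Rightarrow> 'm" where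
  "inv_arrow C X Y f = (THE g. inverse_arrows C X Y f g)"

definition braiding ::
    "('o, 'm, 'z) lin_moncat_scheme \<Rightarrow> ('o \<Rightarrow> 'o \<Rightarrow> 'm) \<Rightarrow> bool" where
  "braiding C \<beta> \<longleftrightarrow>
     (\<forall>X\<in>obj C. \<forall>Y\<in>obj C. iso_arrow C (X \<boxtimes>\<^bsub>C\<^esub> Y) (Y \<boxtimes>\<^bsub>C\<^esub> X) (\<beta> X Y)) \<and>
     (\<forall>X\<in>obj C. \<forall>X'\<in>obj C. \<forall>Y\<in>obj C. \<forall>Y'\<in>obj C. \<forall>f\<in>arr C X X'. \<forall>g\<in>arr C Y Y'.
        \<beta> X' Y' \<cdot>\<^bsub>C\<^esub> (f \<boxdot>\<^bsub>C\<^esub> g) = (g \<boxdot>\<^bsub>C\<^esub> f) \<cdot>\<^bsub>C\<^esub> \<beta> X Y) \<and>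
     (\<forall>X\<in>obj C. \<forall>Y\<in>obj C. \<forall>Z\<in>obj C.
        assoc C Y Z X \<cdot>\<^bsub>C\<^esub> \<beta> X (Y \<boxtimes>\<^bsub>C\<^esub> Z) \<cdot>\<^bsub>C\<^esub> assoc C X Y Z =
        (ident C Y \<boxdot>\<^bsub>C\<^esub> \<beta> X Z) \<cdot>\<^bsub>C\<^esub> assoc C Y X Z \<cdot>\<^bsub>C\<^esub> (\<beta> X Y \<boxdot>\<^bsub>C\<^esub> ident C Z)) \<and>
     (\<forall>X\<in>obj C. \<forall>Y\<in>obj C. \<forall>Z\<in>obj C.
        (let inv_assoc = (\<lambda>U V W. inv_arrow C (U \<boxtimes>\<^bsub>C\<^esub> V \<boxtimes>\<^bsub>C\<^esub> W) (U \<boxtimes>\<^bsub>C\<^esub> (V \<boxtimes>\<^bsub>C\<^esub> W)) (assoc C U V W))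
         in inv_assoc Z X Y \<cdot>\<^bsub>C\<^esub> \<beta> (X \<boxtimes>\<^bsub>C\<^esub> Y) Z \<cdot>\<^bsub>C\<^esub> inv_assoc X Y Z =
            (\<beta> X Z \<boxdot>\<^bsub>C\<^esub> ident C Y) \<cdot>\<^bsub>C\<^esub> inv_assoc X Z Y \<cdot>\<^bsub>C\<^esub> (ident C X \<boxdot>\<^bsub>C\<^esub> \<beta> Y Z)))"

definition functor_on ::
    "('o, 'm, 'z) lin_moncat_scheme \<Rightarrow> ('p, 'k, 'y) lin_moncat_scheme \<Rightarrow>
     ('o \<Rightarrow> 'p) \<Rightarrow> ('m \<Rightarrow> 'k) \<Rightarrow> bool" where
  "functor_on C D FO FM \<longleftrightarrow>
     (\<forall>X\<in>obj C. FO X \<in> obj D) \<and>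
     (\<forall>X\<in>obj C. \<forall>Y\<in>obj C. \<forall>f\<in>arr C X Y. FM f \<in> arr D (FO X) (FO Y)) \<and>
     (\<forall>X\<in>obj C. FM (ident C X) = ident D (FO X)) \<and>
     (\<forall>X\<in>obj C. \<forall>Y\<in>obj C. \<forall>Z\<in>obj C. \<forall>f\<in>arr C X Y. \<forall>g\<in>arr C Y Z.
        FM (g \<cdot>\<^bsub>C\<^esub> f) = FM g \<cdot>\<^bsub>D\<^esub> FM f)"

definition linear_functor ::
    "('o, 'm, 'z) lin_moncat_scheme \<Rightarrow> ('p, 'k, 'y) lin_moncat_scheme \<Rightarrow>
     ('o \<Rightarrow> 'p) \<Rightarrow> ('m \<Rightarrow> 'k) \<Rightarrow> bool" where
  "linear_functor C D FO FM \<longleftrightarrow>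
     functor_on C D FO FM \<and>
     (\<forall>X\<in>obj C. \<forall>Y\<in>obj C. \<forall>f\<in>arr C X Y. \<forall>g\<in>arr C X Y.
        FM (plus_arr C f g) = plus_arr D (FM f) (FM g)) \<and>
     (\<forall>X\<in>obj C. \<forall>Y\<in>obj C. \<forall>f\<in>arr C X Y. \<forall>r.
        FM (scale_arr C r f) = scale_arr D r (FM f))"

definition equivalence_functor ::
    "('o, 'm, 'z) lin_moncat_scheme \<Rightarrow> ('p, 'k, 'y) lin_moncat_scheme \<Rightarrow>
     ('o \<Rightarrow> 'p) \<Rightarrow> ('m \<Rightarrow> 'k) \<Rightarrow> bool" where
  "equivalence_functor C D FO FM \<longleftrightarrow>
     functor_on C D FO FM \<and>
     (\<exists>GO GM \<eta> \<theta>. functor_on D C GO GM \<and>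
        (\<forall>X\<in>obj C. iso_arrow C X (GO (FO X)) (\<eta> X)) \<and>
        (\<forall>X\<in>obj C. \<forall>X'\<in>obj C. \<forall>f\<in>arr C X X'. \<eta> X' \<cdot>\<^bsub>C\<^esub> f = GM (FM f) \<cdot>\<^bsub>C\<^esub> \<eta> X) \<and>
        (\<forall>Y\<in>obj D. iso_arrow D (FO (GO Y)) Y (\<theta> Y)) \<and>
        (\<forall>Y\<in>obj D. \<forall>Y'\<in>obj D. \<forall>g\<in>arr D Y Y'. \<theta> Y' \<cdot>\<^bsub>D\<^esub> FM (GM g) = g \<cdot>\<^bsub>D\<^esub> \<theta> Y))"

definition monoidal_functor ::
    "('o, 'm, 'z) lin_moncat_scheme \<Rightarrow> ('p, 'k, 'y) lin_moncat_scheme \<Rightarrow>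
     ('o \<Rightarrow> 'p) \<Rightarrow> ('m \<Rightarrow> 'k) \<Rightarrow> ('o \<Rightarrow> 'o \<Rightarrow> 'k) \<Rightarrow> 'k \<Rightarrow> bool" where
  "monoidal_functor C D FO FM J \<phi> \<longleftrightarrow>
     functor_on C D FO FM \<and>
     (\<forall>X\<in>obj C. \<forall>Y\<in>obj C. iso_arrow D (FO X \<boxtimes>\<^bsub>D\<^esub> FO Y) (FO (X \<boxtimes>\<^bsub>C\<^esub> Y)) (J X Y)) \<and>
     iso_arrow D (unit_obj D) (FO (unit_obj C)) \<phi> \<and>
     (\<forall>X\<in>obj C. \<forall>X'\<in>obj C. \<forall>Y\<in>obj C. \<forall>Y'\<in>obj C. \<forall>f\<in>arr C X X'. \<forall>g\<in>arr C Y Y'.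
        FM (f \<boxdot>\<^bsub>C\<^esub> g) \<cdot>\<^bsub>D\<^esub> J X Y = J X' Y' \<cdot>\<^bsub>D\<^esub> (FM f \<boxdot>\<^bsub>D\<^esub> FM g)) \<and>
     (\<forall>X\<in>obj C. \<forall>Y\<in>obj C. \<forall>Z\<in>obj C.
        FM (assoc C X Y Z) \<cdot>\<^bsub>D\<^esub> J (X \<boxtimes>\<^bsub>C\<^esub> Y) Z \<cdot>\<^bsub>D\<^esub> (J X Y \<boxdot>\<^bsub>D\<^esub> ident D (FO Z)) =
        J X (Y \<boxtimes>\<^bsub>C\<^esub> Z) \<cdot>\<^bsub>D\<^esub> (ident D (FO X) \<boxdot>\<^bsub>D\<^esub> J Y Z) \<cdot>\<^bsub>D\<^esub> assoc D (FO X) (FO Y) (FO Z)) \<and>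
     (\<forall>X\<in>obj C.
        FM (lunit C X) \<cdot>\<^bsub>D\<^esub> J (unit_obj C) X \<cdot>\<^bsub>D\<^esub> (\<phi> \<boxdot>\<^bsub>D\<^esub> ident D (FO X)) = lunit D (FO X)) \<and>
     (\<forall>X\<in>obj C.
        FM (runit C X) \<cdot>\<^bsub>D\<^esub> J X (unit_obj C) \<cdot>\<^bsub>D\<^esub> (ident D (FO X) \<boxdot>\<^bsub>D\<^esub> \<phi>) = runit D (FO X))"

definition braided_equivalent ::
    "('o, 'm, 'z) lin_moncat_scheme \<Rightarrow> ('o \<Rightarrow> 'o \<Rightarrow> 'm) \<Rightarrow>
     ('p, 'k, 'y) lin_moncat_scheme \<Rightarrow> ('p \<Rightarrow> 'p \<Rightarrow> 'k) \<Rightarrow> bool" where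
  "braided_equivalent C \<beta> D \<gamma> \<longleftrightarrow>
     (\<exists>FO FM J \<phi>. linear_functor C D FO FM \<and> equivalence_functor C D FO FM \<and>
        monoidal_functor C D FO FM J \<phi> \<and>
        (\<forall>X\<in>obj C. \<forall>Y\<in>obj C. FM (\<beta> X Y) \<cdot>\<^bsub>D\<^esub> J X Y = J Y X \<cdot>\<^bsub>D\<^esub> \<gamma> (FO X) (FO Y)))"

definition braidings :: "('o, 'm, 'z) lin_moncat_scheme \<Rightarrow> ('o \<Rightarrow> 'o \<Rightarrow> 'm) set" where
  "braidings C = {\<beta>. braiding C \<beta>}"

definition braided_equiv_rel ::
    "('o, 'm, 'z) lin_moncat_scheme \<Rightarrow> (('o \<Rightarrow> 'o \<Rightarrow> 'm) \<times> ('o \<Rightarrow> 'o \<Rightarrow> 'm)) set" where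
  "braided_equiv_rel C =
     {(\<beta>, \<gamma>). \<beta> \<in> braidings C \<and> \<gamma> \<in> braidings C \<and> braided_equivalent C \<beta> C \<gamma>}"


section \<open>Split real Tambara--Yamagami categories\<close>

text \<open>
  An object of the skeletal category is a multiplicity function on the simple objects, and an
  arrow is a family of real matrices, one for each simple object.  The copies of a simple object
  \<open>s\<close> in \<open>N \<otimes> M\<close> are labelled by the quadruples \<open>(x, p, y, q)\<close> where \<open>s\<close> occurs in
  \<open>x \<otimes> y\<close> and \<open>p\<close>, \<open>q\<close> number copies of \<open>x\<close> in \<open>N\<close> and of \<open>y\<close> in \<open>M\<close>; all fusion
  multiplicities are at most one.  These quadruples are listed lexicographically with respect to
  a chosen enumeration of the simple objects.  For \<open>N\<close> or \<open>M\<close> the unit object this order is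
  the order of copies in the other factor, so that identity unitors make sense.
\<close>

datatype 'a simple = Inv 'a | Mid

definition simples :: "('a, 'b) monoid_scheme \<Rightarrow> 'a simple list" where
  "simples A = map Inv (SOME as. distinct as \<and> set as = carrier A) @ [Mid]"

fun fusion :: "('a, 'b) monoid_scheme \<Rightarrow> 'a simple \<Rightarrow> 'a simple \<Rightarrow> 'a simple set" where
  "fusion A (Inv a) (Inv b) = {Inv (a \<otimes>\<^bsub>A\<^esub> b)}"
| "fusion A (Inv a) Mid = {Mid}"
| "fusion A Mid (Inv a) = {Mid}"
| "fusion A Mid Mid = Inv ` carrier A"

type_synonym 'a ty_obj = "'a simple \<Rightarrow> nat"
type_synonym 'a ty_arr = "'a simple \<Rightarrow> real mat"

definition ty_copies ::
    "('a, 'b) monoid_scheme \<Rightarrow> 'a ty_obj \<Rightarrow> 'a ty_obj \<Rightarrow> 'a simple \<Rightarrow>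
     ('a simple \<times> nat \<times> 'a simple \<times> nat) list" where
  "ty_copies A N M s =
     [(x, p, y, q). x \<leftarrow> simples A, y \<leftarrow> simples A, s \<in> fusion A x y,
                    p \<leftarrow> [0..<N x], q \<leftarrow> [0..<M y]]"

definition ty_tens :: "('a, 'b) monoid_scheme \<Rightarrow> 'a ty_obj \<Rightarrow> 'a ty_obj \<Rightarrow> 'a ty_obj" where
  "ty_tens A N M = (\<lambda>s. length (ty_copies A N M s))"

definition ty_tens_arr ::
    "('a, 'b) monoid_scheme \<Rightarrow> 'a ty_arr \<Rightarrow> 'a ty_arr \<Rightarrow> 'a ty_arr" where
  "ty_tens_arr A f g = (\<lambda>s.
     let src = ty_copies A (\<lambda>x. dim_col (f x)) (\<lambda>y. dim_col (g y)) s;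
         trg = ty_copies A (\<lambda>x. dim_row (f x)) (\<lambda>y. dim_row (g y)) s
     in mat (length trg) (length src) (\<lambda>(i, j).
          case trg ! i of (x', p', y', q') \<Rightarrow> case src ! j of (x, p, y, q) \<Rightarrow>
            if x' = x \<and> y' = y then f x $$ (p', p) * g y $$ (q', q) else 0))"

(* Entry of alpha_{x,y,z} on the simple summand t, from the copy of t through u in
   (x y) z to the copy of t through w in x (y z). *)

fun ty_assoc_coeff ::
    "('a \<Rightarrow> 'a \<Rightarrow> real) \<Rightarrow> real \<Rightarrow> 'a simple \<Rightarrow> 'a simple \<Rightarrow> 'a simple \<Rightarrow>
     'a simple \<Rightarrow> 'a simple \<Rightarrow> 'a simple \<Rightarrow> real" where
  "ty_assoc_coeff \<chi> \<tau> (Inv a) Mid (Inv b) t u w = \<chi> a b"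
| "ty_assoc_coeff \<chi> \<tau> Mid (Inv a) Mid (Inv b) u w = \<chi> a b"
| "ty_assoc_coeff \<chi> \<tau> Mid Mid Mid t (Inv a) (Inv b) = \<tau> * inverse (\<chi> a b)"
| "ty_assoc_coeff \<chi> \<tau> x y z t u w = 1"

definition ty_assoc ::
    "('a, 'b) monoid_scheme \<Rightarrow> ('a \<Rightarrow> 'a \<Rightarrow> real) \<Rightarrow> real \<Rightarrow>
     'a ty_obj \<Rightarrow> 'a ty_obj \<Rightarrow> 'a ty_obj \<Rightarrow> 'a ty_arr" where
  "ty_assoc A \<chi> \<tau> N M L = (\<lambda>t.
     let src = ty_copies A (ty_tens A N M) L t;
         trg = ty_copies A N (ty_tens A M L) t
     in mat (length trg) (length src) (\<lambda>(i, j).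
          case src ! j of (u, k, z, r) \<Rightarrow> case ty_copies A N M u ! k of (x, p, y, q) \<Rightarrow>
          case trg ! i of (x', p', w, l) \<Rightarrow> case ty_copies A M L w ! l of (y', q', z', r') \<Rightarrow>
            if (x', p', y', q', z', r') = (x, p, y, q, z, r)
            then ty_assoc_coeff \<chi> \<tau> x y z t u w else 0))"

definition TY ::
    "('a, 'b) monoid_scheme \<Rightarrow> ('a \<Rightarrow> 'a \<Rightarrow> real) \<Rightarrow> real \<Rightarrow> ('a ty_obj, 'a ty_arr) lin_moncat" where
  "TY A \<chi> \<tau> = \<lparr>
     obj = {N. \<forall>s. s \<notin> set (simples A) \<longrightarrow> N s = 0},
     arr = (\<lambda>N M. {f. \<forall>s. f s \<in> carrier_mat (M s) (N s)}),
     ident = (\<lambda>N s. 1\<^sub>m (N s)),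
     cmp = (\<lambda>g f s. g s * f s),
     plus_arr = (\<lambda>f g s. f s + g s),
     scale_arr = (\<lambda>r f s. r \<cdot>\<^sub>m f s),
     tens = ty_tens A,
     tens_arr = ty_tens_arr A,
     unit_obj = (\<lambda>s. if s = Inv \<one>\<^bsub>A\<^esub> then 1 else 0),
     assoc = ty_assoc A \<chi> \<tau>,
     lunit = (\<lambda>N s. 1\<^sub>m (N s)),
     runit = (\<lambda>N s. 1\<^sub>m (N s)) \<rparr>"

(* Scalar by which beta_{x,y} acts on the simple summand t of x y. *)

fun ty_braid_coeff ::
    "('a \<Rightarrow> 'a \<Rightarrow> real) \<Rightarrow> ('a \<Rightarrow> real) \<Rightarrow> real \<Rightarrow>
     'a simple \<Rightarrow> 'a simple \<Rightarrow> 'a simple \<Rightarrow> real" where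
  "ty_braid_coeff \<chi> \<sigma> \<epsilon> (Inv a) (Inv b) t = \<chi> a b"
| "ty_braid_coeff \<chi> \<sigma> \<epsilon> (Inv a) Mid t = \<sigma> a"
| "ty_braid_coeff \<chi> \<sigma> \<epsilon> Mid (Inv a) t = \<sigma> a"
| "ty_braid_coeff \<chi> \<sigma> \<epsilon> Mid Mid (Inv a) = \<epsilon> * \<sigma> a"
| "ty_braid_coeff \<chi> \<sigma> \<epsilon> Mid Mid Mid = 0"

definition ty_braid ::
    "('a, 'b) monoid_scheme \<Rightarrow> ('a \<Rightarrow> 'a \<Rightarrow> real) \<Rightarrow> ('a \<Rightarrow> real) \<Rightarrow> real \<Rightarrow>
     'a ty_obj \<Rightarrow> 'a ty_obj \<Rightarrow> 'a ty_arr" where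
  "ty_braid A \<chi> \<sigma> \<epsilon> N M = (\<lambda>t.
     let src = ty_copies A N M t; trg = ty_copies A M N t
     in mat (length trg) (length src) (\<lambda>(i, j).
          case src ! j of (x, p, y, q) \<Rightarrow> case trg ! i of (y', q', x', p') \<Rightarrow>
            if (x', p', y', q') = (x, p, y, q) then ty_braid_coeff \<chi> \<sigma> \<epsilon> x y t else 0))"

abbreviation TY_K4 :: "nat \<Rightarrow> real \<Rightarrow>
    ((nat \<Rightarrow> int \<times> int) ty_obj, (nat \<Rightarrow> int \<times> int) ty_arr) lin_moncat" where
  "TY_K4 n \<tau> \<equiv> TY (K4_pow n) (h_pow n) \<tau>"

abbreviation K4_braid :: "nat \<Rightarrow> ((nat \<Rightarrow> int \<times> int) \<Rightarrow> real) \<Rightarrow> real \<Rightarrow>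
    (nat \<Rightarrow> int \<times> int) ty_obj \<Rightarrow> (nat \<Rightarrow> int \<times> int) ty_obj \<Rightarrow> (nat \<Rightarrow> int \<times> int) ty_arr" where
  "K4_braid n \<sigma> \<epsilon> \<equiv> ty_braid (K4_pow n) (h_pow n) \<sigma> \<epsilon>"

end

theory Submission
  imports Defs
begin

text \<open>
  By naturality a braiding is determined by scalars on the simple objects, and the hexagons become
  Siehler's equations for these scalars.  They say that the braiding is given by a quadratic form
  \<open>\<sigma>\<close> with \<open>\<delta>\<sigma> = \<chi>\<close> and a number \<open>\<epsilon>\<close> with \<open>\<epsilon>\<^sup>2 = \<tau> \<Sigma>(\<sigma>)\<close>; as \<open>\<Sigma>(\<sigma>)\<^sup>2 = |A|\<close>, the sign of
  \<open>\<Sigma>(\<sigma>)\<close> must be that of \<open>\<tau>\<close>, and then \<open>\<epsilon> = \<plusminus>1\<close>.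

  A second form is \<open>\<sigma>' = \<sigma> \<chi>(v, \<cdot>)\<close> for some \<open>v\<close>, with \<open>\<Sigma>(\<sigma>') = \<sigma>(v) \<Sigma>(\<sigma>)\<close>.  If the signs
  agree, then \<open>\<sigma>(v) = 1\<close>, and the transvection along \<open>v\<close> is an isometry of \<open>\<chi>\<close> that carries \<open>\<sigma>\<close>
  to \<open>\<sigma>'\<close>.  Relabelling the simple objects by it is a braided equivalence.  Conversely, a braided
  equivalence fixes \<open>m\<close>, and \<open>\<epsilon>\<close> is the eigenvalue of \<open>\<beta>\<^bsub>m,m\<^esub>\<close> on the unit summand of \<open>m \<otimes> m\<close>.
\<close>

section \<open>Matrices with labelled rows and columns\<close>

text \<open>Copies in a tensor product are listed lexicographically, so rebracketed or reordered
  products have differently ordered bases, and even a relabelling of simple objects needs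
  permutation matrices. Common labels separate this bookkeeping from the mathematics: an identity of
  composites becomes one scalar equation for each key and each pair of outer channels. Two features
  of \<open>\<chi>\<close> drive the rest. It is nondegenerate with values \<plusminus>1, so every
  element squares to the identity and the associators are orthogonal; and
  \<open>\<chi> x x = 1\<close>, so forms take values \<plusminus>1 and transvections are
  isometries. Only the hexagons at (m, m, m) contain a genuine sum, and there the Gauss sum enters.
  A braiding is a function on all multiplicity functions, but the axioms constrain it at objects
  only; hence everything is stated up to agreement on \<open>obj C\<close>. For \<open>n > 0\<close>
  some form takes the value -1 at some element, and twisting by that element flips the sign of the
  Gauss sum. For \<open>n = 0\<close> the sum is always 1, so a negative \<tau> admits no
  braiding.\<close>

text \<open>Rows and columns carry labels (key, channel), and an entry vanishes unless the keys agree.  In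
  a tensor product the key records which copies of the simple objects are multiplied, and the channel
  the intermediate simple object, so all structure morphisms have this form.\<close>

definition bmat ::
    "nat \<Rightarrow> (nat \<Rightarrow> 'k \<times> 'u) \<Rightarrow> nat \<Rightarrow> (nat \<Rightarrow> 'k \<times> 'v) \<Rightarrow> ('k \<Rightarrow> 'u \<Rightarrow> 'v \<Rightarrow> real) \<Rightarrow> real mat" where
  "bmat m e n d f = mat m n (\<lambda>(i, j).
     if fst (e i) = fst (d j) then f (fst (d j)) (snd (e i)) (snd (d j)) else 0)"

text \<open>\<open>U k\<close> collects the channels that occur with the key \<open>k\<close>. Each
  label in the whole of \<open>Sigma UNIV U\<close> occurs exactly once, so that sums over indices
  are sums over channels and entries determine coefficients.\<close>

definition basis :: "(nat \<Rightarrow> 'k \<times> 'u) \<Rightarrow> nat \<Rightarrow> ('k \<Rightarrow> 'u set) \<Rightarrow> bool" where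
  "basis e n U \<longleftrightarrow> bij_betw e {..<n} (Sigma UNIV U)"

lemma basis_finite: assumes "basis e n U" shows "finite (U k)"
proof -
  have "finite (Sigma UNIV U)"
    using assms unfolding basis_def by (metis bij_betw_finite finite_lessThan)
  then have "finite (Pair k -` Sigma UNIV U)"
    by (rule finite_vimageI) (simp add: inj_on_def)
  then show ?thesis by (simp add: Sigma_def vimage_def)
qed

lemma basis_memb: "basis e n U \<Longrightarrow> i < n \<Longrightarrow> snd (e i) \<in> U (fst (e i))"
  unfolding basis_def bij_betw_def by (metis image_eqI lessThan_iff mem_Sigma_iff prod.collapse)

lemma basis_ex: "basis e n U \<Longrightarrow> u \<in> U k \<Longrightarrow> \<exists>i<n. e i = (k, u)"
  unfolding basis_def bij_betw_def by (metis (no_types, lifting) SigmaI UNIV_I image_iff lessThan_iff)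

lemma basis_inj: "basis e n U \<Longrightarrow> i < n \<Longrightarrow> j < n \<Longrightarrow> e i = e j \<longleftrightarrow> i = j"
  unfolding basis_def bij_betw_def by (auto dest: inj_onD)

lemma bmat_dim [simp]: "dim_row (bmat m e n d f) = m" "dim_col (bmat m e n d f) = n"
  "bmat m e n d f \<in> carrier_mat m n"
  by (auto simp: bmat_def)

text \<open>Composition does not mix keys: a contributing middle label must share the key of the
  column, so the sum over the middle basis collapses to the channels over that key.\<close>

lemma bmat_mult:
  assumes d: "basis d n U"
  shows "bmat m e n d f * bmat n d l c g = bmat m e l c (\<lambda>k w u. \<Sum>v\<in>U k. f k w v * g k v u)"
proof (rule eq_matI)
  fix i j assume "i < dim_row (bmat m e l c (\<lambda>k w u. \<Sum>v\<in>U k. f k w v * g k v u))"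
    "j < dim_col (bmat m e l c (\<lambda>k w u. \<Sum>v\<in>U k. f k w v * g k v u))"
  then have ij: "i < m" "j < l" by auto
  let ?F = "\<lambda>y. (if fst (e i) = fst y then f (fst y) (snd (e i)) (snd y) else 0) *
      (if fst y = fst (c j) then g (fst (c j)) (snd y) (snd (c j)) else 0)"
  have fin: "finite (Sigma UNIV U)"
    using d unfolding basis_def by (metis bij_betw_finite finite_lessThan)
  have "(bmat m e n d f * bmat n d l c g) $$ (i, j) = (\<Sum>a<n. ?F (d a))"
    using ij by (simp add: bmat_def scalar_prod_def atLeast0LessThan)
  also have "\<dots> = (\<Sum>y\<in>Sigma UNIV U. ?F y)"
    using sum.reindex_bij_betw[OF d[unfolded basis_def], of ?F] by simp
  also have "\<dots> = (\<Sum>y\<in>Pair (fst (c j)) ` U (fst (c j)). ?F y)"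
    by (rule sum.mono_neutral_right) (use fin in auto)
  also have "\<dots> = (\<Sum>v\<in>U (fst (c j)). ?F (fst (c j), v))"
    by (subst sum.reindex) (auto simp: inj_on_def)
  also have "\<dots> = bmat m e l c (\<lambda>k w u. \<Sum>v\<in>U k. f k w v * g k v u) $$ (i, j)"
    using ij by (simp add: bmat_def)
  finally show "(bmat m e n d f * bmat n d l c g) $$ (i, j)
    = bmat m e l c (\<lambda>k w u. \<Sum>v\<in>U k. f k w v * g k v u) $$ (i, j)" .
qed auto

text \<open>This is the passage from matrices to scalars. Every admissible label occurs as a row or
  column, so each coefficient can be read off at some entry.\<close>

lemma bmat_eq_iff:
  assumes e: "basis e m V" and d: "basis d n U"
  shows "bmat m e n d f = bmat m e n d g \<longleftrightarrow> (\<forall>k. \<forall>u\<in>U k. \<forall>w\<in>V k. f k w u = g k w u)"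
proof
  assume eq: "bmat m e n d f = bmat m e n d g"
  show "\<forall>k. \<forall>u\<in>U k. \<forall>w\<in>V k. f k w u = g k w u"
  proof (intro allI ballI)
    fix k u w assume "u \<in> U k" "w \<in> V k"
    then obtain i j where ij: "i < m" "e i = (k, w)" "j < n" "d j = (k, u)"
      using basis_ex[OF e] basis_ex[OF d] by metis
    have "bmat m e n d f $$ (i, j) = bmat m e n d g $$ (i, j)" using eq by simp
    then show "f k w u = g k w u" using ij by (simp add: bmat_def)
  qed
next
  assume "\<forall>k. \<forall>u\<in>U k. \<forall>w\<in>V k. f k w u = g k w u"
  then show "bmat m e n d f = bmat m e n d g"
    using basis_memb[OF e] basis_memb[OF d] unfolding bmat_def
    by (intro eq_matI) force+
qed

lemma bmat_one:
  assumes d: "basis d n U"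
  shows "bmat n d n d (\<lambda>k w u. if w = u then 1 else 0) = 1\<^sub>m n"
  using basis_inj[OF d] by (intro eq_matI) (auto simp: bmat_def prod_eq_iff)

text \<open>Braidings, the relabelling isomorphisms and their products with identities are diagonal
  in the channels; composing with them leaves no sum.\<close>

lemma bmat_mult_diag:
  assumes d: "basis d n U" and c: "basis c l U"
  shows "bmat m e n d f * bmat n d l c (\<lambda>k v u. if v = u then g k u else 0)
    = bmat m e l c (\<lambda>k w u. f k w u * g k u)"
proof -
  have *: "(\<Sum>v\<in>U k. f k w v * (if v = u then g k u else 0)) = (if u \<in> U k then f k w u * g k u else 0)"
    for k w u
    using basis_finite[OF d] by (simp add: if_distrib[of "\<lambda>x. _ * x"] cong: if_cong)
  show ?thesis
    unfolding bmat_mult[OF d] * using basis_memb[OF c] by (intro eq_matI) (auto simp: bmat_def)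
qed

lemma bmat_diag_mult:
  assumes d: "basis d n U" and e: "basis e m U"
  shows "bmat m e n d (\<lambda>k w v. if w = v then g k v else 0) * bmat n d l c f
    = bmat m e l c (\<lambda>k w u. g k w * f k w u)"
proof -
  have *: "(\<Sum>v\<in>U k. (if w = v then g k v else 0) * f k v u) = (if w \<in> U k then g k w * f k w u else 0)"
    for k w u
    using basis_finite[OF d] by (simp add: if_distrib[of "\<lambda>x. x * _"] cong: if_cong)
  show ?thesis
    unfolding bmat_mult[OF d] * using basis_memb[OF e] by (intro eq_matI) (force simp: bmat_def)+
qed

section \<open>Labels of tensor products\<close>

lemma set_ty_copies:
  "set (ty_copies A N M s) = {(x, p, y, q). x \<in> set (simples A) \<and> y \<in> set (simples A) \<and>
      s \<in> fusion A x y \<and> p < N x \<and> q < M y}"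
  by (auto simp: ty_copies_def image_iff)

lemma distinct_concat_map_tag:
  assumes "distinct xs" "\<And>x. x \<in> set xs \<Longrightarrow> distinct (f x)"
    "\<And>x y z. x \<in> set xs \<Longrightarrow> y \<in> set xs \<Longrightarrow> z \<in> set (f x) \<Longrightarrow> z \<in> set (f y) \<Longrightarrow> x = y"
  shows "distinct (concat (map f xs))"
  using assms
proof (induction xs)
  case (Cons a xs)
  have "distinct (concat (map f xs))"
    by (rule Cons.IH) (use Cons.prems in \<open>auto\<close>)
  moreover have "set (f a) \<inter> set (concat (map f xs)) = {}"
    using Cons.prems(1) Cons.prems(3)[of a] by fastforce
  ultimately show ?case using Cons.prems by auto
qed simp

lemma distinct_ty_copies:
  assumes "distinct (simples A)"
  shows "distinct (ty_copies A N M s)"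
proof -
  have "distinct (concat (map (\<lambda>p. map (\<lambda>q. (x, p, y, q)) [0..<M y]) [0..<N x]))" for x y
    by (rule distinct_concat_map_tag) (auto simp: distinct_map inj_on_def)
  then show ?thesis
    unfolding ty_copies_def
    by (intro distinct_concat_map_tag[OF assms]) (auto split: if_splits)
qed

lemma nth_ty_copies:
  "i < ty_tens A N M s \<Longrightarrow> (case ty_copies A N M s ! i of (x, p, y, q) \<Rightarrow>
     x \<in> set (simples A) \<and> y \<in> set (simples A) \<and> s \<in> fusion A x y \<and> p < N x \<and> q < M y)"
  using nth_mem[of i "ty_copies A N M s"] unfolding set_ty_copies ty_tens_def by auto

lemma bij_ty_copies:
  assumes "distinct (simples A)"
  shows "bij_betw ((!) (ty_copies A N M s)) {..<ty_tens A N M s} (set (ty_copies A N M s))"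
  by (rule bij_betw_nth[OF distinct_ty_copies[OF assms]]) (auto simp: ty_tens_def)

definition labels :: "('a, 'b) monoid_scheme \<Rightarrow> 'a ty_obj \<Rightarrow> 'a ty_obj \<Rightarrow> 'a simple \<Rightarrow>
    (('a simple \<times> nat) \<times> ('a simple \<times> nat)) set" where
  "labels A N M s = {((x, p), (y, q)). x \<in> set (simples A) \<and> y \<in> set (simples A) \<and>
      s \<in> fusion A x y \<and> p < N x \<and> q < M y}"

text \<open>Pairs of pairs instead of quadruples: each half names one copy in one factor, so
  exchanging the factors is \<open>prod.swap\<close> and labels of iterated products can be
  nested.\<close>

definition lab :: "('a, 'b) monoid_scheme \<Rightarrow> 'a ty_obj \<Rightarrow> 'a ty_obj \<Rightarrow> 'a simple \<Rightarrow> nat \<Rightarrow>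
    ('a simple \<times> nat) \<times> ('a simple \<times> nat)" where
  "lab A N M s i = (case ty_copies A N M s ! i of (x, p, y, q) \<Rightarrow> ((x, p), (y, q)))"

lemma bij_lab:
  assumes "distinct (simples A)"
  shows "bij_betw (lab A N M s) {..<ty_tens A N M s} (labels A N M s)"
proof -
  have 1: "bij_betw (\<lambda>(x, p, y, q). ((x, p), (y, q))) (set (ty_copies A N M s)) (labels A N M s)"
    unfolding set_ty_copies labels_def
    by (rule bij_betw_byWitness[where f' = "\<lambda>((x, p), (y, q)). (x, p, y, q)"]) auto
  show ?thesis
    using bij_betw_trans[OF bij_ty_copies[OF assms] 1] by (simp add: lab_def comp_def cong: bij_betw_cong)
qed

text \<open>In a threefold product the simple summand \<open>u\<close> of the inner factor \<open>N\<close>, whose copies are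
  labelled by \<open>e u\<close>, is the channel; everything else is the key.  The parameters \<open>\<kappa>\<close> and \<open>\<rho>\<close> bring
  differently ordered, or relabelled, tensor products to a common set of labels.\<close>

definition nestL where
  "nestL A \<kappa> \<rho> e N Z t j = (case ty_copies A N Z t ! j of (u, k, z, r) \<Rightarrow> (\<kappa> (e u k) (z, r), \<rho> u))"

definition nestR where
  "nestR A \<kappa> \<rho> e X N t j = (case ty_copies A X N t ! j of (x, p, w, l) \<Rightarrow> (\<kappa> (x, p) (e w l), \<rho> w))"

text \<open>As \<open>case_prod \<kappa>\<close> and \<open>\<rho>\<close> are bijections, every key
  and channel has the form that appears in the hypothesis on \<open>U\<close>, which therefore
  determines \<open>U\<close> completely.\<close>

lemma basis_nestL:
  assumes "distinct (simples A)"
    and e: "\<And>u. u \<in> set (simples A) \<Longrightarrow> bij_betw (e u) {..<N u} (E u)"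
    and \<kappa>: "bij (case_prod \<kappa>)" and \<rho>: "bij \<rho>"
    and U: "\<And>u k z r. \<rho> u \<in> U (\<kappa> k (z, r)) \<longleftrightarrow> u \<in> set (simples A) \<and> z \<in> set (simples A) \<and>
          k \<in> E u \<and> t \<in> fusion A u z \<and> r < Z z"
  shows "basis (nestL A \<kappa> \<rho> e N Z t) (ty_tens A N Z t) U"
proof -
  have \<kappa>_eq: "\<kappa> k z = \<kappa> k' z' \<longleftrightarrow> k = k' \<and> z = z'" for k z k' z'
    using inj_eq[OF bij_is_inj[OF \<kappa>], of "(k, z)" "(k', z')"] by simp
  have e_eq: "u \<in> set (simples A) \<Longrightarrow> k < N u \<Longrightarrow> k' < N u \<Longrightarrow> e u k = e u k' \<longleftrightarrow> k = k'" for u k k'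
    using e[of u] by (auto simp: bij_betw_def inj_on_def)
  have "bij_betw (\<lambda>(u, k, z, r). (\<kappa> (e u k) (z, r), \<rho> u)) (set (ty_copies A N Z t)) (Sigma UNIV U)"
    unfolding bij_betw_def
  proof
    show "inj_on (\<lambda>(u, k, z, r). (\<kappa> (e u k) (z, r), \<rho> u)) (set (ty_copies A N Z t))"
      unfolding inj_on_def set_ty_copies by (auto simp: \<kappa>_eq inj_eq[OF bij_is_inj[OF \<rho>]] e_eq)
    show "(\<lambda>(u, k, z, r). (\<kappa> (e u k) (z, r), \<rho> u)) ` set (ty_copies A N Z t) = Sigma UNIV U"
    proof (intro equalityI subsetI)
      fix y assume "y \<in> (\<lambda>(u, k, z, r). (\<kappa> (e u k) (z, r), \<rho> u)) ` set (ty_copies A N Z t)"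
      then show "y \<in> Sigma UNIV U"
        using e by (force simp: set_ty_copies U bij_betw_def)
    next
      fix y assume y: "y \<in> Sigma UNIV U"
      obtain k zr u where y_def: "y = (\<kappa> k zr, \<rho> u)"
        using \<kappa> \<rho> by (cases y) (metis bij_pointE case_prod_conv surj_pair)
      obtain z r where zr: "zr = (z, r)" by (cases zr)
      have u: "u \<in> set (simples A)" "z \<in> set (simples A)" "k \<in> E u" "t \<in> fusion A u z" "r < Z z"
        using y U[of u k z r] by (auto simp: y_def zr)
      then obtain j where "j < N u" "k = e u j"
        using e[of u] by (auto simp: bij_betw_def)
      then show "y \<in> (\<lambda>(u, k, z, r). (\<kappa> (e u k) (z, r), \<rho> u)) ` set (ty_copies A N Z t)"
        using u by (intro image_eqI[of _ _ "(u, j, z, r)"]) (auto simp: y_def zr set_ty_copies)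
    qed
  qed
  moreover have "nestL A \<kappa> \<rho> e N Z t = (\<lambda>(u, k, z, r). (\<kappa> (e u k) (z, r), \<rho> u)) \<circ> (!) (ty_copies A N Z t)"
    by (simp add: fun_eq_iff nestL_def split: prod.split)
  ultimately show ?thesis
    unfolding basis_def by (simp only: bij_betw_trans[OF bij_ty_copies[OF assms(1)]])
qed

lemma basis_nestR:
  assumes "distinct (simples A)"
    and e: "\<And>u. u \<in> set (simples A) \<Longrightarrow> bij_betw (e u) {..<N u} (E u)"
    and \<kappa>: "bij (case_prod \<kappa>)" and \<rho>: "bij \<rho>"
    and U: "\<And>u k x p. \<rho> u \<in> U (\<kappa> (x, p) k) \<longleftrightarrow> u \<in> set (simples A) \<and> x \<in> set (simples A) \<and>
          k \<in> E u \<and> t \<in> fusion A x u \<and> p < X x"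
  shows "basis (nestR A \<kappa> \<rho> e X N t) (ty_tens A X N t) U"
proof -
  have \<kappa>_eq: "\<kappa> k z = \<kappa> k' z' \<longleftrightarrow> k = k' \<and> z = z'" for k z k' z'
    using inj_eq[OF bij_is_inj[OF \<kappa>], of "(k, z)" "(k', z')"] by simp
  have e_eq: "u \<in> set (simples A) \<Longrightarrow> k < N u \<Longrightarrow> k' < N u \<Longrightarrow> e u k = e u k' \<longleftrightarrow> k = k'" for u k k'
    using e[of u] by (auto simp: bij_betw_def inj_on_def)
  have "bij_betw (\<lambda>(x, p, w, l). (\<kappa> (x, p) (e w l), \<rho> w)) (set (ty_copies A X N t)) (Sigma UNIV U)"
    unfolding bij_betw_def
  proof
    show "inj_on (\<lambda>(x, p, w, l). (\<kappa> (x, p) (e w l), \<rho> w)) (set (ty_copies A X N t))"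
      unfolding inj_on_def set_ty_copies by (auto simp: \<kappa>_eq inj_eq[OF bij_is_inj[OF \<rho>]] e_eq)
    show "(\<lambda>(x, p, w, l). (\<kappa> (x, p) (e w l), \<rho> w)) ` set (ty_copies A X N t) = Sigma UNIV U"
    proof (intro equalityI subsetI)
      fix y assume "y \<in> (\<lambda>(x, p, w, l). (\<kappa> (x, p) (e w l), \<rho> w)) ` set (ty_copies A X N t)"
      then show "y \<in> Sigma UNIV U"
        using e by (force simp: set_ty_copies U bij_betw_def)
    next
      fix y assume y: "y \<in> Sigma UNIV U"
      obtain k xp u where y_def: "y = (\<kappa> xp k, \<rho> u)"
        using \<kappa> \<rho> by (cases y) (metis bij_pointE case_prod_conv surj_pair)
      obtain x p where xp: "xp = (x, p)" by (cases xp)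
      have u: "u \<in> set (simples A)" "x \<in> set (simples A)" "k \<in> E u" "t \<in> fusion A x u" "p < X x"
        using y U[of u x p k] by (auto simp: y_def xp)
      then obtain j where "j < N u" "k = e u j"
        using e[of u] by (auto simp: bij_betw_def)
      then show "y \<in> (\<lambda>(x, p, w, l). (\<kappa> (x, p) (e w l), \<rho> w)) ` set (ty_copies A X N t)"
        using u by (intro image_eqI[of _ _ "(x, p, u, j)"]) (auto simp: y_def xp set_ty_copies)
    qed
  qed
  moreover have "nestR A \<kappa> \<rho> e X N t = (\<lambda>(x, p, w, l). (\<kappa> (x, p) (e w l), \<rho> w)) \<circ> (!) (ty_copies A X N t)"
    by (simp add: fun_eq_iff nestR_def split: prod.split)
  ultimately show ?thesis
    unfolding basis_def by (simp only: bij_betw_trans[OF bij_ty_copies[OF assms(1)]])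
qed

section \<open>Structure morphisms as labelled matrices\<close>

lemma transpose_bmat: "transpose_mat (bmat m e n d f) = bmat n d m e (\<lambda>k u w. f k w u)"
  by (rule eq_matI) (auto simp: bmat_def)

text \<open>A change of labels in the inner factor is absorbed into the key. It serves for
  \<open>prod.swap\<close> when the inner factor is braided, and for the relabelling of simple
  objects.\<close>

lemma nestL_comp: "nestL A \<kappa> \<rho> (\<lambda>u k. f (e u k)) N Z t = nestL A (\<lambda>k. \<kappa> (f k)) \<rho> e N Z t"
  by (simp add: fun_eq_iff nestL_def split: prod.split)

lemma nestR_comp: "nestR A \<kappa> \<rho> (\<lambda>u k. f (e u k)) X N t = nestR A (\<lambda>a k. \<kappa> a (f k)) \<rho> e X N t"
  by (simp add: fun_eq_iff nestR_def split: prod.split)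

lemma nth_ty_copiesE:
  assumes "i < ty_tens A N M s"
  obtains x p y q where "ty_copies A N M s ! i = (x, p, y, q)" "x \<in> set (simples A)"
    "y \<in> set (simples A)" "s \<in> fusion A x y" "p < N x" "q < M y"
  using nth_ty_copies[OF assms] by (auto split: prod.splits)

lemma inj2_eq: "bij (case_prod \<kappa>) \<Longrightarrow> \<kappa> k z = \<kappa> k' z' \<longleftrightarrow> k = k' \<and> z = z'"
  using inj_eq[OF bij_is_inj, of "case_prod \<kappa>" "(k, z)" "(k', z')"] by simp

lemma bij_eq: "bij \<rho> \<Longrightarrow> \<rho> u = \<rho> u' \<longleftrightarrow> u = u'"
  by (simp add: bij_is_inj inj_eq)

text \<open>The shape of \<open>ty_braid\<close> with arbitrary scalars. Naturality forces every
  braiding into this shape before the hexagons restrict the scalars.\<close>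

definition gbraid ::
    "('a, 'b) monoid_scheme \<Rightarrow> ('a simple \<Rightarrow> 'a simple \<Rightarrow> 'a simple \<Rightarrow> real) \<Rightarrow>
     'a ty_obj \<Rightarrow> 'a ty_obj \<Rightarrow> 'a ty_arr" where
  "gbraid A c N M = (\<lambda>t.
     let src = ty_copies A N M t; trg = ty_copies A M N t
     in mat (length trg) (length src) (\<lambda>(i, j).
          case src ! j of (x, p, y, q) \<Rightarrow> case trg ! i of (y', q', x', p') \<Rightarrow>
            if (x', p', y', q') = (x, p, y, q) then c x y t else 0))"

lemma ty_braid_eq_gbraid: "ty_braid A \<chi> \<sigma> \<epsilon> = gbraid A (ty_braid_coeff \<chi> \<sigma> \<epsilon>)"
  by (simp add: ty_braid_def gbraid_def fun_eq_iff)

lemma gbraid_alt: "gbraid A c N M t = mat (ty_tens A M N t) (ty_tens A N M t) (\<lambda>(i, j).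
          case ty_copies A N M t ! j of (x, p, y, q) \<Rightarrow> case ty_copies A M N t ! i of (y', q', x', p') \<Rightarrow>
            if (x', p', y', q') = (x, p, y, q) then c x y t else 0)"
  by (simp add: gbraid_def ty_tens_def Let_def)

text \<open>\<open>ty_tens_arr\<close> reads the multiplicities off the dimensions of the matrices;
  here they are named by the source and target objects.\<close>

lemma ty_tens_arr_alt:
  assumes "\<And>s. f s \<in> carrier_mat (N' s) (N s)" "\<And>s. g s \<in> carrier_mat (M' s) (M s)"
  shows "ty_tens_arr A f g s = mat (ty_tens A N' M' s) (ty_tens A N M s) (\<lambda>(i, j).
          case ty_copies A N' M' s ! i of (x', p', y', q') \<Rightarrow> case ty_copies A N M s ! j of (x, p, y, q) \<Rightarrow>
            if x' = x \<and> y' = y then f x $$ (p', p) * g y $$ (q', q) else 0)"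
proof -
  have "(\<lambda>x. dim_col (f x)) = N" "(\<lambda>x. dim_row (f x)) = N'"
    "(\<lambda>x. dim_col (g x)) = M" "(\<lambda>x. dim_row (g x)) = M'"
    using assms by fastforce+
  then show ?thesis by (simp add: ty_tens_arr_def ty_tens_def Let_def)
qed

lemma ty_assoc_alt: "ty_assoc A \<chi> \<tau> N M L t =
     mat (ty_tens A N (ty_tens A M L) t) (ty_tens A (ty_tens A N M) L t) (\<lambda>(i, j).
          case ty_copies A (ty_tens A N M) L t ! j of (u, k, z, r) \<Rightarrow> case ty_copies A N M u ! k of (x, p, y, q) \<Rightarrow>
          case ty_copies A N (ty_tens A M L) t ! i of (x', p', w, l) \<Rightarrow> case ty_copies A M L w ! l of (y', q', z', r') \<Rightarrow>
            if (x', p', y', q', z', r') = (x, p, y, q, z, r)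
            then ty_assoc_coeff \<chi> \<tau> x y z t u w else 0)"
proof -
  have "length (ty_copies A N M s) = ty_tens A N M s" for N M s by (simp add: ty_tens_def)
  then show ?thesis by (simp add: ty_assoc_def Let_def)
qed

text \<open>For use as an inner factor: the whole pair of copies becomes part of the key, so the
  channel is the trivial \<open>()\<close>.\<close>

lemma gbraid_double:
  "gbraid A c N M s = bmat (ty_tens A M N s) (\<lambda>i. (prod.swap (lab A M N s i), ()))
     (ty_tens A N M s) (\<lambda>j. (lab A N M s j, ())) (\<lambda>k _ _. c (fst (fst k)) (fst (snd k)) s)"
proof (rule eq_matI, goal_cases)
  case (1 i j)
  then have "i < ty_tens A M N s" "j < ty_tens A N M s" by auto
  then show ?case
    by (auto simp: gbraid_alt bmat_def lab_def split: prod.splits)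
qed (auto simp: gbraid_alt)

text \<open>The inner morphism acts separately on each simple summand \<open>u\<close> and keeps its
  inner labels. After tensoring with an identity, \<open>u\<close> is the channel, and the product
  is diagonal in it.\<close>

lemma tens_id_right:
  assumes \<kappa>: "bij (case_prod \<kappa>)" and \<rho>: "bij \<rho>"
    and f: "\<And>u. f u = bmat (N' u) (\<lambda>k. (e' u k, ())) (N u) (\<lambda>k. (e u k, ())) (\<lambda>l _ _. b u l)"
    and G: "\<And>u l z r. G (\<kappa> l (z, r)) (\<rho> u) = b u l"
  shows "ty_tens_arr A f (\<lambda>s. 1\<^sub>m (Z s)) t = bmat (ty_tens A N' Z t) (nestL A \<kappa> \<rho> e' N' Z t)
     (ty_tens A N Z t) (nestL A \<kappa> \<rho> e N Z t) (\<lambda>k w v. if w = v then G k v else 0)"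
proof (rule eq_matI, goal_cases)
  case (1 i j)
  have f': "f u \<in> carrier_mat (N' u) (N u)" for u by (simp add: f)
  from 1 have ij: "i < ty_tens A N' Z t" "j < ty_tens A N Z t" by auto
  from nth_ty_copiesE[OF ij(1)] obtain u' k' z' r' where
    i: "ty_copies A N' Z t ! i = (u', k', z', r')" "k' < N' u'" "r' < Z z'" by metis
  from nth_ty_copiesE[OF ij(2)] obtain u k z r where
    j: "ty_copies A N Z t ! j = (u, k, z, r)" "k < N u" "r < Z z" by metis
  show ?case
    using ij i j
    by (auto simp: ty_tens_arr_alt[where N = N and N' = N' and M = Z and M' = Z, OF f'] bmat_def[of "ty_tens A N' Z t"]
        nestL_def inj2_eq[OF \<kappa>] bij_eq[OF \<rho>] G f) (auto simp: bmat_def)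
next
  case 2
  then show ?case by (subst ty_tens_arr_alt[where N = N and N' = N' and M = Z and M' = Z]) (auto simp: f)
next
  case 3
  then show ?case by (subst ty_tens_arr_alt[where N = N and N' = N' and M = Z and M' = Z]) (auto simp: f)
qed

lemma tens_id_left:
  assumes \<kappa>: "bij (case_prod \<kappa>)" and \<rho>: "bij \<rho>"
    and f: "\<And>u. f u = bmat (N' u) (\<lambda>k. (e' u k, ())) (N u) (\<lambda>k. (e u k, ())) (\<lambda>l _ _. b u l)"
    and G: "\<And>u l x p. G (\<kappa> (x, p) l) (\<rho> u) = b u l"
  shows "ty_tens_arr A (\<lambda>s. 1\<^sub>m (X s)) f t = bmat (ty_tens A X N' t) (nestR A \<kappa> \<rho> e' X N' t)
     (ty_tens A X N t) (nestR A \<kappa> \<rho> e X N t) (\<lambda>k w v. if w = v then G k v else 0)"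
proof (rule eq_matI, goal_cases)
  case (1 i j)
  have f': "f u \<in> carrier_mat (N' u) (N u)" for u by (simp add: f)
  from 1 have ij: "i < ty_tens A X N' t" "j < ty_tens A X N t" by auto
  from nth_ty_copiesE[OF ij(1)] obtain x' p' w' l' where
    i: "ty_copies A X N' t ! i = (x', p', w', l')" "l' < N' w'" "p' < X x'" by metis
  from nth_ty_copiesE[OF ij(2)] obtain x p w l where
    j: "ty_copies A X N t ! j = (x, p, w, l)" "l < N w" "p < X x" by metis
  show ?case
    using ij i j
    by (auto simp: ty_tens_arr_alt[where N = X and N' = X and M = N and M' = N', OF _ f'] bmat_def[of "ty_tens A X N' t"]
        nestR_def inj2_eq[OF \<kappa>] bij_eq[OF \<rho>] G f) (auto simp: bmat_def)
next
  case 2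
  then show ?case by (subst ty_tens_arr_alt[where N = X and N' = X and M = N and M' = N']) (auto simp: f)
next
  case 3
  then show ?case by (subst ty_tens_arr_alt[where N = X and N' = X and M = N and M' = N']) (auto simp: f)
qed

text \<open>Braiding \<open>X\<close> past a product sees only the simple constituent
  \<open>u\<close> of that product. The inner labels of the product are carried along in the key,
  and the scalar is \<open>c x u t\<close>.\<close>

lemma gbraid_nestR:
  assumes \<kappa>: "bij (case_prod \<kappa>)" and \<rho>: "bij \<rho>"
    and e: "\<And>u. u \<in> set (simples A) \<Longrightarrow> bij_betw (e u) {..<N u} (E u)"
    and G: "\<And>u l x p. G (\<kappa> (x, p) l) (\<rho> u) = c x u t"
  shows "gbraid A c X N t = bmat (ty_tens A N X t) (nestL A (\<lambda>k a. \<kappa> a k) \<rho> e N X t)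
     (ty_tens A X N t) (nestR A \<kappa> \<rho> e X N t) (\<lambda>k w v. if w = v then G k v else 0)"
proof (rule eq_matI, goal_cases)
  case (1 i j)
  have e_eq: "u \<in> set (simples A) \<Longrightarrow> k < N u \<Longrightarrow> k' < N u \<Longrightarrow> e u k = e u k' \<longleftrightarrow> k = k'" for u k k'
    using e[of u] by (auto simp: bij_betw_def inj_on_def)
  from 1 have ij: "i < ty_tens A N X t" "j < ty_tens A X N t" by auto
  from nth_ty_copiesE[OF ij(1)] obtain x' p' w' l' where
    i: "ty_copies A N X t ! i = (w', l', x', p')" "l' < N w'" "p' < X x'" "w' \<in> set (simples A)" by metis
  from nth_ty_copiesE[OF ij(2)] obtain x p w l where
    j: "ty_copies A X N t ! j = (x, p, w, l)" "l < N w" "p < X x" "w \<in> set (simples A)" by metis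
  show ?case
    using ij i j
    by (auto simp: gbraid_alt bmat_def nestR_def nestL_def inj2_eq[OF \<kappa>] bij_eq[OF \<rho>] G e_eq)
qed (auto simp: gbraid_alt)

lemma gbraid_nestL:
  assumes \<kappa>: "bij (case_prod \<kappa>)" and \<rho>: "bij \<rho>"
    and e: "\<And>u. u \<in> set (simples A) \<Longrightarrow> bij_betw (e u) {..<N u} (E u)"
    and G: "\<And>u l z r. G (\<kappa> l (z, r)) (\<rho> u) = c u z t"
  shows "gbraid A c N Z t = bmat (ty_tens A Z N t) (nestR A (\<lambda>a k. \<kappa> k a) \<rho> e Z N t)
     (ty_tens A N Z t) (nestL A \<kappa> \<rho> e N Z t) (\<lambda>k w v. if w = v then G k v else 0)"
proof (rule eq_matI, goal_cases)
  case (1 i j)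
  have e_eq: "u \<in> set (simples A) \<Longrightarrow> k < N u \<Longrightarrow> k' < N u \<Longrightarrow> e u k = e u k' \<longleftrightarrow> k = k'" for u k k'
    using e[of u] by (auto simp: bij_betw_def inj_on_def)
  from 1 have ij: "i < ty_tens A Z N t" "j < ty_tens A N Z t" by auto
  from nth_ty_copiesE[OF ij(1)] obtain x' p' w' l' where
    i: "ty_copies A Z N t ! i = (x', p', w', l')" "l' < N w'" "p' < Z x'" "w' \<in> set (simples A)" by metis
  from nth_ty_copiesE[OF ij(2)] obtain x p w l where
    j: "ty_copies A N Z t ! j = (w, l, x, p)" "l < N w" "p < Z x" "w \<in> set (simples A)" by metis
  show ?case
    using ij i j
    by (auto simp: gbraid_alt bmat_def nestR_def nestL_def inj2_eq[OF \<kappa>] bij_eq[OF \<rho>] G e_eq)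
qed (auto simp: gbraid_alt)

text \<open>The associator keeps the three copies that are multiplied, hence the key, and is the one
  structure morphism that mixes channels.\<close>

lemma ty_assoc_nest:
  assumes \<kappa>: "bij (\<lambda>(a, b, c). \<kappa> a b c)" and \<rho>: "bij \<rho>"
    and G: "\<And>x p y q z r u w. G (\<kappa> (x, p) (y, q) (z, r)) (\<rho> w) (\<rho> u) = ty_assoc_coeff \<chi> \<tau> x y z t u w"
  shows "ty_assoc A \<chi> \<tau> X Y Z t =
     bmat (ty_tens A X (ty_tens A Y Z) t) (nestR A (\<lambda>a k. \<kappa> a (fst k) (snd k)) \<rho> (lab A Y Z) X (ty_tens A Y Z) t)
       (ty_tens A (ty_tens A X Y) Z t) (nestL A (\<lambda>k c. \<kappa> (fst k) (snd k) c) \<rho> (lab A X Y) (ty_tens A X Y) Z t) G"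
proof (rule eq_matI, goal_cases)
  case (1 i j)
  have \<kappa>_eq: "\<kappa> a b c = \<kappa> a' b' c' \<longleftrightarrow> a = a' \<and> b = b' \<and> c = c'" for a b c a' b' c'
    using inj_eq[OF bij_is_inj[OF \<kappa>], of "(a, b, c)" "(a', b', c')"] by simp
  from 1 have ij: "i < ty_tens A X (ty_tens A Y Z) t" "j < ty_tens A (ty_tens A X Y) Z t" by auto
  obtain x' p' w l where i: "ty_copies A X (ty_tens A Y Z) t ! i = (x', p', w, l)" by (metis prod_cases4)
  obtain y' q' z' r' where i': "ty_copies A Y Z w ! l = (y', q', z', r')" by (metis prod_cases4)
  obtain u k z r where j: "ty_copies A (ty_tens A X Y) Z t ! j = (u, k, z, r)" by (metis prod_cases4)
  obtain x p y q where j': "ty_copies A X Y u ! k = (x, p, y, q)" by (metis prod_cases4)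
  show ?case
    using ij i i' j j'
    by (auto simp: ty_assoc_alt bmat_def nestR_def nestL_def lab_def \<kappa>_eq G)
qed (auto simp: ty_assoc_alt)

text \<open>A second labelling, for naturality: an arrow preserves simple types and mixes copies, so
  here the types are the key and the copy numbers the channel.\<close>

definition labP where
  "labP A \<mu> \<nu> N M s i = (case ty_copies A N M s ! i of (x, p, y, q) \<Rightarrow> (\<mu> (x, y), \<nu> (p, q)))"

lemma basis_labP:
  assumes "distinct (simples A)" and \<mu>: "bij \<mu>" and \<nu>: "bij \<nu>"
    and U: "\<And>x y p q. \<nu> (p, q) \<in> U (\<mu> (x, y)) \<longleftrightarrow> x \<in> set (simples A) \<and> y \<in> set (simples A) \<and>
              s \<in> fusion A x y \<and> p < N x \<and> q < M y"
  shows "basis (labP A \<mu> \<nu> N M s) (ty_tens A N M s) U"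
proof -
  have "bij_betw (\<lambda>(x, p, y, q). (\<mu> (x, y), \<nu> (p, q))) (set (ty_copies A N M s)) (Sigma UNIV U)"
    unfolding bij_betw_def
  proof
    show "inj_on (\<lambda>(x, p, y, q). (\<mu> (x, y), \<nu> (p, q))) (set (ty_copies A N M s))"
      unfolding inj_on_def set_ty_copies by (auto simp: bij_eq[OF \<mu>] bij_eq[OF \<nu>])
    show "(\<lambda>(x, p, y, q). (\<mu> (x, y), \<nu> (p, q))) ` set (ty_copies A N M s) = Sigma UNIV U"
    proof (intro equalityI subsetI)
      fix k assume "k \<in> (\<lambda>(x, p, y, q). (\<mu> (x, y), \<nu> (p, q))) ` set (ty_copies A N M s)"
      then show "k \<in> Sigma UNIV U" by (auto simp: set_ty_copies U)
    next
      fix k assume k: "k \<in> Sigma UNIV U"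
      obtain x y p q where "k = (\<mu> (x, y), \<nu> (p, q))"
        using \<mu> \<nu> by (cases k) (metis bij_pointE surj_pair)
      then show "k \<in> (\<lambda>(x, p, y, q). (\<mu> (x, y), \<nu> (p, q))) ` set (ty_copies A N M s)"
        using k by (intro image_eqI[of _ _ "(x, p, y, q)"]) (auto simp: set_ty_copies U)
    qed
  qed
  note b = this
  have "labP A \<mu> \<nu> N M s = (\<lambda>(x, p, y, q). (\<mu> (x, y), \<nu> (p, q))) \<circ> (!) (ty_copies A N M s)"
    by (simp add: fun_eq_iff labP_def split: prod.split)
  then show ?thesis
    unfolding basis_def by (simp only: bij_betw_trans[OF bij_ty_copies[OF assms(1)] b])
qed

lemma ty_tens_arr_labP:
  assumes \<mu>: "bij \<mu>"
    and f: "\<And>s. f s \<in> carrier_mat (N' s) (N s)" and g: "\<And>s. g s \<in> carrier_mat (M' s) (M s)"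
    and F: "\<And>x y p q p' q'. F (\<mu> (x, y)) (\<nu> (p', q')) (\<nu> (p, q)) = f x $$ (p', p) * g y $$ (q', q)"
  shows "ty_tens_arr A f g s = bmat (ty_tens A N' M' s) (labP A \<mu> \<nu> N' M' s)
     (ty_tens A N M s) (labP A \<mu> \<nu> N M s) F"
proof (rule eq_matI, goal_cases)
  case (1 i j)
  then have ij: "i < ty_tens A N' M' s" "j < ty_tens A N M s" by auto
  obtain x p y q where j: "ty_copies A N M s ! j = (x, p, y, q)" by (metis prod_cases4)
  obtain x' p' y' q' where i: "ty_copies A N' M' s ! i = (x', p', y', q')" by (metis prod_cases4)
  show ?case
    using ij i j by (auto simp: ty_tens_arr_alt[OF f g] bmat_def labP_def bij_eq[OF \<mu>] F)
qed (auto simp: ty_tens_arr_alt[OF f g])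

lemma gbraid_labP:
  assumes \<mu>: "bij \<mu>" and \<nu>: "bij \<nu>"
    and F: "\<And>x y. F (\<mu> (x, y)) = c x y s"
  shows "gbraid A c N M s = bmat (ty_tens A M N s) (labP A (\<mu> \<circ> prod.swap) (\<nu> \<circ> prod.swap) M N s)
     (ty_tens A N M s) (labP A \<mu> \<nu> N M s) (\<lambda>k w v. if w = v then F k else 0)"
proof (rule eq_matI, goal_cases)
  case (1 i j)
  then have ij: "i < ty_tens A M N s" "j < ty_tens A N M s" by auto
  obtain x p y q where j: "ty_copies A N M s ! j = (x, p, y, q)" by (metis prod_cases4)
  obtain x' p' y' q' where i: "ty_copies A M N s ! i = (x', p', y', q')" by (metis prod_cases4)
  show ?case
    using ij i j by (auto simp: gbraid_alt bmat_def labP_def bij_eq[OF \<mu>] bij_eq[OF \<nu>] F)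
qed (auto simp: gbraid_alt)

section \<open>Hexagons on simple objects\<close>

text \<open>The channels index bases of the multiplicity spaces of \<open>t\<close> in (x y) z and
  in x (y z).\<close>

definition channelL where "channelL A x y z t = {u \<in> fusion A x y. t \<in> fusion A u z}"
definition channelR where "channelR A x y z t = {w \<in> fusion A y z. t \<in> fusion A x w}"

definition valid where
  "valid A X Y Z k = (case k of ((x, p), (y, q), (z, r)) \<Rightarrow>
     x \<in> set (simples A) \<and> y \<in> set (simples A) \<and> z \<in> set (simples A) \<and> p < X x \<and> q < Y y \<and> r < Z z)"

locale ty_group = comm_group G for G (structure) +
  assumes fin: "finite (carrier G)"
begin

lemma simples_some: "distinct (SOME as. distinct as \<and> set as = carrier G) \<and>
    set (SOME as. distinct as \<and> set as = carrier G) = carrier G"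
  by (rule someI_ex) (use finite_distinct_list[OF fin] in blast)

lemma set_simples: "set (simples G) = insert Mid (Inv ` carrier G)"
  using simples_some by (auto simp: simples_def)

lemma distinct_simples: "distinct (simples G)"
  using simples_some by (auto simp: simples_def distinct_map inj_on_def)

lemma fusion_simples: "x \<in> set (simples G) \<Longrightarrow> y \<in> set (simples G) \<Longrightarrow> u \<in> fusion G x y \<Longrightarrow> u \<in> set (simples G)"
  by (cases x; cases y) (auto simp: set_simples)

lemma fusion_comm: "x \<in> set (simples G) \<Longrightarrow> y \<in> set (simples G) \<Longrightarrow> fusion G x y = fusion G y x"
  by (cases x; cases y) (auto simp: set_simples m_comm)

text \<open>The fusion rules are commutative. Hence the source and the target of a braiding share
  one family of channels, as the diagonal form requires.\<close>

lemma channelL_rot: "x \<in> set (simples G) \<Longrightarrow> y \<in> set (simples G) \<Longrightarrow> z \<in> set (simples G) \<Longrightarrow>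
    channelL G x y z t = channelR G z x y t"
  unfolding channelL_def channelR_def by (metis fusion_comm fusion_simples)

lemma channelL_swap: "x \<in> set (simples G) \<Longrightarrow> y \<in> set (simples G) \<Longrightarrow> channelL G x y z t = channelL G y x z t"
  unfolding channelL_def by (metis fusion_comm)

lemma channelR_swap: "y \<in> set (simples G) \<Longrightarrow> z \<in> set (simples G) \<Longrightarrow> channelR G x y z t = channelR G x z y t"
  unfolding channelR_def by (metis fusion_comm)

text \<open>The parameter \<open>\<kappa>\<close> lets the key list the three copies in another
  order than the factors, so that all vertices of a hexagon can be keyed alike.\<close>

lemma basis_L:
  assumes \<kappa>: "bij (\<lambda>(a, b, c). \<kappa> a b c)" and \<rho>: "bij \<rho>"
    and U: "\<And>x p y q z r u. \<rho> u \<in> U (\<kappa> (x, p) (y, q) (z, r)) \<longleftrightarrow>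
      valid G X Y Z ((x, p), (y, q), (z, r)) \<and> u \<in> channelL G x y z t"
  shows "basis (nestL G (\<lambda>k c. \<kappa> (fst k) (snd k) c) \<rho> (lab G X Y) (ty_tens G X Y) Z t)
    (ty_tens G (ty_tens G X Y) Z t) U"
proof (rule basis_nestL[OF distinct_simples bij_lab[OF distinct_simples] _ \<rho>])
  have "bij ((\<lambda>(a, b, c). \<kappa> a b c) \<circ> (\<lambda>(k, c). (fst k, snd k, c)))"
    by (rule bij_comp[OF _ \<kappa>]) (rule bij_betw_byWitness[where f' = "\<lambda>(a, b, c). ((a, b), c)"], auto)
  then show "bij (\<lambda>(k, c). \<kappa> (fst k) (snd k) c)"
    by (simp add: comp_def case_prod_unfold)
qed (auto simp: U labels_def valid_def channelL_def dest: fusion_simples)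

lemma basis_R:
  assumes \<kappa>: "bij (\<lambda>(a, b, c). \<kappa> a b c)" and \<rho>: "bij \<rho>"
    and U: "\<And>x p y q z r u. \<rho> u \<in> U (\<kappa> (x, p) (y, q) (z, r)) \<longleftrightarrow>
      valid G X Y Z ((x, p), (y, q), (z, r)) \<and> u \<in> channelR G x y z t"
  shows "basis (nestR G (\<lambda>a k. \<kappa> a (fst k) (snd k)) \<rho> (lab G Y Z) X (ty_tens G Y Z) t)
    (ty_tens G X (ty_tens G Y Z) t) U"
proof (rule basis_nestR[OF distinct_simples bij_lab[OF distinct_simples] _ \<rho>])
  have "bij ((\<lambda>(a, b, c). \<kappa> a b c) \<circ> (\<lambda>(a, k). (a, fst k, snd k)))"
    by (rule bij_comp[OF _ \<kappa>]) (rule bij_betw_byWitness[where f' = "\<lambda>(a, b, c). (a, (b, c))"], auto)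
  then show "bij (\<lambda>(a, k). \<kappa> a (fst k) (snd k))"
    by (simp add: comp_def case_prod_unfold)
qed (auto simp: U labels_def valid_def channelR_def dest: fusion_simples)

end

lemma bij_perms:
  "bij (\<lambda>(a, b, c). (a, b, c))" "bij (\<lambda>(b, c, a). (a, b, c))" "bij (\<lambda>(b, a, c). (a, b, c))"
  "bij (\<lambda>(c, a, b). (a, b, c))" "bij (\<lambda>(a, c, b). (a, b, c))"
  "bij (\<lambda>(a, k). (a, fst k, snd k))" "bij (\<lambda>(k, c). (fst k, snd k, c))"
  "bij (\<lambda>(b, k). (fst k, b, snd k))" "bij (\<lambda>(k, b). (fst k, b, snd k))"
  by (auto simp: bij_def inj_def surj_def)

text \<open>These are the properties of \<open>K4_pow n\<close> and \<open>h_pow n\<close> on which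
  the classification rests. Since \<open>\<chi>\<close> is alternating as well as symmetric, forms
  are \<plusminus>1-valued and transvections preserve it.\<close>

locale real_ty = ty_group G for G :: "('a, 'b) monoid_scheme" (structure) +
  fixes \<chi> :: "'a \<Rightarrow> 'a \<Rightarrow> real" and \<tau> :: real
  assumes \<chi>_unit: "x \<in> carrier G \<Longrightarrow> y \<in> carrier G \<Longrightarrow> \<chi> x y = 1 \<or> \<chi> x y = - 1"
    and \<chi>_mult: "x \<in> carrier G \<Longrightarrow> y \<in> carrier G \<Longrightarrow> z \<in> carrier G \<Longrightarrow> \<chi> (x \<otimes> y) z = \<chi> x z * \<chi> y z"
    and \<chi>_sym: "x \<in> carrier G \<Longrightarrow> y \<in> carrier G \<Longrightarrow> \<chi> x y = \<chi> y x"
    and \<chi>_self: "x \<in> carrier G \<Longrightarrow> \<chi> x x = 1"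
    and \<chi>_nondeg: "x \<in> carrier G \<Longrightarrow> (\<And>y. y \<in> carrier G \<Longrightarrow> \<chi> x y = 1) \<Longrightarrow> x = \<one>"
    and \<tau>_sq: "\<tau> * \<tau> * real (card (carrier G)) = 1"
begin

abbreviation "\<alpha> \<equiv> ty_assoc_coeff \<chi> \<tau>"

text \<open>The coefficient of the first hexagon from the channel \<open>u\<close> of (x y) z to the
  channel \<open>w\<close> of y (z x). The right side has no sum because its outer factors are
  diagonal in the channels.\<close>

definition hex1 where
  "hex1 c x y z t \<longleftrightarrow> (\<forall>u\<in>channelL G x y z t. \<forall>w\<in>channelR G y z x t.
     (\<Sum>v\<in>channelR G x y z t. \<alpha> y z x t v w * c x v t * \<alpha> x y z t u v) = c x z w * \<alpha> y x z t u w * c x y u)"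

text \<open>The inverse associators are transposes, so their coefficients are again
  \<open>\<alpha>\<close>, now read from \<open>w\<close> back to \<open>u\<close>, and the sum runs
  over left channels.\<close>

definition hex2 where
  "hex2 c x y z t \<longleftrightarrow> (\<forall>w\<in>channelR G x y z t. \<forall>u\<in>channelL G z x y t.
     (\<Sum>v\<in>channelL G x y z t. \<alpha> z x y t u v * c v z t * \<alpha> x y z t v w) = c x z u * \<alpha> x z y t u w * c y z w)"

text \<open>Both composites are labelled matrices over the same key and outer channels, so their
  equality is \<open>hex1\<close> at every triple of simple objects that has copies in
  \<open>X\<close>, \<open>Y\<close>, \<open>Z\<close>.\<close>

lemma hex1_component:
  "ty_assoc G \<chi> \<tau> Y Z X t * gbraid G c X (ty_tens G Y Z) t * ty_assoc G \<chi> \<tau> X Y Z t =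
   ty_tens_arr G (\<lambda>s. 1\<^sub>m (Y s)) (gbraid G c X Z) t * ty_assoc G \<chi> \<tau> Y X Z t *
   ty_tens_arr G (gbraid G c X Y) (\<lambda>s. 1\<^sub>m (Z s)) t
   \<longleftrightarrow> (\<forall>x p y q z r. valid G X Y Z ((x, p), (y, q), (z, r)) \<longrightarrow> hex1 c x y z t)"
proof -
  \<comment> \<open>The six vertices of the hexagon, all keyed in the order X, Y, Z. A braiding
    preserves channels, so the vertices fall into three pairs with the channel families
    \<open>UL\<close>, \<open>UR\<close> and \<open>UM\<close> below.\<close>
  let ?L1 = "nestL G (\<lambda>k c. (fst k, snd k, c)) id (lab G X Y) (ty_tens G X Y) Z t"
  let ?R1 = "nestR G (\<lambda>a k. (a, fst k, snd k)) id (lab G Y Z) X (ty_tens G Y Z) t"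
  let ?L2 = "nestL G (\<lambda>k a. (a, fst k, snd k)) id (lab G Y Z) (ty_tens G Y Z) X t"
  let ?R2 = "nestR G (\<lambda>b k. (snd k, b, fst k)) id (lab G Z X) Y (ty_tens G Z X) t"
  let ?L3 = "nestL G (\<lambda>k c. (snd k, fst k, c)) id (lab G Y X) (ty_tens G Y X) Z t"
  let ?R3 = "nestR G (\<lambda>b k. (fst k, b, snd k)) id (lab G X Z) Y (ty_tens G X Z) t"
  define UL where "UL = (\<lambda>k. if valid G X Y Z k then channelL G (fst (fst k)) (fst (fst (snd k))) (fst (snd (snd k))) t else {})"
  define UR where "UR = (\<lambda>k. if valid G X Y Z k then channelR G (fst (fst k)) (fst (fst (snd k))) (fst (snd (snd k))) t else {})"
  define UM where "UM = (\<lambda>k. if valid G X Y Z k then channelR G (fst (fst (snd k))) (fst (snd (snd k))) (fst (fst k)) t else {})"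
  note bij = bij_perms bij_id
  have L1: "basis ?L1 (ty_tens G (ty_tens G X Y) Z t) UL"
    by (rule basis_L[where \<kappa> = "\<lambda>a b c. (a, b, c)"]) (auto simp: bij UL_def)
  have R1: "basis ?R1 (ty_tens G X (ty_tens G Y Z) t) UR"
    by (rule basis_R[where \<kappa> = "\<lambda>a b c. (a, b, c)"]) (auto simp: bij UR_def)
  have L2: "basis ?L2 (ty_tens G (ty_tens G Y Z) X t) UR"
    by (rule basis_L[where \<kappa> = "\<lambda>b c a. (a, b, c)"])
      (auto simp: bij UR_def valid_def channelL_rot)
  have R2: "basis ?R2 (ty_tens G Y (ty_tens G Z X) t) UM"
    by (rule basis_R[where \<kappa> = "\<lambda>b c a. (a, b, c)"]) (auto simp: bij UM_def valid_def)
  have L3: "basis ?L3 (ty_tens G (ty_tens G Y X) Z t) UL"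
    by (rule basis_L[where \<kappa> = "\<lambda>b a c. (a, b, c)"]) (auto simp: bij UL_def valid_def channelL_swap)
  have R3: "basis ?R3 (ty_tens G Y (ty_tens G X Z) t) UM"
    by (rule basis_R[where \<kappa> = "\<lambda>b a c. (a, b, c)"]) (auto simp: bij UM_def valid_def channelR_swap)
  have a1: "ty_assoc G \<chi> \<tau> X Y Z t = bmat (ty_tens G X (ty_tens G Y Z) t) ?R1 (ty_tens G (ty_tens G X Y) Z t) ?L1
     (\<lambda>k w u. \<alpha> (fst (fst k)) (fst (fst (snd k))) (fst (snd (snd k))) t u w)"
    by (rule ty_assoc_nest[where \<kappa> = "\<lambda>a b c. (a, b, c)"]) (auto simp: bij)
  have a2: "ty_assoc G \<chi> \<tau> Y Z X t = bmat (ty_tens G Y (ty_tens G Z X) t) ?R2 (ty_tens G (ty_tens G Y Z) X t) ?L2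
     (\<lambda>k w u. \<alpha> (fst (fst (snd k))) (fst (snd (snd k))) (fst (fst k)) t u w)"
    by (rule ty_assoc_nest[where \<kappa> = "\<lambda>b c a. (a, b, c)"]) (auto simp: bij)
  have a3: "ty_assoc G \<chi> \<tau> Y X Z t = bmat (ty_tens G Y (ty_tens G X Z) t) ?R3 (ty_tens G (ty_tens G Y X) Z t) ?L3
     (\<lambda>k w u. \<alpha> (fst (fst (snd k))) (fst (fst k)) (fst (snd (snd k))) t u w)"
    by (rule ty_assoc_nest[where \<kappa> = "\<lambda>b a c. (a, b, c)"]) (auto simp: bij)
  have b1: "gbraid G c X (ty_tens G Y Z) t = bmat (ty_tens G (ty_tens G Y Z) X t) ?L2 (ty_tens G X (ty_tens G Y Z) t) ?R1
     (\<lambda>k w v. if w = v then c (fst (fst k)) v t else 0)"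
    by (rule gbraid_nestR[where \<kappa> = "\<lambda>a k. (a, fst k, snd k)", OF _ _ bij_lab[OF distinct_simples]]) (auto simp: bij)
  have b2: "ty_tens_arr G (gbraid G c X Y) (\<lambda>s. 1\<^sub>m (Z s)) t =
     bmat (ty_tens G (ty_tens G Y X) Z t) ?L3 (ty_tens G (ty_tens G X Y) Z t) ?L1
     (\<lambda>k w v. if w = v then c (fst (fst k)) (fst (fst (snd k))) v else 0)"
    \<comment> \<open>The target labels of the inner braiding are swapped; \<open>nestL_comp\<close>
      moves the swap into the key.\<close>
    using tens_id_right[where A = G and \<kappa> = "\<lambda>k c. (fst k, snd k, c)" and \<rho> = id and f = "gbraid G c X Y" and
        b = "\<lambda>u l. c (fst (fst l)) (fst (snd l)) u" and e = "lab G X Y" and N = "ty_tens G X Y" and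
        e' = "\<lambda>u i. prod.swap (lab G Y X u i)" and N' = "ty_tens G Y X", OF _ _ gbraid_double,
        where G = "\<lambda>k v. c (fst (fst k)) (fst (fst (snd k))) v" and Z = Z and t = t]
    by (simp add: bij nestL_comp[where f = prod.swap])
  have b3: "ty_tens_arr G (\<lambda>s. 1\<^sub>m (Y s)) (gbraid G c X Z) t =
     bmat (ty_tens G Y (ty_tens G Z X) t) ?R2 (ty_tens G Y (ty_tens G X Z) t) ?R3
     (\<lambda>k w v. if w = v then c (fst (fst k)) (fst (snd (snd k))) v else 0)"
    using tens_id_left[where A = G and \<kappa> = "\<lambda>b k. (fst k, b, snd k)" and \<rho> = id and f = "gbraid G c X Z" and
        b = "\<lambda>u l. c (fst (fst l)) (fst (snd l)) u" and e = "lab G X Z" and N = "ty_tens G X Z" and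
        e' = "\<lambda>u i. prod.swap (lab G Z X u i)" and N' = "ty_tens G Z X", OF _ _ gbraid_double,
        where G = "\<lambda>k v. c (fst (fst k)) (fst (snd (snd k))) v" and X = Y and t = t]
    by (simp add: bij nestR_comp[where f = prod.swap])
  show ?thesis
    unfolding a1 a2 a3 b1 b2 b3 bmat_mult_diag[OF L2 R1] bmat_mult[OF R1]
      bmat_diag_mult[OF R3 R2] bmat_mult_diag[OF L3 L1] bmat_eq_iff[OF R2 L1]
    by (auto simp: UL_def UR_def UM_def hex1_def)
qed

text \<open>The same reduction for the other hexagon. Its vertices pair up along the braidings
  again, but the sum is now over the left-bracketed object (X Y) Z.\<close>

lemma hex2_component:
  "transpose_mat (ty_assoc G \<chi> \<tau> Z X Y t) * gbraid G c (ty_tens G X Y) Z t * transpose_mat (ty_assoc G \<chi> \<tau> X Y Z t) =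
   ty_tens_arr G (gbraid G c X Z) (\<lambda>s. 1\<^sub>m (Y s)) t * transpose_mat (ty_assoc G \<chi> \<tau> X Z Y t) *
   ty_tens_arr G (\<lambda>s. 1\<^sub>m (X s)) (gbraid G c Y Z) t
   \<longleftrightarrow> (\<forall>x p y q z r. valid G X Y Z ((x, p), (y, q), (z, r)) \<longrightarrow> hex2 c x y z t)"
proof -
  let ?L1 = "nestL G (\<lambda>k c. (fst k, snd k, c)) id (lab G X Y) (ty_tens G X Y) Z t"
  let ?R1 = "nestR G (\<lambda>a k. (a, fst k, snd k)) id (lab G Y Z) X (ty_tens G Y Z) t"
  let ?R4 = "nestR G (\<lambda>c k. (fst k, snd k, c)) id (lab G X Y) Z (ty_tens G X Y) t"
  let ?L4 = "nestL G (\<lambda>k b. (snd k, b, fst k)) id (lab G Z X) (ty_tens G Z X) Y t"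
  let ?R5 = "nestR G (\<lambda>a k. (a, snd k, fst k)) id (lab G Z Y) X (ty_tens G Z Y) t"
  let ?L5 = "nestL G (\<lambda>k b. (fst k, b, snd k)) id (lab G X Z) (ty_tens G X Z) Y t"
  define UL where "UL = (\<lambda>k. if valid G X Y Z k then channelL G (fst (fst k)) (fst (fst (snd k))) (fst (snd (snd k))) t else {})"
  define UR where "UR = (\<lambda>k. if valid G X Y Z k then channelR G (fst (fst k)) (fst (fst (snd k))) (fst (snd (snd k))) t else {})"
  define UM where "UM = (\<lambda>k. if valid G X Y Z k then channelL G (fst (snd (snd k))) (fst (fst k)) (fst (fst (snd k))) t else {})"
  note bij = bij_perms bij_id
  have L1: "basis ?L1 (ty_tens G (ty_tens G X Y) Z t) UL"
    by (rule basis_L[where \<kappa> = "\<lambda>a b c. (a, b, c)"]) (auto simp: bij UL_def)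
  have R1: "basis ?R1 (ty_tens G X (ty_tens G Y Z) t) UR"
    by (rule basis_R[where \<kappa> = "\<lambda>a b c. (a, b, c)"]) (auto simp: bij UR_def)
  have R4: "basis ?R4 (ty_tens G Z (ty_tens G X Y) t) UL"
    by (rule basis_R[where \<kappa> = "\<lambda>c a b. (a, b, c)"])
      (auto simp: bij UL_def valid_def channelL_rot)
  have L4: "basis ?L4 (ty_tens G (ty_tens G Z X) Y t) UM"
    by (rule basis_L[where \<kappa> = "\<lambda>c a b. (a, b, c)"]) (auto simp: bij UM_def valid_def)
  have R5: "basis ?R5 (ty_tens G X (ty_tens G Z Y) t) UR"
    by (rule basis_R[where \<kappa> = "\<lambda>a c b. (a, b, c)"]) (auto simp: bij UR_def valid_def channelR_swap)
  have L5: "basis ?L5 (ty_tens G (ty_tens G X Z) Y t) UM"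
    by (rule basis_L[where \<kappa> = "\<lambda>a c b. (a, b, c)"]) (auto simp: bij UM_def valid_def channelL_swap)
  have a1: "ty_assoc G \<chi> \<tau> X Y Z t = bmat (ty_tens G X (ty_tens G Y Z) t) ?R1 (ty_tens G (ty_tens G X Y) Z t) ?L1
     (\<lambda>k w u. \<alpha> (fst (fst k)) (fst (fst (snd k))) (fst (snd (snd k))) t u w)"
    by (rule ty_assoc_nest[where \<kappa> = "\<lambda>a b c. (a, b, c)"]) (auto simp: bij)
  have a2: "ty_assoc G \<chi> \<tau> Z X Y t = bmat (ty_tens G Z (ty_tens G X Y) t) ?R4 (ty_tens G (ty_tens G Z X) Y t) ?L4
     (\<lambda>k w u. \<alpha> (fst (snd (snd k))) (fst (fst k)) (fst (fst (snd k))) t u w)"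
    by (rule ty_assoc_nest[where \<kappa> = "\<lambda>c a b. (a, b, c)"]) (auto simp: bij)
  have a3: "ty_assoc G \<chi> \<tau> X Z Y t = bmat (ty_tens G X (ty_tens G Z Y) t) ?R5 (ty_tens G (ty_tens G X Z) Y t) ?L5
     (\<lambda>k w u. \<alpha> (fst (fst k)) (fst (snd (snd k))) (fst (fst (snd k))) t u w)"
    by (rule ty_assoc_nest[where \<kappa> = "\<lambda>a c b. (a, b, c)"]) (auto simp: bij)
  have b1: "gbraid G c (ty_tens G X Y) Z t = bmat (ty_tens G Z (ty_tens G X Y) t) ?R4 (ty_tens G (ty_tens G X Y) Z t) ?L1
     (\<lambda>k w v. if w = v then c v (fst (snd (snd k))) t else 0)"
    by (rule gbraid_nestL[where \<kappa> = "\<lambda>k c. (fst k, snd k, c)", OF _ _ bij_lab[OF distinct_simples]]) (auto simp: bij)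
  have b2: "ty_tens_arr G (gbraid G c X Z) (\<lambda>s. 1\<^sub>m (Y s)) t =
     bmat (ty_tens G (ty_tens G Z X) Y t) ?L4 (ty_tens G (ty_tens G X Z) Y t) ?L5
     (\<lambda>k w v. if w = v then c (fst (fst k)) (fst (snd (snd k))) v else 0)"
    using tens_id_right[where A = G and \<kappa> = "\<lambda>k b. (fst k, b, snd k)" and \<rho> = id and f = "gbraid G c X Z" and
        b = "\<lambda>u l. c (fst (fst l)) (fst (snd l)) u" and e = "lab G X Z" and N = "ty_tens G X Z" and
        e' = "\<lambda>u i. prod.swap (lab G Z X u i)" and N' = "ty_tens G Z X", OF _ _ gbraid_double,
        where G = "\<lambda>k v. c (fst (fst k)) (fst (snd (snd k))) v" and Z = Y and t = t]
    by (simp add: bij nestL_comp[where f = prod.swap])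
  have b3: "ty_tens_arr G (\<lambda>s. 1\<^sub>m (X s)) (gbraid G c Y Z) t =
     bmat (ty_tens G X (ty_tens G Z Y) t) ?R5 (ty_tens G X (ty_tens G Y Z) t) ?R1
     (\<lambda>k w v. if w = v then c (fst (fst (snd k))) (fst (snd (snd k))) v else 0)"
    using tens_id_left[where A = G and \<kappa> = "\<lambda>a k. (a, fst k, snd k)" and \<rho> = id and f = "gbraid G c Y Z" and
        b = "\<lambda>u l. c (fst (fst l)) (fst (snd l)) u" and e = "lab G Y Z" and N = "ty_tens G Y Z" and
        e' = "\<lambda>u i. prod.swap (lab G Z Y u i)" and N' = "ty_tens G Z Y", OF _ _ gbraid_double,
        where G = "\<lambda>k v. c (fst (fst (snd k))) (fst (snd (snd k))) v" and X = X and t = t]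
    by (simp add: bij nestR_comp[where f = prod.swap]) (simp add: prod.swap_def)
  show ?thesis
    unfolding a1 a2 a3 b1 b2 b3 transpose_bmat bmat_mult_diag[OF R4 L1] bmat_mult[OF L1]
      bmat_diag_mult[OF L5 L4] bmat_mult_diag[OF R5 R1] bmat_eq_iff[OF L4 R1]
    by (auto simp: UL_def UR_def UM_def hex2_def)
qed

end

section \<open>Character sums, channels and orthogonality of the associator\<close>

context ty_group
begin

text \<open>Translation by \<open>b\<close> permutes the group and multiplies the sum by
  \<open>\<psi> b\<close>, which differs from 1.\<close>

lemma sum_character:
  fixes \<psi> :: "'a \<Rightarrow> real"
  assumes "\<And>x y. x \<in> carrier G \<Longrightarrow> y \<in> carrier G \<Longrightarrow> \<psi> (x \<otimes> y) = \<psi> x * \<psi> y"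
    and "b \<in> carrier G" "\<psi> b \<noteq> 1"
  shows "(\<Sum>x\<in>carrier G. \<psi> x) = 0"
proof -
  have "(\<Sum>x\<in>carrier G. \<psi> x) = (\<Sum>x\<in>carrier G. \<psi> (b \<otimes> x))"
    by (rule sum.reindex_bij_betw[symmetric])
      (use assms(2) in \<open>auto intro!: bij_betw_byWitness[where f' = "\<lambda>x. inv b \<otimes> x"] simp: m_assoc[symmetric]\<close>)
  also have "\<dots> = \<psi> b * (\<Sum>x\<in>carrier G. \<psi> x)"
    unfolding sum_distrib_left by (rule sum.cong) (use assms in auto)
  finally show ?thesis using assms(3) by simp
qed

end

context real_ty
begin

lemma \<chi>_mult': "x \<in> carrier G \<Longrightarrow> y \<in> carrier G \<Longrightarrow> z \<in> carrier G \<Longrightarrow> \<chi> z (x \<otimes> y) = \<chi> z x * \<chi> z y"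
  by (simp add: \<chi>_sym[of z] \<chi>_mult)

lemma \<chi>_sq: "x \<in> carrier G \<Longrightarrow> y \<in> carrier G \<Longrightarrow> \<chi> x y * \<chi> x y = 1"
  using \<chi>_unit[of x y] by auto

lemma \<chi>_sq': "x \<in> carrier G \<Longrightarrow> y \<in> carrier G \<Longrightarrow> \<chi> x y * (\<chi> x y * a) = a"
  using \<chi>_sq[of x y] by (simp add: mult.assoc[symmetric])

lemma \<chi>_inverse: "x \<in> carrier G \<Longrightarrow> y \<in> carrier G \<Longrightarrow> inverse (\<chi> x y) = \<chi> x y"
  using \<chi>_unit[of x y] by auto

lemma \<chi>_one: "y \<in> carrier G \<Longrightarrow> \<chi> \<one> y = 1" "y \<in> carrier G \<Longrightarrow> \<chi> y \<one> = 1"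
  using \<chi>_mult[of \<one> \<one> y] \<chi>_unit[of \<one> y] \<chi>_sym[of y \<one>] by auto

text \<open>As the values are \<plusminus>1, \<open>\<chi> (x \<otimes> x) y\<close> is the square
  of \<open>\<chi> x y\<close>, hence 1 for all \<open>y\<close>, and nondegeneracy applies.\<close>

lemma sq_one: "x \<in> carrier G \<Longrightarrow> x \<otimes> x = \<one>"
  by (rule \<chi>_nondeg) (auto simp: \<chi>_mult \<chi>_sq)

lemma sq_cancel: "x \<in> carrier G \<Longrightarrow> y \<in> carrier G \<Longrightarrow> x \<otimes> (x \<otimes> y) = y"
  by (simp add: m_assoc[symmetric] sq_one)

lemma inv_self: "x \<in> carrier G \<Longrightarrow> inv x = x"
  by (rule inv_equality) (auto simp: sq_one)

lemma mult_eq_iff: "x \<in> carrier G \<Longrightarrow> y \<in> carrier G \<Longrightarrow> z \<in> carrier G \<Longrightarrow> z = x \<otimes> y \<longleftrightarrow> y = x \<otimes> z"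
  by (auto simp: sq_cancel)

lemma sum_\<chi>: "x \<in> carrier G \<Longrightarrow> (\<Sum>y\<in>carrier G. \<chi> x y) = (if x = \<one> then real (card (carrier G)) else 0)"
proof (cases "x = \<one>")
  case False
  assume x: "x \<in> carrier G"
  obtain b where "b \<in> carrier G" "\<chi> x b \<noteq> 1" using \<chi>_nondeg[OF x] False by blast
  then have "(\<Sum>y\<in>carrier G. \<chi> x y) = 0"
    by (intro sum_character[of "\<chi> x" b]) (auto simp: \<chi>_mult' x)
  then show ?thesis using False by simp
qed (simp add: \<chi>_one)

text \<open>Apart from three factors \<open>Mid\<close> there is at most one channel, so all
  associator blocks are scalars except the one at (m, m, m).\<close>

lemma channelL_simps:
  assumes "a \<in> carrier G" "b \<in> carrier G" "c \<in> carrier G" "d \<in> carrier G"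
  shows "channelL G (Inv a) (Inv b) (Inv c) t = (if t = Inv (a \<otimes> b \<otimes> c) then {Inv (a \<otimes> b)} else {})"
    "channelL G (Inv a) (Inv b) Mid t = (if t = Mid then {Inv (a \<otimes> b)} else {})"
    "channelL G (Inv a) Mid (Inv c) t = (if t = Mid then {Mid} else {})"
    "channelL G Mid (Inv b) (Inv c) t = (if t = Mid then {Mid} else {})"
    "channelL G (Inv a) Mid Mid (Inv d) = {Mid}" "channelL G (Inv a) Mid Mid Mid = {}"
    "channelL G Mid (Inv b) Mid (Inv d) = {Mid}" "channelL G Mid (Inv b) Mid Mid = {}"
    "channelL G Mid Mid (Inv c) (Inv d) = {Inv (c \<otimes> d)}" "channelL G Mid Mid (Inv c) Mid = {}"
    "channelL G Mid Mid Mid (Inv d) = {}" "channelL G Mid Mid Mid Mid = Inv ` carrier G"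
  using assms by (auto simp: channelL_def sq_cancel m_comm[of _ c])

lemma channelR_simps:
  assumes "a \<in> carrier G" "b \<in> carrier G" "c \<in> carrier G" "d \<in> carrier G"
  shows "channelR G (Inv a) (Inv b) (Inv c) t = (if t = Inv (a \<otimes> b \<otimes> c) then {Inv (b \<otimes> c)} else {})"
    "channelR G (Inv a) (Inv b) Mid t = (if t = Mid then {Mid} else {})"
    "channelR G (Inv a) Mid (Inv c) t = (if t = Mid then {Mid} else {})"
    "channelR G Mid (Inv b) (Inv c) t = (if t = Mid then {Inv (b \<otimes> c)} else {})"
    "channelR G (Inv a) Mid Mid (Inv d) = {Inv (a \<otimes> d)}" "channelR G (Inv a) Mid Mid Mid = {}"
    "channelR G Mid (Inv b) Mid (Inv d) = {Mid}" "channelR G Mid (Inv b) Mid Mid = {}"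
    "channelR G Mid Mid (Inv c) (Inv d) = {Mid}" "channelR G Mid Mid (Inv c) Mid = {}"
    "channelR G Mid Mid Mid (Inv d) = {}" "channelR G Mid Mid Mid Mid = Inv ` carrier G"
  using assms by (auto simp: channelR_def sq_cancel m_assoc)

lemma channel_Mid:
  "channelL G Mid Mid Mid Mid = Inv ` carrier G" "channelR G Mid Mid Mid Mid = Inv ` carrier G"
  by (auto simp: channelL_def channelR_def)

lemma channel_memb:
  assumes "x \<in> set (simples G)" "y \<in> set (simples G)" "z \<in> set (simples G)" "u \<in> channelL G x y z t \<or> u \<in> channelR G x y z t"
  shows "t \<in> set (simples G)"
  using assms fusion_simples unfolding channelL_def channelR_def by blast

lemma sum_\<chi>_\<chi>:
  assumes "a \<in> carrier G" "b \<in> carrier G"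
  shows "(\<Sum>e\<in>carrier G. \<chi> a e * \<chi> b e) = (if a = b then real (card (carrier G)) else 0)"
proof -
  have "(\<Sum>e\<in>carrier G. \<chi> a e * \<chi> b e) = (\<Sum>e\<in>carrier G. \<chi> (a \<otimes> b) e)"
    by (rule sum.cong) (use assms in \<open>auto simp: \<chi>_mult\<close>)
  also have "\<dots> = (if a = b then real (card (carrier G)) else 0)"
    using assms mult_eq_iff[of a b \<one>] by (auto simp: sum_\<chi>)
  finally show ?thesis .
qed

text \<open>The block at (m, m, m) is a finite Fourier transform; \<tau> is the normalisation that
  makes it orthogonal.\<close>

lemma mid_orth:
  assumes "a \<in> carrier G" "b \<in> carrier G"
  shows "(\<Sum>e\<in>carrier G. \<tau> * \<chi> a e * (\<tau> * \<chi> b e)) = (if a = b then 1 else 0)"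
proof -
  have "(\<Sum>e\<in>carrier G. \<tau> * \<chi> a e * (\<tau> * \<chi> b e)) = \<tau> * \<tau> * (\<Sum>e\<in>carrier G. \<chi> a e * \<chi> b e)"
    by (simp add: sum_distrib_left mult_ac)
  then show ?thesis using \<tau>_sq by (simp add: sum_\<chi>_\<chi> assms)
qed

text \<open>The blocks with a single channel are \<plusminus>1, and the remaining one is the Fourier
  matrix of \<open>mid_orth\<close>. Rows and columns are treated separately to obtain a two-sided
  inverse.\<close>

lemma assoc_orth:
  assumes S: "x \<in> set (simples G)" "y \<in> set (simples G)" "z \<in> set (simples G)"
  shows "\<lbrakk>u \<in> channelL G x y z t; u' \<in> channelL G x y z t\<rbrakk> \<Longrightarrow>
      (\<Sum>w\<in>channelR G x y z t. \<alpha> x y z t u' w * \<alpha> x y z t u w) = (if u' = u then 1 else 0)"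
    and "\<lbrakk>w \<in> channelR G x y z t; w' \<in> channelR G x y z t\<rbrakk> \<Longrightarrow>
      (\<Sum>u\<in>channelL G x y z t. \<alpha> x y z t u w' * \<alpha> x y z t u w) = (if w' = w then 1 else 0)"
proof -
  have "t \<in> set (simples G)" if "u \<in> channelL G x y z t \<or> w \<in> channelR G x y z t" for u w
    using channel_memb[OF S] that by blast
  note t = this
  show "(\<Sum>w\<in>channelR G x y z t. \<alpha> x y z t u' w * \<alpha> x y z t u w) = (if u' = u then 1 else 0)"
    if u: "u \<in> channelL G x y z t" "u' \<in> channelL G x y z t" for u u'
    by (cases x; cases y; cases z; cases t)
      (use S u t[of u] in \<open>auto simp: set_simples channel_Mid channelL_simps channelR_simps \<chi>_sq \<chi>_inverse mid_orth sum.reindex inj_on_def split: if_splits\<close>)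
  have sym: "(\<Sum>e\<in>carrier G. \<tau> * \<chi> e a * (\<tau> * \<chi> e b)) = (if a = b then 1 else 0)"
    if "a \<in> carrier G" "b \<in> carrier G" for a b
    using mid_orth[OF that] that by (simp add: \<chi>_sym[of a] \<chi>_sym[of b] cong: sum.cong)
  show "(\<Sum>u\<in>channelL G x y z t. \<alpha> x y z t u w' * \<alpha> x y z t u w) = (if w' = w then 1 else 0)"
    if u: "w \<in> channelR G x y z t" "w' \<in> channelR G x y z t" for w w'
    by (cases x; cases y; cases z; cases t)
      (use S u t[of _ w] in \<open>auto simp: set_simples channel_Mid channelL_simps channelR_simps \<chi>_sq \<chi>_inverse sym sum.reindex inj_on_def split: if_splits\<close>)
qed

section \<open>Inverse arrows, naturality and the reduction to scalar hexagons\<close>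

abbreviation "C \<equiv> TY G \<chi> \<tau>"

lemma C_simps:
  "obj C = {N. \<forall>s. s \<notin> set (simples G) \<longrightarrow> N s = 0}"
  "arr C N M = {f. \<forall>s. f s \<in> carrier_mat (M s) (N s)}"
  "ident C N = (\<lambda>s. 1\<^sub>m (N s))"
  "g \<cdot>\<^bsub>C\<^esub> f = (\<lambda>s. g s * f s)"
  "plus_arr C f g = (\<lambda>s. f s + g s)"
  "scale_arr C r f = (\<lambda>s. r \<cdot>\<^sub>m f s)"
  "N \<boxtimes>\<^bsub>C\<^esub> M = ty_tens G N M"
  "f \<boxdot>\<^bsub>C\<^esub> g = ty_tens_arr G f g"
  "unit_obj C = (\<lambda>s. if s = Inv \<one> then 1 else 0)"
  "assoc C = ty_assoc G \<chi> \<tau>"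
  "lunit C N = (\<lambda>s. 1\<^sub>m (N s))"
  "runit C N = (\<lambda>s. 1\<^sub>m (N s))"
  by (simp_all add: TY_def)

text \<open>\<open>inv_arrow\<close> is a definite description and can be evaluated only once
  inverses are known to be unique.\<close>

lemma inverse_arrows_unique:
  assumes "inverse_arrows C X Y f g" "inverse_arrows C X Y f g'"
  shows "g = g'"
proof
  fix s
  have c: "f s \<in> carrier_mat (Y s) (X s)" "g s \<in> carrier_mat (X s) (Y s)" "g' s \<in> carrier_mat (X s) (Y s)"
    and e: "g s * f s = 1\<^sub>m (X s)" "f s * g' s = 1\<^sub>m (Y s)"
    using assms by (auto simp: inverse_arrows_def C_simps fun_eq_iff)
  have "g s = g s * (f s * g' s)" using c e by simp
  also have "\<dots> = (g s * f s) * g' s" using c by (simp add: assoc_mult_mat[OF c(2,1,3)])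
  finally show "g s = g' s" using c e by simp
qed

lemma inv_arrow_eq: "inverse_arrows C X Y f g \<Longrightarrow> inv_arrow C X Y f = g"
  unfolding inv_arrow_def by (rule the_equality) (auto intro: inverse_arrows_unique)

text \<open>As \<open>\<chi>\<close> takes the values \<open>\<plusminus>1\<close> only, the associator matrices are orthogonal.\<close>

lemma assoc_inverse:
  "inverse_arrows C (ty_tens G (ty_tens G X Y) Z) (ty_tens G X (ty_tens G Y Z))
     (ty_assoc G \<chi> \<tau> X Y Z) (\<lambda>t. transpose_mat (ty_assoc G \<chi> \<tau> X Y Z t))"
proof -
  have "transpose_mat (ty_assoc G \<chi> \<tau> X Y Z t) * ty_assoc G \<chi> \<tau> X Y Z t = 1\<^sub>m (ty_tens G (ty_tens G X Y) Z t) \<and>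
    ty_assoc G \<chi> \<tau> X Y Z t * transpose_mat (ty_assoc G \<chi> \<tau> X Y Z t) = 1\<^sub>m (ty_tens G X (ty_tens G Y Z) t)" for t
  proof -
    let ?L1 = "nestL G (\<lambda>k c. (fst k, snd k, c)) id (lab G X Y) (ty_tens G X Y) Z t"
    let ?R1 = "nestR G (\<lambda>a k. (a, fst k, snd k)) id (lab G Y Z) X (ty_tens G Y Z) t"
    define UL where "UL = (\<lambda>k. if valid G X Y Z k then channelL G (fst (fst k)) (fst (fst (snd k))) (fst (snd (snd k))) t else {})"
    define UR where "UR = (\<lambda>k. if valid G X Y Z k then channelR G (fst (fst k)) (fst (fst (snd k))) (fst (snd (snd k))) t else {})"
    have L1: "basis ?L1 (ty_tens G (ty_tens G X Y) Z t) UL"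
      by (rule basis_L[where \<kappa> = "\<lambda>a b c. (a, b, c)"]) (auto simp: bij_perms UL_def)
    have R1: "basis ?R1 (ty_tens G X (ty_tens G Y Z) t) UR"
      by (rule basis_R[where \<kappa> = "\<lambda>a b c. (a, b, c)"]) (auto simp: bij_perms UR_def)
    have a1: "ty_assoc G \<chi> \<tau> X Y Z t = bmat (ty_tens G X (ty_tens G Y Z) t) ?R1 (ty_tens G (ty_tens G X Y) Z t) ?L1
       (\<lambda>k w u. \<alpha> (fst (fst k)) (fst (fst (snd k))) (fst (snd (snd k))) t u w)"
      by (rule ty_assoc_nest[where \<kappa> = "\<lambda>a b c. (a, b, c)"]) (auto simp: bij_perms)
    show ?thesis
      unfolding a1 transpose_bmat bmat_mult[OF R1] bmat_mult[OF L1] bmat_one[OF L1, symmetric] bmat_one[OF R1, symmetric]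
        bmat_eq_iff[OF L1 L1] bmat_eq_iff[OF R1 R1]
      by (auto simp: UL_def UR_def assoc_orth valid_def)
  qed
  then show ?thesis
    by (auto simp: inverse_arrows_def C_simps ty_assoc_alt)
qed

lemma tens_obj: "ty_tens G X Y \<in> obj C" if "X \<in> obj C" "Y \<in> obj C"
proof -
  have "ty_copies G X Y s = []" if "s \<notin> set (simples G)" for s
    using that fusion_simples unfolding set_empty[symmetric] set_ty_copies by blast
  then show ?thesis by (auto simp: C_simps ty_tens_def)
qed

lemma bij_prod: "bij prod.swap" "bij id" "bij (\<lambda>x. x)"
  by (auto simp: bij_def inj_def surj_def)

definition pair_channels where
  "pair_channels N M s = (\<lambda>(x, y). {(p, q). x \<in> set (simples G) \<and> y \<in> set (simples G) \<and> s \<in> fusion G x y \<and> p < N x \<and> q < M y})"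

lemma gbraid_carrier: "gbraid G c N M s \<in> carrier_mat (ty_tens G M N s) (ty_tens G N M s)"
  by (simp add: gbraid_alt)

lemma basis_P: "basis (labP G id id N M s) (ty_tens G N M s) (pair_channels N M s)"
  by (rule basis_labP[OF distinct_simples bij_prod(2,2)]) (auto simp: pair_channels_def)

lemma basis_P': "basis (labP G prod.swap prod.swap M N s) (ty_tens G M N s) (pair_channels N M s)"
  by (rule basis_labP[OF distinct_simples bij_prod(1,1)]) (auto simp: pair_channels_def fusion_comm)

lemma gbraid_P: "gbraid G c N M s = bmat (ty_tens G M N s) (labP G prod.swap prod.swap M N s)
     (ty_tens G N M s) (labP G id id N M s) (\<lambda>k w v. if w = v then c (fst k) (snd k) s else 0)"
  using gbraid_labP[of id id "\<lambda>k. c (fst k) (snd k) s" c s G N M] by simp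

lemma gbraid_P': "gbraid G c M N s = bmat (ty_tens G N M s) (labP G id id N M s)
     (ty_tens G M N s) (labP G prod.swap prod.swap M N s) (\<lambda>k w v. if w = v then c (snd k) (fst k) s else 0)"
  using gbraid_labP[of prod.swap prod.swap "\<lambda>k. c (snd k) (fst k) s" c s G M N] by (simp add: bij_prod comp_def id_def)

lemma gbraid_inverse:
  assumes "\<And>x y. x \<in> set (simples G) \<Longrightarrow> y \<in> set (simples G) \<Longrightarrow> s \<in> fusion G x y \<Longrightarrow> c x y s \<noteq> 0"
  shows "gbraid G (\<lambda>y x t. 1 / c x y t) M N s * gbraid G c N M s = 1\<^sub>m (ty_tens G N M s)"
    "gbraid G c N M s * gbraid G (\<lambda>y x t. 1 / c x y t) M N s = 1\<^sub>m (ty_tens G M N s)"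
proof -
  show "gbraid G (\<lambda>y x t. 1 / c x y t) M N s * gbraid G c N M s = 1\<^sub>m (ty_tens G N M s)"
    unfolding gbraid_P[of c] gbraid_P'[of "\<lambda>y x t. 1 / c x y t"] bmat_mult_diag[OF basis_P' basis_P]
      bmat_one[OF basis_P, symmetric] bmat_eq_iff[OF basis_P basis_P]
    by (auto simp: pair_channels_def assms)
  show "gbraid G c N M s * gbraid G (\<lambda>y x t. 1 / c x y t) M N s = 1\<^sub>m (ty_tens G M N s)"
    unfolding gbraid_P[of c] gbraid_P'[of "\<lambda>y x t. 1 / c x y t"] bmat_mult_diag[OF basis_P basis_P']
      bmat_one[OF basis_P', symmetric] bmat_eq_iff[OF basis_P' basis_P']
    by (auto simp: pair_channels_def assms)
qed

text \<open>On each pair of simple types \<open>gbraid\<close> is a scalar times the exchange of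
  copies, while arrows mix only copies of one type.\<close>

lemma gbraid_natural:
  assumes f: "f \<in> arr C X X'" and g: "g \<in> arr C Y Y'"
  shows "gbraid G c X' Y' s * ty_tens_arr G f g s = ty_tens_arr G g f s * gbraid G c X Y s"
proof -
  let ?F = "\<lambda>k w v. f (fst k) $$ (fst w, fst v) * g (snd k) $$ (snd w, snd v)"
  have 1: "ty_tens_arr G f g s = bmat (ty_tens G X' Y' s) (labP G id id X' Y' s)
     (ty_tens G X Y s) (labP G id id X Y s) ?F"
    by (rule ty_tens_arr_labP) (use f g in \<open>auto simp: C_simps\<close>)
  have 2: "ty_tens_arr G g f s = bmat (ty_tens G Y' X' s) (labP G prod.swap prod.swap Y' X' s)
     (ty_tens G Y X s) (labP G prod.swap prod.swap Y X s) ?F"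
    by (rule ty_tens_arr_labP) (use f g in \<open>auto simp: C_simps bij_prod mult.commute\<close>)
  show ?thesis
    unfolding 1 2 gbraid_P bmat_mult_diag[OF basis_P' basis_P] bmat_diag_mult[OF basis_P basis_P']
    by (simp add: mult.commute)
qed

lemma iso_arrow_gbraid:
  assumes "\<And>x y s. x \<in> set (simples G) \<Longrightarrow> y \<in> set (simples G) \<Longrightarrow> s \<in> fusion G x y \<Longrightarrow> c x y s \<noteq> 0"
  shows "iso_arrow C (ty_tens G N M) (ty_tens G M N) (gbraid G c N M)"
proof -
  have "inverse_arrows C (ty_tens G N M) (ty_tens G M N) (gbraid G c N M) (gbraid G (\<lambda>y x t. 1 / c x y t) M N)"
    unfolding inverse_arrows_def C_simps
    by (intro conjI ext gbraid_inverse assms) (auto simp: gbraid_carrier)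
  then show ?thesis unfolding iso_arrow_def by blast
qed

text \<open>A test object with one copy of every simple object: every pair and triple of simple
  objects occurs in its powers, so this object alone detects all coefficients.\<close>

definition ones :: "'a ty_obj" where "ones s = (if s \<in> set (simples G) then 1 else 0)"

lemma ones_obj: "ones \<in> obj C" by (auto simp: C_simps ones_def)

lemma iso_arrow_gbraid_ones:
  assumes iso: "iso_arrow C (ty_tens G ones ones) (ty_tens G ones ones) (gbraid G c ones ones)"
    and x: "x \<in> set (simples G)" "y \<in> set (simples G)" "s \<in> fusion G x y"
  shows "c x y s \<noteq> 0"
proof
  assume c0: "c x y s = 0"
  let ?n = "ty_tens G ones ones s"
  obtain g where g: "g s \<in> carrier_mat ?n ?n" "g s * gbraid G c ones ones s = 1\<^sub>m ?n"
    using iso by (auto simp: iso_arrow_def inverse_arrows_def C_simps fun_eq_iff)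
  have "(x, 0, y, 0) \<in> set (ty_copies G ones ones s)" using x by (auto simp: set_ty_copies ones_def)
  then obtain j where j: "j < ?n" "ty_copies G ones ones s ! j = (x, 0, y, 0)"
    by (auto simp: in_set_conv_nth ty_tens_def)
  \<comment> \<open>A vanishing scalar makes the whole column \<open>j\<close> of the braiding zero,
    which no left inverse allows.\<close>
  have "(g s * gbraid G c ones ones s) $$ (j, j) = 0"
    using j g(1) c0 by (auto simp: gbraid_alt scalar_prod_def split: prod.splits intro!: sum.neutral)
  then show False using g(2) j(1) by simp
qed

text \<open>Naturality is automatic for the shape \<open>gbraid\<close>. What remains is that the
  scalars are nonzero, for invertibility, and satisfy the two hexagon equations.\<close>

lemma braiding_gbraid_iff:
  assumes \<beta>: "\<And>N M. N \<in> obj C \<Longrightarrow> M \<in> obj C \<Longrightarrow> \<beta> N M = gbraid G c N M"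
  shows "braiding C \<beta> \<longleftrightarrow>
    (\<forall>x\<in>set (simples G). \<forall>y\<in>set (simples G). \<forall>s\<in>fusion G x y. c x y s \<noteq> 0) \<and>
    (\<forall>x\<in>set (simples G). \<forall>y\<in>set (simples G). \<forall>z\<in>set (simples G). \<forall>t. hex1 c x y z t \<and> hex2 c x y z t)"
    (is "_ \<longleftrightarrow> ?nz \<and> ?hex")
proof -
  have inv: "inv_arrow C (U \<boxtimes>\<^bsub>C\<^esub> V \<boxtimes>\<^bsub>C\<^esub> W) (U \<boxtimes>\<^bsub>C\<^esub> (V \<boxtimes>\<^bsub>C\<^esub> W)) (assoc C U V W)
      = (\<lambda>t. transpose_mat (ty_assoc G \<chi> \<tau> U V W t))" for U V W
    using inv_arrow_eq[OF assoc_inverse] by (simp add: C_simps)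
  have iso: "(\<forall>X\<in>obj C. \<forall>Y\<in>obj C. iso_arrow C (X \<boxtimes>\<^bsub>C\<^esub> Y) (Y \<boxtimes>\<^bsub>C\<^esub> X) (\<beta> X Y)) \<longleftrightarrow> ?nz"
    using iso_arrow_gbraid[of c] iso_arrow_gbraid_ones[of c] \<beta>[OF ones_obj ones_obj] ones_obj
    by (auto simp: \<beta> C_simps(7)) 
  have nat: "\<forall>X\<in>obj C. \<forall>X'\<in>obj C. \<forall>Y\<in>obj C. \<forall>Y'\<in>obj C. \<forall>f\<in>arr C X X'. \<forall>g\<in>arr C Y Y'.
        \<beta> X' Y' \<cdot>\<^bsub>C\<^esub> (f \<boxdot>\<^bsub>C\<^esub> g) = (g \<boxdot>\<^bsub>C\<^esub> f) \<cdot>\<^bsub>C\<^esub> \<beta> X Y"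
    using gbraid_natural by (auto simp: \<beta> C_simps(4,8))
  have val: "(\<forall>X\<in>obj C. \<forall>Y\<in>obj C. \<forall>Z\<in>obj C. \<forall>x p y q z r. valid G X Y Z ((x, p), (y, q), (z, r)) \<longrightarrow> P x y z)
    \<longleftrightarrow> (\<forall>x\<in>set (simples G). \<forall>y\<in>set (simples G). \<forall>z\<in>set (simples G). P x y z)" for P
  proof (intro iffI ballI)
    fix x y z assume H: "\<forall>X\<in>obj C. \<forall>Y\<in>obj C. \<forall>Z\<in>obj C. \<forall>x p y q z r. valid G X Y Z ((x, p), (y, q), (z, r)) \<longrightarrow> P x y z"
      and S: "x \<in> set (simples G)" "y \<in> set (simples G)" "z \<in> set (simples G)"
    have "valid G ones ones ones ((x, 0), (y, 0), (z, 0))" using S by (auto simp: valid_def ones_def)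
    then show "P x y z" using H ones_obj by blast
  qed (auto simp: valid_def)
  have h1: "(\<forall>X\<in>obj C. \<forall>Y\<in>obj C. \<forall>Z\<in>obj C.
        assoc C Y Z X \<cdot>\<^bsub>C\<^esub> \<beta> X (Y \<boxtimes>\<^bsub>C\<^esub> Z) \<cdot>\<^bsub>C\<^esub> assoc C X Y Z =
        (ident C Y \<boxdot>\<^bsub>C\<^esub> \<beta> X Z) \<cdot>\<^bsub>C\<^esub> assoc C Y X Z \<cdot>\<^bsub>C\<^esub> (\<beta> X Y \<boxdot>\<^bsub>C\<^esub> ident C Z))
     \<longleftrightarrow> (\<forall>x\<in>set (simples G). \<forall>y\<in>set (simples G). \<forall>z\<in>set (simples G). \<forall>t. hex1 c x y z t)"
    unfolding val[of "\<lambda>x y z. \<forall>t. hex1 c x y z t", symmetric]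
    by (intro ball_cong refl) (simp add: C_simps(3,4,7,8,10) \<beta> tens_obj fun_eq_iff hex1_component, blast)
  have h2: "(\<forall>X\<in>obj C. \<forall>Y\<in>obj C. \<forall>Z\<in>obj C.
        (let inv_assoc = (\<lambda>U V W. inv_arrow C (U \<boxtimes>\<^bsub>C\<^esub> V \<boxtimes>\<^bsub>C\<^esub> W) (U \<boxtimes>\<^bsub>C\<^esub> (V \<boxtimes>\<^bsub>C\<^esub> W)) (assoc C U V W))
         in inv_assoc Z X Y \<cdot>\<^bsub>C\<^esub> \<beta> (X \<boxtimes>\<^bsub>C\<^esub> Y) Z \<cdot>\<^bsub>C\<^esub> inv_assoc X Y Z =
            (\<beta> X Z \<boxdot>\<^bsub>C\<^esub> ident C Y) \<cdot>\<^bsub>C\<^esub> inv_assoc X Z Y \<cdot>\<^bsub>C\<^esub> (ident C X \<boxdot>\<^bsub>C\<^esub> \<beta> Y Z)))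
     \<longleftrightarrow> (\<forall>x\<in>set (simples G). \<forall>y\<in>set (simples G). \<forall>z\<in>set (simples G). \<forall>t. hex2 c x y z t)"
    unfolding val[of "\<lambda>x y z. \<forall>t. hex2 c x y z t", symmetric] Let_def inv
    by (intro ball_cong refl) (simp add: C_simps(3,4,7,8,10) \<beta> tens_obj fun_eq_iff hex2_component, blast)
  show ?thesis
    unfolding braiding_def iso h1 h2 using nat by blast
qed

end

section \<open>Braidings and quadratic forms\<close>

lemma distinct_singleton_set: "distinct xs \<Longrightarrow> set xs = {a} \<Longrightarrow> xs = [a]"
  by (cases xs; cases "tl xs") auto

lemma gbraid_cong:
  assumes "\<And>x y t. x \<in> set (simples A) \<Longrightarrow> y \<in> set (simples A) \<Longrightarrow> t \<in> fusion A x y \<Longrightarrow> c x y t = d x y t"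
  shows "gbraid A c = gbraid A d"
proof (intro ext)
  fix N M t
  show "gbraid A c N M t = gbraid A d N M t"
  proof (rule eq_matI, goal_cases)
    case (1 i j)
    then have ij: "i < ty_tens A M N t" "j < ty_tens A N M t" by (auto simp: gbraid_alt)
    from nth_ty_copiesE[OF ij(2)] obtain x p y q where
      "ty_copies A N M t ! j = (x, p, y, q)" "x \<in> set (simples A)" "y \<in> set (simples A)" "t \<in> fusion A x y" by metis
    then show ?case using ij assms by (simp add: gbraid_alt split: prod.split)
  qed (auto simp: gbraid_alt)
qed

context real_ty
begin

section \<open>Naturality reduces a braiding to scalars\<close>

definition simple_obj :: "'a simple \<Rightarrow> 'a ty_obj" where
  "simple_obj x = (\<lambda>s. if s = x then 1 else 0)"

lemma simple_obj_obj: "x \<in> set (simples G) \<Longrightarrow> simple_obj x \<in> obj C"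
  by (auto simp: C_simps simple_obj_def)

lemma ty_copies_simple_obj:
  assumes "x \<in> set (simples G)" "y \<in> set (simples G)"
  shows "ty_copies G (simple_obj x) (simple_obj y) t = (if t \<in> fusion G x y then [(x, 0, y, 0)] else [])"
proof -
  have s: "set (ty_copies G (simple_obj x) (simple_obj y) t) = (if t \<in> fusion G x y then {(x, 0, y, 0)} else {})"
    using assms by (auto simp: set_ty_copies simple_obj_def split: if_splits)
  show ?thesis
  proof (cases "t \<in> fusion G x y")
    case True
    then show ?thesis using s distinct_singleton_set[OF distinct_ty_copies[OF distinct_simples]] by simp
  next
    case False
    then show ?thesis using s by simp
  qed
qed

lemma ty_tens_simple_obj:
  assumes "x \<in> set (simples G)" "y \<in> set (simples G)"
  shows "ty_tens G (simple_obj x) (simple_obj y) t = (if t \<in> fusion G x y then 1 else 0)"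
  using ty_copies_simple_obj[OF assms] by (simp add: ty_tens_def)

text \<open>The inclusion of the copy \<open>p\<close> of \<open>x\<close>, a test arrow for
  naturality.\<close>

definition inclusion :: "'a ty_obj \<Rightarrow> 'a simple \<Rightarrow> nat \<Rightarrow> 'a ty_arr" where
  "inclusion N x p = (\<lambda>s. mat (N s) (simple_obj x s) (\<lambda>(i, _). if i = p then 1 else 0))"

lemma inclusion_arr: "inclusion N x p \<in> arr C (simple_obj x) N"
  by (auto simp: C_simps inclusion_def)

text \<open>Naturality along the inclusions of one copy of \<open>x\<close> and one of
  \<open>y\<close> compares a column of \<open>\<beta> N M\<close> with the braiding of two simple
  objects, which is at most a scalar on each summand since fusion multiplicities are at most
  one.\<close>

lemma braiding_is_gbraid:
  assumes "braiding C \<beta>"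
  shows "\<exists>c. \<forall>N\<in>obj C. \<forall>M\<in>obj C. \<beta> N M = gbraid G c N M"
proof (intro exI ballI ext)
  define c where "c x y t = \<beta> (simple_obj x) (simple_obj y) t $$ (0, 0)" for x y t
  fix N M t assume NM: "N \<in> obj C" "M \<in> obj C"
  have carr: "\<beta> X Y s \<in> carrier_mat (ty_tens G Y X s) (ty_tens G X Y s)" if "X \<in> obj C" "Y \<in> obj C" for X Y s
    using assms that unfolding braiding_def iso_arrow_def inverse_arrows_def C_simps(2,7) by blast
  show "\<beta> N M t = gbraid G c N M t"
  proof (rule eq_matI, goal_cases)
    case (1 i j)
    then have ij: "i < ty_tens G M N t" "j < ty_tens G N M t" by (auto simp: gbraid_alt)
    from nth_ty_copiesE[OF ij(2)] obtain x p y q where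
      j: "ty_copies G N M t ! j = (x, p, y, q)" "x \<in> set (simples G)" "y \<in> set (simples G)" "t \<in> fusion G x y"
        "p < N x" "q < M y" by metis
    from nth_ty_copiesE[OF ij(1)] obtain x' p' y' q' where
      i: "ty_copies G M N t ! i = (y', q', x', p')" "p' < N x'" "q' < M y'" by metis
    let ?f = "inclusion N x p" and ?g = "inclusion M y q"
    have f: "?f s \<in> carrier_mat (N s) (simple_obj x s)" "?g s \<in> carrier_mat (M s) (simple_obj y s)" for s
      by (auto simp: inclusion_def)
    have t': "t \<in> fusion G y x" using j fusion_comm by blast
    note X = simple_obj_obj[OF j(2)] simple_obj_obj[OF j(3)]
    have "\<beta> N M \<cdot>\<^bsub>C\<^esub> (?f \<boxdot>\<^bsub>C\<^esub> ?g) = (?g \<boxdot>\<^bsub>C\<^esub> ?f) \<cdot>\<^bsub>C\<^esub> \<beta> (simple_obj x) (simple_obj y)"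
      using assms NM X inclusion_arr unfolding braiding_def by blast
    then have eq: "\<beta> N M t * ty_tens_arr G ?f ?g t = ty_tens_arr G ?g ?f t * \<beta> (simple_obj x) (simple_obj y) t"
      unfolding C_simps by metis
    \<comment> \<open>A standard basis vector, so multiplication by it picks out the column
      \<open>j\<close> of \<open>\<beta> N M t\<close>.\<close>
    have fg: "ty_tens_arr G ?f ?g t = mat (ty_tens G N M t) 1 (\<lambda>(k, _). if k = j then 1 else 0)"
    proof (rule eq_matI, goal_cases)
      case (1 k l)
      then have k: "k < ty_tens G N M t" and l: "l = 0" by auto
      from nth_ty_copiesE[OF k] obtain x1 p1 y1 q1 where
        k': "ty_copies G N M t ! k = (x1, p1, y1, q1)" "p1 < N x1" "q1 < M y1" by metis
      have "k = j \<longleftrightarrow> (x1, p1, y1, q1) = (x, p, y, q)"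
        using k' j k ij(2) distinct_ty_copies[OF distinct_simples, of N M t] nth_eq_iff_index_eq
        by (metis ty_tens_def)
      then show ?case
        unfolding ty_tens_arr_alt[OF f] using k l k' j
        by (auto simp: ty_tens_simple_obj ty_copies_simple_obj inclusion_def) (auto simp: simple_obj_def)
    qed (use j in \<open>simp_all add: ty_tens_arr_alt[OF f] ty_tens_simple_obj\<close>)
    have "\<beta> N M t $$ (i, j) = (\<beta> N M t * ty_tens_arr G ?f ?g t) $$ (i, 0)"
      unfolding fg using ij carr[OF NM, of t]
      by (simp add: scalar_prod_def if_distrib[of "\<lambda>x. _ * x"] cong: if_cong)
    also have "\<dots> = (ty_tens_arr G ?g ?f t * \<beta> (simple_obj x) (simple_obj y) t) $$ (i, 0)"
      by (simp add: eq)
    also have "\<dots> = gbraid G c N M t $$ (i, j)"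
      unfolding ty_tens_arr_alt[OF f(2) f(1)] using ij i j t' carr[OF X, of t]
      by (auto simp: ty_tens_simple_obj ty_copies_simple_obj gbraid_alt scalar_prod_def c_def inclusion_def)
        (auto simp: simple_obj_def)
    finally show ?case .
  qed (use carr[OF NM, of t] in \<open>auto simp: gbraid_alt\<close>)
qed

text \<open>From \<open>\<sigma> \<one> = 1\<close>, \<open>x \<otimes> x = \<one>\<close> and
  \<open>\<chi> x x = 1\<close> follows that \<open>\<sigma> x\<close> squares to 1. Inversion is
  trivial in this group, so the symmetry condition on forms holds by itself.\<close>

lemma QF_iff: "\<sigma> \<in> QF G \<chi> \<longleftrightarrow> \<sigma> \<in> extensional (carrier G) \<and>
   (\<forall>x\<in>carrier G. \<sigma> x = 1 \<or> \<sigma> x = - 1) \<and>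
   (\<forall>x\<in>carrier G. \<forall>y\<in>carrier G. \<sigma> (x \<otimes> y) = \<sigma> x * \<sigma> y * \<chi> x y)" (is "_ \<longleftrightarrow> ?r")
proof
  assume \<sigma>: "\<sigma> \<in> QF G \<chi>"
  have nz: "\<sigma> x \<noteq> 0" if "x \<in> carrier G" for x
    using \<sigma> that by (auto simp: QF_def quadratic_form_def)
  have m: "\<sigma> (x \<otimes> y) = \<sigma> x * \<sigma> y * \<chi> x y" if "x \<in> carrier G" "y \<in> carrier G" for x y
  proof -
    have "\<sigma> (x \<otimes> y) / (\<sigma> x * \<sigma> y) = \<chi> x y" using \<sigma> that by (auto simp: QF_def coboundary_def)
    then show ?thesis using nz[of x] nz[of y] that by (simp add: divide_eq_eq mult_ac)
  qed
  have 1: "\<sigma> \<one> = 1" using m[of \<one> \<one>] nz[of \<one>] by (simp add: \<chi>_one)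
  have "\<sigma> x = 1 \<or> \<sigma> x = - 1" if "x \<in> carrier G" for x
    using m[OF that that] 1 that by (simp add: \<chi>_self sq_one square_eq_1_iff)
  then show ?r using m \<sigma> by (auto simp: QF_def quadratic_form_def PiE_def)
next
  assume r: ?r
  have nz: "\<sigma> x \<noteq> 0" if "x \<in> carrier G" for x using r that by force
  have c: "coboundary G \<sigma> x y = \<chi> x y" if "x \<in> carrier G" "y \<in> carrier G" for x y
    using r nz[of x] nz[of y] that by (simp add: coboundary_def)
  have "\<chi> x y \<noteq> 0" if "x \<in> carrier G" "y \<in> carrier G" for x y using \<chi>_unit[OF that] by auto
  then show "\<sigma> \<in> QF G \<chi>"
    using r nz c by (auto simp: QF_def quadratic_form_def bicharacter_def PiE_def \<chi>_mult \<chi>_mult' inv_self)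
qed

text \<open>Substitute \<open>y = x \<otimes> z\<close> in the double sum. Then \<open>\<sigma> x *
  \<sigma> (x \<otimes> z) = \<sigma> z * \<chi> z x\<close>, and summing over \<open>x\<close>
  leaves only \<open>z = \<one>\<close>.\<close>

lemma gauss_sum_sq:
  assumes "\<sigma> \<in> QF G \<chi>"
  shows "gauss_sum G \<sigma> * gauss_sum G \<sigma> = real (card (carrier G))"
proof -
  have m: "\<sigma> (x \<otimes> y) = \<sigma> x * \<sigma> y * \<chi> x y" if "x \<in> carrier G" "y \<in> carrier G" for x y
    using assms that by (auto simp: QF_iff)
  have u: "\<sigma> x = 1 \<or> \<sigma> x = - 1" if "x \<in> carrier G" for x using assms that by (auto simp: QF_iff)
  have 1: "\<sigma> \<one> = 1" using m[of \<one> \<one>] u[of \<one>] by (auto simp: \<chi>_one)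
  have "gauss_sum G \<sigma> * gauss_sum G \<sigma> = (\<Sum>x\<in>carrier G. \<sigma> x * (\<Sum>y\<in>carrier G. \<sigma> y))"
    by (simp add: gauss_sum_def sum_distrib_right)
  also have "\<dots> = (\<Sum>x\<in>carrier G. \<Sum>z\<in>carrier G. \<sigma> x * \<sigma> (x \<otimes> z))"
  proof (rule sum.cong[OF refl])
    fix x assume x: "x \<in> carrier G"
    have "(\<Sum>y\<in>carrier G. \<sigma> y) = (\<Sum>z\<in>carrier G. \<sigma> (x \<otimes> z))"
      by (rule sum.reindex_bij_betw[symmetric])
        (use x in \<open>auto intro!: bij_betw_byWitness[where f' = "\<lambda>z. x \<otimes> z"] simp: sq_cancel\<close>)
    then show "\<sigma> x * (\<Sum>y\<in>carrier G. \<sigma> y) = (\<Sum>z\<in>carrier G. \<sigma> x * \<sigma> (x \<otimes> z))"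
      by (simp add: sum_distrib_left)
  qed
  also have "\<dots> = (\<Sum>x\<in>carrier G. \<Sum>z\<in>carrier G. \<sigma> z * \<chi> z x)"
    by (intro sum.cong refl) (use m u in \<open>force simp: \<chi>_sym\<close>)
  also have "\<dots> = (\<Sum>z\<in>carrier G. \<sigma> z * (\<Sum>x\<in>carrier G. \<chi> z x))"
    by (subst sum.swap) (simp add: sum_distrib_left)
  also have "\<dots> = (\<Sum>z\<in>carrier G. if z = \<one> then \<sigma> z * real (card (carrier G)) else 0)"
    by (rule sum.cong) (auto simp: sum_\<chi>)
  also have "\<dots> = real (card (carrier G))"
    using fin 1 by simp
  finally show ?thesis .
qed

text \<open>The number \<open>\<tau> * gauss_sum G \<sigma>\<close> has square 1, so its sign
  determines it. The second part serves the hexagon that exhibits it as a nonzero square.\<close>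

lemma \<tau>_gauss_sum:
  assumes "\<sigma> \<in> QF G \<chi>"
  shows "sgn (gauss_sum G \<sigma>) = sgn \<tau> \<longleftrightarrow> \<tau> * gauss_sum G \<sigma> = 1" "\<tau> * gauss_sum G \<sigma> > 0 \<Longrightarrow> \<tau> * gauss_sum G \<sigma> = 1"
proof -
  have "(\<tau> * gauss_sum G \<sigma>) * (\<tau> * gauss_sum G \<sigma>) = 1"
    using \<tau>_sq gauss_sum_sq[OF assms] by (metis mult.assoc mult.left_commute)
  then have 1: "\<tau> * gauss_sum G \<sigma> = 1 \<or> \<tau> * gauss_sum G \<sigma> = - 1"
    by (simp add: square_eq_1_iff)
  then show "sgn (gauss_sum G \<sigma>) = sgn \<tau> \<longleftrightarrow> \<tau> * gauss_sum G \<sigma> = 1"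
    using sgn_mult[of \<tau> "gauss_sum G \<sigma>"] by (auto simp: sgn_if split: if_splits)
  show "\<tau> * gauss_sum G \<sigma> = 1" if "\<tau> * gauss_sum G \<sigma> > 0" using that 1 by auto
qed

section \<open>From the hexagons to quadratic forms and back\<close>

abbreviation "cf \<equiv> ty_braid_coeff \<chi>"

text \<open>The unknowns are the scalars \<open>s1\<close>, \<open>s2\<close>, \<open>s3\<close> of
  the braidings of (a, m), of (m, a), and of (m, m) on the summand a. Suitable triples express all
  of them by \<open>s2\<close>, which becomes the form, and by \<open>s3 \<one>\<close>, which
  becomes \<epsilon>.\<close>

lemma hexagons_imp_quadratic_form:
  assumes nz: "\<And>x y s. x \<in> set (simples G) \<Longrightarrow> y \<in> set (simples G) \<Longrightarrow> s \<in> fusion G x y \<Longrightarrow> c x y s \<noteq> 0"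
    and hex: "\<And>x y z t. x \<in> set (simples G) \<Longrightarrow> y \<in> set (simples G) \<Longrightarrow> z \<in> set (simples G) \<Longrightarrow>
      hex1 c x y z t \<and> hex2 c x y z t"
  shows "\<exists>\<sigma> \<epsilon>. \<sigma> \<in> QF G \<chi> \<and> \<epsilon> \<in> {1, - 1} \<and> sgn (gauss_sum G \<sigma>) = sgn \<tau> \<and> gbraid G c = gbraid G (cf \<sigma> \<epsilon>)"
proof -
  have S: "Mid \<in> set (simples G)" "\<And>a. a \<in> carrier G \<Longrightarrow> Inv a \<in> set (simples G)" by (auto simp: set_simples)
  define s1 where "s1 a = c (Inv a) Mid Mid" for a
  define s2 where "s2 a = c Mid (Inv a) Mid" for a
  define s3 where "s3 a = c Mid Mid (Inv a)" for a
  note defs = s1_def[symmetric] s2_def[symmetric] s3_def[symmetric]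
  have nz1: "s1 a \<noteq> 0" "s2 a \<noteq> 0" "s3 a \<noteq> 0" if "a \<in> carrier G" for a
    using that nz S by (auto simp: s1_def s2_def s3_def)
  \<comment> \<open>At (a, b, m) the factor \<open>s1 a\<close> occurs on both sides of the first
    hexagon and cancels.\<close>
  have s0: "c (Inv a) (Inv b) (Inv (a \<otimes> b)) = \<chi> a b" if "a \<in> carrier G" "b \<in> carrier G" for a b
    using hex[of "Inv a" "Inv b" Mid Mid] nz1[of a] that S
    by (simp add: hex1_def hex2_def channelL_simps channelR_simps defs \<chi>_sym)
  have s2_mult: "s2 (a \<otimes> b) = s2 a * s2 b * \<chi> a b" if "a \<in> carrier G" "b \<in> carrier G" for a b
    using hex[of Mid "Inv a" "Inv b" Mid] that S \<chi>_unit[of a b]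
    by (auto simp: hex1_def hex2_def channelL_simps channelR_simps defs)
  \<comment> \<open>At (m, b, m) the first hexagon relates \<open>s3\<close> to \<open>s2\<close>,
    and the second one, in the next fact, relates it to \<open>s1\<close>; together they identify
    \<open>s1\<close> with \<open>s2\<close>.\<close>
  have s3_s2: "s3 \<one> = s3 b * s2 b" if "b \<in> carrier G" for b
    using hex[of Mid "Inv b" Mid "Inv \<one>"] that S
    by (auto simp: hex1_def hex2_def channelL_simps channelR_simps defs \<chi>_one)
  have s3_s1: "s3 \<one> = s3 b * s1 b" if "b \<in> carrier G" for b
    using hex[of Mid "Inv b" Mid "Inv \<one>"] that S
    by (auto simp: hex1_def hex2_def channelL_simps channelR_simps defs \<chi>_one)
  have s12: "s1 b = s2 b" if "b \<in> carrier G" for b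
    using s3_s2[OF that] s3_s1[OF that] nz1[OF that] by simp
  have s2_one: "s2 \<one> = 1" using s2_mult[of \<one> \<one>] nz1[of \<one>] by (simp add: \<chi>_one)
  have s2_unit: "s2 b = 1 \<or> s2 b = - 1" if "b \<in> carrier G" for b
    using s2_mult[OF that that] that s2_one by (simp add: sq_one \<chi>_self square_eq_1_iff)
  have s3_eq: "s3 b = s3 \<one> * s2 b" if "b \<in> carrier G" for b
    using s3_s2[OF that] s2_unit[OF that] by auto
  define \<sigma> where "\<sigma> = restrict s2 (carrier G)"
  have \<sigma>: "\<sigma> \<in> QF G \<chi>" using s2_unit s2_mult by (auto simp: QF_iff \<sigma>_def)
  \<comment> \<open>The first hexagon at (m, m, m) with both outer channels
    \<open>Inv \<one>\<close>: all values of \<open>\<chi>\<close> are 1 there and the sum is a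
    Gauss sum.\<close>
  have "(\<Sum>v\<in>carrier G. \<tau> * inverse (\<chi> v \<one>) * s2 v * (\<tau> * inverse (\<chi> \<one> v))) = s3 \<one> * (\<tau> * inverse (\<chi> \<one> \<one>)) * s3 \<one>"
    using hex[of Mid Mid Mid Mid] S by (simp add: hex1_def channel_Mid sum.reindex inj_on_def defs)
  then have "\<tau> * (\<tau> * gauss_sum G \<sigma>) = \<tau> * (s3 \<one> * s3 \<one>)"
    by (simp add: gauss_sum_def \<sigma>_def \<chi>_one sum_distrib_left mult_ac cong: sum.cong)
  moreover have "\<tau> \<noteq> 0" using \<tau>_sq by auto
  ultimately have g: "\<tau> * gauss_sum G \<sigma> = s3 \<one> * s3 \<one>" by simp
  \<comment> \<open>Here it matters that the scalars are real: the square of the nonzero number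
    \<open>s3 \<one>\<close> is positive, which forces the sign of the Gauss sum.\<close>
  then have g1: "\<tau> * gauss_sum G \<sigma> = 1"
    using \<tau>_gauss_sum(2)[OF \<sigma>] nz1(3)[of \<one>] by (auto simp: zero_less_mult_iff linorder_neq_iff)
  then have "s3 \<one> = 1 \<or> s3 \<one> = - 1" using g by (simp add: square_eq_1_iff)
  moreover have "gbraid G c = gbraid G (cf \<sigma> (s3 \<one>))"
  proof (rule gbraid_cong)
    fix x y t assume xy: "x \<in> set (simples G)" "y \<in> set (simples G)" "t \<in> fusion G x y"
    show "c x y t = cf \<sigma> (s3 \<one>) x y t"
      by (cases x; cases y) (use xy in \<open>auto simp: set_simples s0 \<sigma>_def s12 s3_eq[symmetric] defs\<close>)
  qed
  ultimately show ?thesis using \<sigma> g1 \<tau>_gauss_sum(1)[OF \<sigma>] by blast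
qed

text \<open>Away from (m, m, m) each equation is an identity between products of values
  \<plusminus>1. At (m, m, m) it evaluates a translated Gauss sum.\<close>

lemma quadratic_form_hexagons:
  assumes \<sigma>: "\<sigma> \<in> QF G \<chi>" and g: "sgn (gauss_sum G \<sigma>) = sgn \<tau>" and \<epsilon>: "\<epsilon> \<in> {1, - 1}"
    and S: "x \<in> set (simples G)" "y \<in> set (simples G)" "z \<in> set (simples G)"
  shows "hex1 (cf \<sigma> \<epsilon>) x y z t \<and> hex2 (cf \<sigma> \<epsilon>) x y z t"
proof (cases "t \<in> set (simples G)")
  case False
  then have "channelR G x y z t = {}" "channelL G x y z t = {}" using channel_memb[OF S] by auto
  then show ?thesis by (simp add: hex1_def hex2_def)
next
  case t: True
  have m: "\<sigma> (x \<otimes> y) = \<sigma> x * \<sigma> y * \<chi> x y" if "x \<in> carrier G" "y \<in> carrier G" for x y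
    using \<sigma> that by (auto simp: QF_iff)
  have u: "\<sigma> x * \<sigma> x = 1" if "x \<in> carrier G" for x using \<sigma> that by (force simp: QF_iff)
  have \<epsilon>2: "\<epsilon> * \<epsilon> = 1" using \<epsilon> by auto
  have u': "\<sigma> x * (\<sigma> x * r) = r" if "x \<in> carrier G" for x r using u[OF that] by (simp add: mult.assoc[symmetric])
  \<comment> \<open>Completing the square: \<open>\<chi> e b * \<chi> a e * \<sigma> e\<close>
    equals \<open>\<sigma> (a \<otimes> b) * \<sigma> ((a \<otimes> b) \<otimes> e)\<close>, and
    translation by \<open>a \<otimes> b\<close> leaves the Gauss sum unchanged.\<close>
  have mid: "(\<Sum>e\<in>carrier G. \<tau> * \<chi> e b * \<sigma> e * (\<tau> * \<chi> a e)) = \<epsilon> * \<sigma> b * (\<tau> * \<chi> a b) * (\<epsilon> * \<sigma> a)"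
    if ab: "a \<in> carrier G" "b \<in> carrier G" for a b
  proof -
    have "(\<Sum>e\<in>carrier G. \<tau> * \<chi> e b * \<sigma> e * (\<tau> * \<chi> a e)) = (\<Sum>e\<in>carrier G. \<tau> * \<tau> * \<sigma> (a \<otimes> b) * \<sigma> ((a \<otimes> b) \<otimes> e))"
    proof (rule sum.cong[OF refl])
      fix e assume e: "e \<in> carrier G"
      then show "\<tau> * \<chi> e b * \<sigma> e * (\<tau> * \<chi> a e) = \<tau> * \<tau> * \<sigma> (a \<otimes> b) * \<sigma> ((a \<otimes> b) \<otimes> e)"
        using ab m[of "a \<otimes> b" e] u'[of "a \<otimes> b"] by (simp add: \<chi>_mult \<chi>_sym[of e b] mult_ac)
    qed
    also have "\<dots> = \<tau> * \<tau> * \<sigma> (a \<otimes> b) * (\<Sum>e\<in>carrier G. \<sigma> ((a \<otimes> b) \<otimes> e))"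
      by (simp add: sum_distrib_left)
    also have "(\<Sum>e\<in>carrier G. \<sigma> ((a \<otimes> b) \<otimes> e)) = gauss_sum G \<sigma>"
      unfolding gauss_sum_def by (rule sum.reindex_bij_betw)
        (use ab in \<open>auto intro!: bij_betw_byWitness[where f' = "\<lambda>z. (a \<otimes> b) \<otimes> z"] simp: sq_cancel\<close>)
    also have "\<tau> * \<tau> * \<sigma> (a \<otimes> b) * gauss_sum G \<sigma> = \<tau> * \<sigma> (a \<otimes> b)"
      using g \<tau>_gauss_sum(1)[OF \<sigma>] by (simp add: mult_ac)
    also have "\<dots> = \<epsilon> * \<epsilon> * \<sigma> b * (\<tau> * \<chi> a b) * \<sigma> a" using m[OF ab] \<epsilon>2 by simp
    finally show ?thesis by (simp add: mult_ac)
  qed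
  have mid': "(\<Sum>e\<in>carrier G. \<tau> * \<chi> b e * \<sigma> e * (\<tau> * \<chi> e a)) = \<epsilon> * \<sigma> b * (\<tau> * \<chi> b a) * (\<epsilon> * \<sigma> a)"
    if ab: "a \<in> carrier G" "b \<in> carrier G" for a b
    using mid[OF ab] ab by (simp add: \<chi>_sym[of a] \<chi>_sym[of _ b] cong: sum.cong)
  show ?thesis
  proof (cases "x = Mid \<and> y = Mid \<and> z = Mid")
    case True
    then have "hex1 (cf \<sigma> \<epsilon>) Mid Mid Mid (Inv d) \<and> hex2 (cf \<sigma> \<epsilon>) Mid Mid Mid (Inv d)" for d
      by (auto simp: hex1_def hex2_def channelL_def channelR_def)
    moreover have "hex1 (cf \<sigma> \<epsilon>) Mid Mid Mid Mid \<and> hex2 (cf \<sigma> \<epsilon>) Mid Mid Mid Mid"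
      by (auto simp: hex1_def hex2_def channel_Mid \<chi>_inverse sum.reindex inj_on_def mid mid' cong: sum.cong)
    ultimately show ?thesis using True by (cases t) auto
  next
    case False
    then show ?thesis
      by (cases x; cases y; cases z; cases t; use S t in \<open>auto simp: hex1_def hex2_def set_simples
        channelL_simps channelR_simps \<chi>_mult \<chi>_mult' m \<chi>_sq \<chi>_sq' u u' mult_ac \<chi>_self split: if_splits\<close>;
        metis \<chi>_sym)
  qed
qed

end

section \<open>Relabelling the simple objects\<close>

lemma concat_map_single:
  "distinct xs \<Longrightarrow> a \<in> set xs \<Longrightarrow> (\<And>x. x \<in> set xs \<Longrightarrow> x \<noteq> a \<Longrightarrow> f x = []) \<Longrightarrow> concat (map f xs) = f a"
proof (induction xs)
  case (Cons b xs)
  show ?case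
  proof (cases "b = a")
    case True
    then have "concat (map f xs) = []" using Cons.prems by auto
    then show ?thesis using True by simp
  next
    case False
    then show ?thesis using Cons by auto
  qed
qed simp

context real_ty
begin

lemma tens_ident:
  "ty_tens_arr G (\<lambda>s. 1\<^sub>m (N s)) (\<lambda>s. 1\<^sub>m (M s)) = (\<lambda>s. 1\<^sub>m (ty_tens G N M s))"
proof
  fix s
  have c: "\<And>s. 1\<^sub>m (N s) \<in> carrier_mat (N s) (N s)" "\<And>s. 1\<^sub>m (M s) \<in> carrier_mat (M s) (M s)" by simp_all
  show "ty_tens_arr G (\<lambda>s. 1\<^sub>m (N s)) (\<lambda>s. 1\<^sub>m (M s)) s = 1\<^sub>m (ty_tens G N M s)"
    unfolding ty_tens_arr_alt[of "\<lambda>s. 1\<^sub>m (N s)" N N "\<lambda>s. 1\<^sub>m (M s)" M M, OF c(1) c(2)]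
  proof (rule eq_matI, goal_cases)
    case (1 i j)
    then have ij: "i < ty_tens G N M s" "j < ty_tens G N M s" by auto
    from nth_ty_copiesE[OF ij(1)] obtain x p y q where
      i: "ty_copies G N M s ! i = (x, p, y, q)" "p < N x" "q < M y" by metis
    from nth_ty_copiesE[OF ij(2)] obtain x' p' y' q' where
      j: "ty_copies G N M s ! j = (x', p', y', q')" "p' < N x'" "q' < M y'" by metis
    have "i = j \<longleftrightarrow> (x, p, y, q) = (x', p', y', q')"
      using i j ij distinct_ty_copies[OF distinct_simples, of N M s] nth_eq_iff_index_eq
      by (metis ty_tens_def)
    then show ?case using ij i j by auto
  qed auto
qed

text \<open>The list itself, not just its set: the identity unitors depend on the copies keeping
  their order.\<close>

lemma ty_copies_unit_left:
  assumes X: "X \<in> obj C"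
  shows "ty_copies G (unit_obj C) X s = map (\<lambda>q. (Inv \<one>, 0, s, q)) [0..<X s]"
proof (cases "s \<in> set (simples G)")
  case True
  have f: "fusion G (Inv \<one>) y = {y}" if "y \<in> set (simples G)" for y using that by (auto simp: set_simples)
  have "ty_copies G (unit_obj C) X s = concat (map (\<lambda>y. if s \<in> fusion G (Inv \<one>) y then
      concat (map (\<lambda>p. map (\<lambda>q. (Inv \<one>, p, y, q)) [0..<X y]) [0..<unit_obj C (Inv \<one>)]) else []) (simples G))"
    unfolding ty_copies_def
    by (rule concat_map_single[OF distinct_simples]) (auto simp: set_simples C_simps)
  also have "\<dots> = (if s \<in> fusion G (Inv \<one>) s then
      concat (map (\<lambda>p. map (\<lambda>q. (Inv \<one>, p, s, q)) [0..<X s]) [0..<unit_obj C (Inv \<one>)]) else [])"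
    by (rule concat_map_single[OF distinct_simples True]) (auto simp: f)
  finally show ?thesis using f[OF True] by (simp add: C_simps)
next
  case False
  then have "set (ty_copies G (unit_obj C) X s) = {}"
    unfolding set_ty_copies using fusion_simples by blast
  then show ?thesis using False X by (simp add: C_simps)
qed

lemma ty_copies_unit_right:
  assumes X: "X \<in> obj C"
  shows "ty_copies G X (unit_obj C) s = map (\<lambda>p. (s, p, Inv \<one>, 0)) [0..<X s]"
proof (cases "s \<in> set (simples G)")
  case True
  have f: "fusion G y (Inv \<one>) = {y}" if "y \<in> set (simples G)" for y using that by (auto simp: set_simples)
  have i: "Inv \<one> \<in> set (simples G)" by (auto simp: set_simples)
  have "concat (map (\<lambda>y. if s \<in> fusion G x y then
      concat (map (\<lambda>p. map (\<lambda>q. (x, p, y, q)) [0..<unit_obj C y]) [0..<X x]) else []) (simples G))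
    = (if s \<in> fusion G x (Inv \<one>) then
      concat (map (\<lambda>p. map (\<lambda>q. (x, p, Inv \<one>, q)) [0..<unit_obj C (Inv \<one>)]) [0..<X x]) else [])" for x
    by (rule concat_map_single[OF distinct_simples i]) (auto simp: C_simps)
  then have "ty_copies G X (unit_obj C) s = concat (map (\<lambda>x. if s \<in> fusion G x (Inv \<one>) then
      concat (map (\<lambda>p. map (\<lambda>q. (x, p, Inv \<one>, q)) [0..<unit_obj C (Inv \<one>)]) [0..<X x]) else []) (simples G))"
    unfolding ty_copies_def by simp
  also have "\<dots> = (if s \<in> fusion G s (Inv \<one>) then
      concat (map (\<lambda>p. map (\<lambda>q. (s, p, Inv \<one>, q)) [0..<unit_obj C (Inv \<one>)]) [0..<X s]) else [])"
    by (rule concat_map_single[OF distinct_simples True]) (auto simp: f)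
  also have "\<dots> = map (\<lambda>p. (s, p, Inv \<one>, 0)) [0..<X s]"
    using f[OF True] by (simp add: C_simps)
  finally show ?thesis .
next
  case False
  then have "set (ty_copies G X (unit_obj C) s) = {}"
    unfolding set_ty_copies using fusion_simples by blast
  then show ?thesis using False X by (simp add: C_simps)
qed

end

text \<open>An isometric involution of the group. It is an involution of the whole type so that
  \<open>R\<close> permutes all labels, including those that are no simple object of the
  category.\<close>

locale relabelling = real_ty G \<chi> \<tau> for G :: "('a, 'b) monoid_scheme" (structure) and \<chi> \<tau> +
  fixes T :: "'a \<Rightarrow> 'a"
  assumes T_T [simp]: "T (T x) = x"
    and T_carrier: "x \<in> carrier G \<Longrightarrow> T x \<in> carrier G"
    and T_mult: "x \<in> carrier G \<Longrightarrow> y \<in> carrier G \<Longrightarrow> T (x \<otimes> y) = T x \<otimes> T y"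
    and T_\<chi>: "x \<in> carrier G \<Longrightarrow> y \<in> carrier G \<Longrightarrow> \<chi> (T x) (T y) = \<chi> x y"
begin

definition R :: "'a simple \<Rightarrow> 'a simple" where "R = map_simple T"

lemma R_simps [simp]: "R (Inv a) = Inv (T a)" "R Mid = Mid"
  by (auto simp: R_def)

lemma R_R [simp]: "R (R x) = x"
  by (cases x) auto

lemma bij_R: "bij R"
  by (rule bij_betw_byWitness[where f' = R]) auto

lemma R_eq_iff: "R x = y \<longleftrightarrow> x = R y"
  by auto

lemma T_carrier_iff: "T x \<in> carrier G \<longleftrightarrow> x \<in> carrier G"
  using T_carrier[of x] T_carrier[of "T x"] by auto

lemma T_one: "T \<one> = \<one>"
  using T_mult[of \<one> \<one>] T_carrier[of \<one>] by (simp add: sq_one)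

lemma R_simples [simp]: "R x \<in> set (simples G) \<longleftrightarrow> x \<in> set (simples G)"
  by (cases x) (auto simp: set_simples T_carrier_iff)

lemma R_fusion: "x \<in> set (simples G) \<Longrightarrow> y \<in> set (simples G) \<Longrightarrow> R s \<in> fusion G (R x) (R y) \<longleftrightarrow> s \<in> fusion G x y"
proof -
  have "Inv (T a) \<in> Inv ` carrier G \<longleftrightarrow> a \<in> carrier G" for a using T_carrier_iff by auto
  moreover have "T a = T b \<longleftrightarrow> a = b" for a b by (metis T_T)
  ultimately show "x \<in> set (simples G) \<Longrightarrow> y \<in> set (simples G) \<Longrightarrow> R s \<in> fusion G (R x) (R y) \<longleftrightarrow> s \<in> fusion G x y"
    by (cases x; cases y; cases s) (auto simp: set_simples T_mult[symmetric])
qed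

lemma R_assoc_coeff:
  assumes S: "x \<in> set (simples G)" "y \<in> set (simples G)" "z \<in> set (simples G)"
    and uw: "u \<in> channelL G x y z t" "w \<in> channelR G x y z t"
  shows "\<alpha> (R x) (R y) (R z) (R t) (R u) (R w) = \<alpha> x y z t u w"
proof -
  have t: "t \<in> set (simples G)" using channel_memb[OF S] uw by blast
  have uw': "u \<in> set (simples G)" "w \<in> set (simples G)"
    using S uw fusion_simples unfolding channelL_def channelR_def by blast+
  show ?thesis
    by (cases x; cases y; cases z; cases t; cases u; cases w) (use S t uw' in \<open>auto simp: set_simples T_\<chi>\<close>)
qed

section \<open>The relabelling functor and its monoidal structure\<close>

definition FO :: "'a ty_obj \<Rightarrow> 'a ty_obj" where "FO N = (\<lambda>s. N (R s))"
definition FM :: "'a ty_arr \<Rightarrow> 'a ty_arr" where "FM f = (\<lambda>s. f (R s))"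

text \<open>Relabelling permutes the order in which the copies in a product are listed, so the
  monoidal structure is a permutation matrix rather than an identity; its inverse is the
  transpose.\<close>

definition J :: "'a ty_obj \<Rightarrow> 'a ty_obj \<Rightarrow> 'a ty_arr" where
  "J N M s = mat (ty_tens G N M (R s)) (ty_tens G (FO N) (FO M) s) (\<lambda>(i, j).
     case ty_copies G N M (R s) ! i of (x', p', y', q') \<Rightarrow> case ty_copies G (FO N) (FO M) s ! j of (x, p, y, q) \<Rightarrow>
     if (x', p', y', q') = (R x, p, R y, q) then 1 else 0)"

lemma FO_obj: "N \<in> obj C \<Longrightarrow> FO N \<in> obj C"
  by (auto simp: C_simps FO_def)

lemma FO_FO [simp]: "FO (FO N) = N" and FM_FM [simp]: "FM (FM f) = f"
  by (simp_all add: FO_def FM_def)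

definition relab :: "'a simple \<times> nat \<Rightarrow> 'a simple \<times> nat" where "relab = map_prod R id"

lemma relab_simps [simp]: "relab (x, p) = (R x, p)" "fst (relab a) = R (fst a)" "snd (relab a) = snd a" "relab (relab a) = a"
  by (cases a; simp add: relab_def)+

lemma J_double: "J N M s = bmat (ty_tens G N M (R s)) (\<lambda>i. (lab G N M (R s) i, ()))
    (ty_tens G (FO N) (FO M) s) (\<lambda>j. (map_prod relab relab (lab G (FO N) (FO M) s j), ())) (\<lambda>_ _ _. 1)"
  by (rule eq_matI) (auto simp: J_def bmat_def lab_def split: prod.split)

lemma J_P:
  assumes \<mu>: "bij \<mu>" and \<nu>: "bij \<nu>"
  shows "J N M s = bmat (ty_tens G N M (R s)) (labP G \<mu> \<nu> N M (R s))
    (ty_tens G (FO N) (FO M) s) (labP G (\<lambda>(x, y). \<mu> (R x, R y)) \<nu> (FO N) (FO M) s) (\<lambda>k w v. if w = v then 1 else 0)"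
  by (rule eq_matI) (auto simp: J_def bmat_def labP_def bij_eq[OF \<mu>] bij_eq[OF \<nu>] split: prod.split)

lemma J_P_id: "J N M s = bmat (ty_tens G N M (R s)) (labP G id id N M (R s))
    (ty_tens G (FO N) (FO M) s) (labP G (\<lambda>(x, y). (R x, R y)) id (FO N) (FO M) s) (\<lambda>k w v. if w = v then 1 else 0)"
  using J_P[OF bij_id bij_id, of N M s] by simp

lemma J_inv_P:
  "transpose_mat (J N M s) = bmat (ty_tens G (FO N) (FO M) s) (labP G (\<lambda>(x, y). (R x, R y)) id (FO N) (FO M) s)
    (ty_tens G N M (R s)) (labP G id id N M (R s)) (\<lambda>k w v. if w = v then 1 else 0)"
  unfolding J_P_id transpose_bmat by (simp add: eq_commute cong: if_cong)

lemma bij_RR: "bij (\<lambda>(x, y). (R x, R y))" "bij (\<lambda>(x, y). (R y, R x))"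
  by (auto simp: bij_def inj_def surj_def) (metis R_R)+

lemma basis_PR: "basis (labP G (\<lambda>(x, y). (R x, R y)) id (FO N) (FO M) s) (ty_tens G (FO N) (FO M) s) (pair_channels N M (R s))"
  by (rule basis_labP[OF distinct_simples bij_RR(1) bij_id]) (auto simp: pair_channels_def FO_def R_fusion)

lemma basis_PR': "basis (labP G (\<lambda>(x, y). (R y, R x)) prod.swap (FO M) (FO N) s) (ty_tens G (FO M) (FO N) s) (pair_channels N M (R s))"
  by (rule basis_labP[OF distinct_simples bij_RR(2) bij_prod(1)]) (auto simp: pair_channels_def FO_def R_fusion fusion_comm)

lemma J_inverse: "inverse_arrows C (ty_tens G (FO N) (FO M)) (FO (ty_tens G N M)) (J N M) (\<lambda>s. transpose_mat (J N M s))"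
proof -
  have "transpose_mat (J N M s) * J N M s = 1\<^sub>m (ty_tens G (FO N) (FO M) s)"
    "J N M s * transpose_mat (J N M s) = 1\<^sub>m (ty_tens G N M (R s))" for s
    unfolding J_inv_P unfolding J_P_id bmat_mult_diag[OF basis_P basis_PR] bmat_mult_diag[OF basis_PR basis_P]
    by (simp_all add: bmat_one[OF basis_PR] bmat_one[OF basis_P])
  then show ?thesis
    by (auto simp: inverse_arrows_def C_simps FO_def J_def)
qed

lemma J_natural:
  assumes f: "f \<in> arr C X X'" and g: "g \<in> arr C Y Y'"
  shows "ty_tens_arr G f g (R s) * J X Y s = J X' Y' s * ty_tens_arr G (FM f) (FM g) s"
proof -
  let ?F = "\<lambda>k w v. f (fst k) $$ (fst w, fst v) * g (snd k) $$ (snd w, snd v)"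
  have 1: "ty_tens_arr G f g (R s) = bmat (ty_tens G X' Y' (R s)) (labP G id id X' Y' (R s))
     (ty_tens G X Y (R s)) (labP G id id X Y (R s)) ?F"
    by (rule ty_tens_arr_labP) (use f g in \<open>auto simp: C_simps\<close>)
  have 2: "ty_tens_arr G (FM f) (FM g) s = bmat (ty_tens G (FO X') (FO Y') s) (labP G (\<lambda>(x, y). (R x, R y)) id (FO X') (FO Y') s)
     (ty_tens G (FO X) (FO Y) s) (labP G (\<lambda>(x, y). (R x, R y)) id (FO X) (FO Y) s) ?F"
    by (rule ty_tens_arr_labP[OF bij_RR(1)]) (use f g in \<open>auto simp: C_simps FM_def FO_def\<close>)
  show ?thesis
    unfolding 1 2 J_P_id bmat_mult_diag[OF basis_P basis_PR] bmat_diag_mult[OF basis_PR basis_P]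
    by simp
qed

lemma J_braided:
  assumes c: "\<And>x y t. x \<in> set (simples G) \<Longrightarrow> y \<in> set (simples G) \<Longrightarrow> t \<in> fusion G x y \<Longrightarrow> c' (R x) (R y) (R t) = c x y t"
  shows "gbraid G c X Y (R s) * J X Y s = J Y X s * gbraid G c' (FO X) (FO Y) s"
proof -
  have 1: "J Y X s = bmat (ty_tens G Y X (R s)) (labP G prod.swap prod.swap Y X (R s))
    (ty_tens G (FO Y) (FO X) s) (labP G (\<lambda>(x, y). (R y, R x)) prod.swap (FO Y) (FO X) s) (\<lambda>k w v. if w = v then 1 else 0)"
    using J_P[OF bij_prod(1) bij_prod(1), of Y X s] by simp
  have 2: "gbraid G c' (FO X) (FO Y) s = bmat (ty_tens G (FO Y) (FO X) s) (labP G (\<lambda>(x, y). (R y, R x)) prod.swap (FO Y) (FO X) s)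
     (ty_tens G (FO X) (FO Y) s) (labP G (\<lambda>(x, y). (R x, R y)) id (FO X) (FO Y) s)
     (\<lambda>k w v. if w = v then c' (R (fst k)) (R (snd k)) s else 0)"
  proof -
    have "(\<lambda>(x, y). (R x, R y)) \<circ> prod.swap = (\<lambda>(x, y). (R y, R x))" by auto
    then show ?thesis
      using gbraid_labP[OF bij_RR(1) bij_id, of "\<lambda>k. c' (R (fst k)) (R (snd k)) s" c' s G "FO X" "FO Y"] by simp
  qed
  show ?thesis
    unfolding 1 2 gbraid_P[of c X Y] unfolding J_P_id
      bmat_mult_diag[OF basis_P basis_PR] bmat_mult_diag[OF basis_PR' basis_PR] bmat_eq_iff[OF basis_P' basis_PR]
    using c[of _ _ "R s"] by (auto simp: pair_channels_def bmat_eq_iff[OF basis_P' basis_PR])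
qed

text \<open>When the labels of the source are read through \<open>R\<close>, \<open>J\<close>
  preserves key and channel. The inner factor keeps an arbitrary labelling \<open>e\<close>, so that
  this applies to iterated products.\<close>

lemma J_nestL:
  assumes e: "\<And>u. u \<in> set (simples G) \<Longrightarrow> bij_betw (e u) {..<N u} (E u)"
  shows "J N Z t = bmat (ty_tens G N Z (R t)) (nestL G (\<lambda>k c. (fst k, snd k, c)) id e N Z (R t))
     (ty_tens G (FO N) (FO Z) t) (nestL G (\<lambda>k c. (fst k, snd k, relab c)) R (\<lambda>u. e (R u)) (FO N) (FO Z) t)
     (\<lambda>k w v. if w = v then 1 else 0)"
proof (rule eq_matI, goal_cases)
  case (1 i j)
  have e_eq: "u \<in> set (simples G) \<Longrightarrow> k < N u \<Longrightarrow> k' < N u \<Longrightarrow> e u k = e u k' \<longleftrightarrow> k = k'" for u k k'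
    using e[of u] by (auto simp: bij_betw_def inj_on_def)
  from 1 have ij: "i < ty_tens G N Z (R t)" "j < ty_tens G (FO N) (FO Z) t" by auto
  from nth_ty_copiesE[OF ij(1)] obtain u' k' z' r' where
    i: "ty_copies G N Z (R t) ! i = (u', k', z', r')" "k' < N u'" "u' \<in> set (simples G)" by metis
  from nth_ty_copiesE[OF ij(2)] obtain u k z r where
    j: "ty_copies G (FO N) (FO Z) t ! j = (u, k, z, r)" "k < FO N u" "u \<in> set (simples G)" by metis
  have "k < N (R u)" using j by (simp add: FO_def)
  then have "u' = R u \<Longrightarrow> fst (e (R u) k') = fst (e (R u) k) \<and> snd (e (R u) k') = snd (e (R u) k) \<longleftrightarrow> k' = k"
    using e_eq[of "R u" k' k] i j by (auto simp: prod_eq_iff)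
  then show ?case
    using ij i(1) j(1) by (auto simp: J_def bmat_def nestL_def)
qed (auto simp: J_def)

lemma J_nestR:
  assumes e: "\<And>u. u \<in> set (simples G) \<Longrightarrow> bij_betw (e u) {..<N u} (E u)"
  shows "J X N t = bmat (ty_tens G X N (R t)) (nestR G (\<lambda>a k. (a, fst k, snd k)) id e X N (R t))
     (ty_tens G (FO X) (FO N) t) (nestR G (\<lambda>a k. (relab a, fst k, snd k)) R (\<lambda>u. e (R u)) (FO X) (FO N) t)
     (\<lambda>k w v. if w = v then 1 else 0)"
proof (rule eq_matI, goal_cases)
  case (1 i j)
  have e_eq: "u \<in> set (simples G) \<Longrightarrow> k < N u \<Longrightarrow> k' < N u \<Longrightarrow> e u k = e u k' \<longleftrightarrow> k = k'" for u k k'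
    using e[of u] by (auto simp: bij_betw_def inj_on_def)
  from 1 have ij: "i < ty_tens G X N (R t)" "j < ty_tens G (FO X) (FO N) t" by auto
  from nth_ty_copiesE[OF ij(1)] obtain u' k' z' r' where
    i: "ty_copies G X N (R t) ! i = (z', r', u', k')" "k' < N u'" "u' \<in> set (simples G)" by metis
  from nth_ty_copiesE[OF ij(2)] obtain u k z r where
    j: "ty_copies G (FO X) (FO N) t ! j = (z, r, u, k)" "k < FO N u" "u \<in> set (simples G)" by metis
  have "k < N (R u)" using j by (simp add: FO_def)
  then have "u' = R u \<Longrightarrow> fst (e (R u) k') = fst (e (R u) k) \<and> snd (e (R u) k') = snd (e (R u) k) \<longleftrightarrow> k' = k"
    using e_eq[of "R u" k' k] i j by (auto simp: prod_eq_iff)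
  then show ?case
    using ij i(1) j(1) by (auto simp: J_def bmat_def nestR_def)
qed (auto simp: J_def)

lemma bij_relab:
  "bij (\<lambda>(a, b, c). (relab a, relab b, relab c))" "bij (\<lambda>(a, k). (relab a, fst k, snd k))" "bij (\<lambda>(k, c). (fst k, snd k, relab c))"
proof -
  show "bij (\<lambda>(a, b, c). (relab a, relab b, relab c))"
    by (rule bij_betw_byWitness[where f' = "\<lambda>(a, b, c). (relab a, relab b, relab c)"]) auto
  show "bij (\<lambda>(a, k). (relab a, fst k, snd k))"
    by (rule bij_betw_byWitness[where f' = "\<lambda>(a, b, c). (relab a, b, c)"]) auto
  show "bij (\<lambda>(k, c). (fst k, snd k, relab c))"
    by (rule bij_betw_byWitness[where f' = "\<lambda>(a, b, c). ((a, b), relab c)"]) auto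
qed

text \<open>On common labels every \<open>J\<close> has coefficient 1 on equal channels, and the
  coherence reduces to the invariance of the associator coefficients under an isometry,
  \<open>R_assoc_coeff\<close>.\<close>

lemma J_coherence:
  "ty_assoc G \<chi> \<tau> X Y Z (R t) * J (ty_tens G X Y) Z t * ty_tens_arr G (J X Y) (\<lambda>s. 1\<^sub>m (FO Z s)) t =
   J X (ty_tens G Y Z) t * ty_tens_arr G (\<lambda>s. 1\<^sub>m (FO X s)) (J Y Z) t * ty_assoc G \<chi> \<tau> (FO X) (FO Y) (FO Z) t"
proof -
  let ?X = "FO X" and ?Y = "FO Y" and ?Z = "FO Z"
  \<comment> \<open>The six vertices of the coherence diagram, keyed by copies in the original X, Y,
    Z: \<open>?B1\<close> to \<open>?B3\<close> are left-bracketed with \<open>J\<close> applied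
    zero, one and two times, and \<open>?B4\<close> to \<open>?B6\<close> likewise
    right-bracketed.\<close>
  let ?B1 = "nestL G (\<lambda>k c. (relab (fst k), relab (snd k), relab c)) R (lab G ?X ?Y) (ty_tens G ?X ?Y) ?Z t"
  let ?B2 = "nestL G (\<lambda>k c. (fst k, snd k, relab c)) R (\<lambda>u. lab G X Y (R u)) (FO (ty_tens G X Y)) ?Z t"
  let ?B3 = "nestL G (\<lambda>k c. (fst k, snd k, c)) id (lab G X Y) (ty_tens G X Y) Z (R t)"
  let ?B4 = "nestR G (\<lambda>a k. (relab a, relab (fst k), relab (snd k))) R (lab G ?Y ?Z) ?X (ty_tens G ?Y ?Z) t"
  let ?B5 = "nestR G (\<lambda>a k. (relab a, fst k, snd k)) R (\<lambda>u. lab G Y Z (R u)) ?X (FO (ty_tens G Y Z)) t"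
  let ?B6 = "nestR G (\<lambda>a k. (a, fst k, snd k)) id (lab G Y Z) X (ty_tens G Y Z) (R t)"
  define UL where "UL = (\<lambda>k. if valid G X Y Z k then channelL G (fst (fst k)) (fst (fst (snd k))) (fst (snd (snd k))) (R t) else {})"
  define UR where "UR = (\<lambda>k. if valid G X Y Z k then channelR G (fst (fst k)) (fst (fst (snd k))) (fst (snd (snd k))) (R t) else {})"
  note bl = bij_lab[OF distinct_simples]
  have RL: "R u \<in> channelL G (R x) (R y) (R z) (R t) \<longleftrightarrow> u \<in> channelL G x y z t"
    "R u \<in> channelR G (R x) (R y) (R z) (R t) \<longleftrightarrow> u \<in> channelR G x y z t"
    if "x \<in> set (simples G)" "y \<in> set (simples G)" "z \<in> set (simples G)" for x y z u
    using that R_fusion fusion_simples unfolding channelL_def channelR_def by blast+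
  have B1: "basis ?B1 (ty_tens G (ty_tens G ?X ?Y) ?Z t) UL"
    by (rule basis_L[where \<kappa> = "\<lambda>a b c. (relab a, relab b, relab c)", OF bij_relab(1) bij_R])
      (auto simp: UL_def valid_def FO_def RL)
  have B4: "basis ?B4 (ty_tens G ?X (ty_tens G ?Y ?Z) t) UR"
    by (rule basis_R[where \<kappa> = "\<lambda>a b c. (relab a, relab b, relab c)", OF bij_relab(1) bij_R])
      (auto simp: UR_def valid_def FO_def RL)
  have B3: "basis ?B3 (ty_tens G (ty_tens G X Y) Z (R t)) UL"
    by (rule basis_L[where \<kappa> = "\<lambda>a b c. (a, b, c)"]) (auto simp: bij_perms UL_def)
  have B6: "basis ?B6 (ty_tens G X (ty_tens G Y Z) (R t)) UR"
    by (rule basis_R[where \<kappa> = "\<lambda>a b c. (a, b, c)"]) (auto simp: bij_perms UR_def)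
  have B2: "basis ?B2 (ty_tens G (FO (ty_tens G X Y)) ?Z t) UL"
  proof (rule basis_nestL[OF distinct_simples _ bij_relab(3) bij_R])
    show "bij_betw (lab G X Y (R u)) {..<FO (ty_tens G X Y) u} (labels G X Y (R u))" for u
      using bl[of X Y "R u"] by (simp add: FO_def)
    show "R u \<in> UL (fst k, snd k, relab (z, r)) \<longleftrightarrow> u \<in> set (simples G) \<and> z \<in> set (simples G) \<and>
          k \<in> labels G X Y (R u) \<and> t \<in> fusion G u z \<and> r < ?Z z" for u k z r
      using fusion_simples[of "fst (fst k)" "fst (snd k)" "R u"]
      by (auto simp: UL_def valid_def labels_def channelL_def FO_def R_fusion)
  qed
  have B5: "basis ?B5 (ty_tens G ?X (FO (ty_tens G Y Z)) t) UR"
  proof (rule basis_nestR[OF distinct_simples _ bij_relab(2) bij_R])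
    show "bij_betw (lab G Y Z (R u)) {..<FO (ty_tens G Y Z) u} (labels G Y Z (R u))" for u
      using bl[of Y Z "R u"] by (simp add: FO_def)
    show "R u \<in> UR (relab (x, p), fst k, snd k) \<longleftrightarrow> u \<in> set (simples G) \<and> x \<in> set (simples G) \<and>
          k \<in> labels G Y Z (R u) \<and> t \<in> fusion G x u \<and> p < ?X x" for u k x p
      using fusion_simples[of "fst (fst k)" "fst (snd k)" "R u"]
      by (auto simp: UR_def valid_def labels_def channelR_def FO_def R_fusion)
  qed
  have a1: "ty_assoc G \<chi> \<tau> X Y Z (R t) = bmat (ty_tens G X (ty_tens G Y Z) (R t)) ?B6 (ty_tens G (ty_tens G X Y) Z (R t)) ?B3
     (\<lambda>k w u. \<alpha> (fst (fst k)) (fst (fst (snd k))) (fst (snd (snd k))) (R t) u w)"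
    by (rule ty_assoc_nest[where \<kappa> = "\<lambda>a b c. (a, b, c)"]) (auto simp: bij_perms)
  have a2: "ty_assoc G \<chi> \<tau> ?X ?Y ?Z t = bmat (ty_tens G ?X (ty_tens G ?Y ?Z) t) ?B4 (ty_tens G (ty_tens G ?X ?Y) ?Z t) ?B1
     (\<lambda>k w u. \<alpha> (R (fst (fst k))) (R (fst (fst (snd k)))) (R (fst (snd (snd k)))) t (R u) (R w))"
    by (rule ty_assoc_nest[where \<kappa> = "\<lambda>a b c. (relab a, relab b, relab c)", OF bij_relab(1) bij_R]) auto
  have j1: "J (ty_tens G X Y) Z t = bmat (ty_tens G (ty_tens G X Y) Z (R t)) ?B3 (ty_tens G (FO (ty_tens G X Y)) ?Z t) ?B2
     (\<lambda>k w v. if w = v then 1 else 0)"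
    by (rule J_nestL[OF bl])
  have j2: "J X (ty_tens G Y Z) t = bmat (ty_tens G X (ty_tens G Y Z) (R t)) ?B6 (ty_tens G ?X (FO (ty_tens G Y Z)) t) ?B5
     (\<lambda>k w v. if w = v then 1 else 0)"
    by (rule J_nestR[OF bl])
  have j3: "ty_tens_arr G (J X Y) (\<lambda>s. 1\<^sub>m (?Z s)) t = bmat (ty_tens G (FO (ty_tens G X Y)) ?Z t) ?B2
     (ty_tens G (ty_tens G ?X ?Y) ?Z t) ?B1 (\<lambda>k w v. if w = v then 1 else 0)"
    using tens_id_right[where A = G and \<kappa> = "\<lambda>k c. (fst k, snd k, relab c)" and \<rho> = R and f = "J X Y" and
        b = "\<lambda>u l. 1" and e = "\<lambda>u k. map_prod relab relab (lab G ?X ?Y u k)" and N = "ty_tens G ?X ?Y" and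
        e' = "\<lambda>u. lab G X Y (R u)" and N' = "FO (ty_tens G X Y)" and G = "\<lambda>_ _. 1" and Z = ?Z and t = t, OF bij_relab(3) bij_R]
    by (simp add: nestL_comp[where f = "map_prod relab relab"] J_double FO_def)
  have j4: "ty_tens_arr G (\<lambda>s. 1\<^sub>m (?X s)) (J Y Z) t = bmat (ty_tens G ?X (FO (ty_tens G Y Z)) t) ?B5
     (ty_tens G ?X (ty_tens G ?Y ?Z) t) ?B4 (\<lambda>k w v. if w = v then 1 else 0)"
    using tens_id_left[where A = G and \<kappa> = "\<lambda>a k. (relab a, fst k, snd k)" and \<rho> = R and f = "J Y Z" and
        b = "\<lambda>u l. 1" and e = "\<lambda>u k. map_prod relab relab (lab G ?Y ?Z u k)" and N = "ty_tens G ?Y ?Z" and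
        e' = "\<lambda>u. lab G Y Z (R u)" and N' = "FO (ty_tens G Y Z)" and G = "\<lambda>_ _. 1" and X = ?X and t = t, OF bij_relab(2) bij_R]
    by (simp add: nestR_comp[where f = "map_prod relab relab"] J_double FO_def) (simp add: map_prod_def case_prod_unfold)
  show ?thesis
    unfolding a1 a2 j1 j2 j3 j4 bmat_mult_diag[OF B3 B2] bmat_mult_diag[OF B2 B1]
      bmat_diag_mult[OF B5 B6] mult_1_left mult_1_right bmat_diag_mult[OF B4 B6] bmat_eq_iff[OF B6 B1]
    using R_assoc_coeff[of _ _ _ _ "R t"] by (auto simp: UL_def UR_def valid_def)
qed

lemma FO_unit: "FO (unit_obj C) = unit_obj C"
  by (auto simp: FO_def C_simps fun_eq_iff R_eq_iff T_one)

lemma J_unit_left: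
  assumes "X \<in> obj C"
  shows "J (unit_obj C) X s = 1\<^sub>m (X (R s))"
  unfolding J_def FO_unit ty_tens_def ty_copies_unit_left[OF assms] ty_copies_unit_left[OF FO_obj[OF assms]]
  by (intro eq_matI) (auto simp: T_one FO_def)

lemma J_unit_right:
  assumes "X \<in> obj C"
  shows "J X (unit_obj C) s = 1\<^sub>m (X (R s))"
  unfolding J_def FO_unit ty_tens_def ty_copies_unit_right[OF assms] ty_copies_unit_right[OF FO_obj[OF assms]]
  by (intro eq_matI) (auto simp: T_one FO_def)

lemma ident_inverse: "inverse_arrows C X X (ident C X) (ident C X)"
  by (simp add: inverse_arrows_def C_simps)

lemma relabel_functor: "functor_on C C FO FM"
  using FO_obj by (auto simp: functor_on_def C_simps FO_def FM_def)

lemma relabel_linear: "linear_functor C C FO FM"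
  using relabel_functor by (auto simp: linear_functor_def C_simps FM_def)

text \<open>Since \<open>R\<close> is an involution, the functor is strictly its own inverse, with
  identities as unit and counit.\<close>

lemma relabel_equivalence: "equivalence_functor C C FO FM"
proof -
  have "iso_arrow C X (FO (FO X)) (ident C X)" "iso_arrow C (FO (FO X)) X (ident C X)" for X
    using ident_inverse unfolding iso_arrow_def by auto
  moreover have "ident C Y \<cdot>\<^bsub>C\<^esub> f = FM (FM f) \<cdot>\<^bsub>C\<^esub> ident C X" "ident C Y \<cdot>\<^bsub>C\<^esub> FM (FM f) = f \<cdot>\<^bsub>C\<^esub> ident C X"
    if "f \<in> arr C X Y" for X Y f
  proof -
    have "f s \<in> carrier_mat (Y s) (X s)" for s using that by (simp add: C_simps)
    then have "1\<^sub>m (Y s) * f s = f s" "f s * 1\<^sub>m (X s) = f s" for s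
      using left_mult_one_mat right_mult_one_mat by blast+
    then show "ident C Y \<cdot>\<^bsub>C\<^esub> f = FM (FM f) \<cdot>\<^bsub>C\<^esub> ident C X" "ident C Y \<cdot>\<^bsub>C\<^esub> FM (FM f) = f \<cdot>\<^bsub>C\<^esub> ident C X"
      by (simp_all add: C_simps)
  qed
  ultimately show ?thesis
    unfolding equivalence_functor_def using relabel_functor by blast
qed

lemma relabel_monoidal: "monoidal_functor C C FO FM J (ident C (unit_obj C))"
  unfolding monoidal_functor_def
proof (intro conjI ballI relabel_functor)
  show "iso_arrow C (FO X \<boxtimes>\<^bsub>C\<^esub> FO Y) (FO (X \<boxtimes>\<^bsub>C\<^esub> Y)) (J X Y)" for X Y
    using J_inverse unfolding iso_arrow_def C_simps by blast
  show "iso_arrow C (unit_obj C) (FO (unit_obj C)) (ident C (unit_obj C))"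
    using ident_inverse unfolding iso_arrow_def FO_unit by blast
  show "FM (f \<boxdot>\<^bsub>C\<^esub> g) \<cdot>\<^bsub>C\<^esub> J X Y = J X' Y' \<cdot>\<^bsub>C\<^esub> (FM f \<boxdot>\<^bsub>C\<^esub> FM g)"
    if "f \<in> arr C X X'" "g \<in> arr C Y Y'" for X X' Y Y' f g
    using J_natural[OF that] by (simp add: C_simps fun_eq_iff FM_def[of "ty_tens_arr G f g"])
  show "FM (assoc C X Y Z) \<cdot>\<^bsub>C\<^esub> J (X \<boxtimes>\<^bsub>C\<^esub> Y) Z \<cdot>\<^bsub>C\<^esub> (J X Y \<boxdot>\<^bsub>C\<^esub> ident C (FO Z)) =
        J X (Y \<boxtimes>\<^bsub>C\<^esub> Z) \<cdot>\<^bsub>C\<^esub> (ident C (FO X) \<boxdot>\<^bsub>C\<^esub> J Y Z) \<cdot>\<^bsub>C\<^esub> assoc C (FO X) (FO Y) (FO Z)" for X Y Z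
    using J_coherence[of X Y Z] by (simp add: C_simps fun_eq_iff FM_def)
  fix X assume X: "X \<in> obj C"
  have d: "ty_tens G (unit_obj C) (FO X) s = X (R s)" "ty_tens G (FO X) (unit_obj C) s = X (R s)" for s
    using ty_copies_unit_left[OF FO_obj[OF X], of s] ty_copies_unit_right[OF FO_obj[OF X], of s]
    by (simp_all add: ty_tens_def FO_def)
  show "FM (lunit C X) \<cdot>\<^bsub>C\<^esub> J (unit_obj C) X \<cdot>\<^bsub>C\<^esub> (ident C (unit_obj C) \<boxdot>\<^bsub>C\<^esub> ident C (FO X)) = lunit C (FO X)"
    unfolding C_simps(3,4,8,11) tens_ident using J_unit_left[OF X] d by (simp add: FM_def FO_def)
  show "FM (runit C X) \<cdot>\<^bsub>C\<^esub> J X (unit_obj C) \<cdot>\<^bsub>C\<^esub> (ident C (FO X) \<boxdot>\<^bsub>C\<^esub> ident C (unit_obj C)) = runit C (FO X)"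
    unfolding C_simps(3,4,8,12) tens_ident using J_unit_right[OF X] d by (simp add: FM_def FO_def)
qed

lemma relabel_braided_equivalent:
  assumes "\<And>x. x \<in> carrier G \<Longrightarrow> \<sigma>' (T x) = \<sigma> x"
  shows "braided_equivalent C (gbraid G (cf \<sigma> \<epsilon>)) C (gbraid G (cf \<sigma>' \<epsilon>))"
proof -
  have "cf \<sigma>' \<epsilon> (R x) (R y) (R t) = cf \<sigma> \<epsilon> x y t"
    if "x \<in> set (simples G)" "y \<in> set (simples G)" "t \<in> fusion G x y" for x y t
    by (cases x; cases y; cases t) (use that assms in \<open>auto simp: set_simples T_\<chi>\<close>)
  note J_braided[where c = "cf \<sigma> \<epsilon>" and c' = "cf \<sigma>' \<epsilon>", OF this]
  then have "FM (gbraid G (cf \<sigma> \<epsilon>) X Y) \<cdot>\<^bsub>C\<^esub> J X Y = J Y X \<cdot>\<^bsub>C\<^esub> gbraid G (cf \<sigma>' \<epsilon>) (FO X) (FO Y)" for X Y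
    by (simp add: C_simps fun_eq_iff FM_def)
  then show ?thesis
    unfolding braided_equivalent_def using relabel_linear relabel_equivalence relabel_monoidal by blast
qed

end

section \<open>Forms of equal sign differ by a transvection\<close>

context real_ty
begin

text \<open>The product \<open>\<psi>\<close> of the two forms is a character. Its Fourier
  coefficients add up to the order of the group times \<open>\<psi> \<one>\<close>, so some
  coefficient, at \<open>v\<close>, is nonzero; a character with nonzero sum is trivial, so
  \<open>\<psi>\<close> equals \<open>\<chi> v\<close>.\<close>

lemma QF_ratio_character:
  assumes \<sigma>: "\<sigma> \<in> QF G \<chi>" and \<sigma>': "\<sigma>' \<in> QF G \<chi>"
  shows "\<exists>v\<in>carrier G. \<forall>x\<in>carrier G. \<sigma>' x = \<sigma> x * \<chi> v x"
proof -
  have u: "\<sigma> x = 1 \<or> \<sigma> x = - 1" "\<sigma>' x = 1 \<or> \<sigma>' x = - 1" if "x \<in> carrier G" for x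
    using assms that by (auto simp: QF_iff)
  have m: "\<sigma> (x \<otimes> y) = \<sigma> x * \<sigma> y * \<chi> x y" "\<sigma>' (x \<otimes> y) = \<sigma>' x * \<sigma>' y * \<chi> x y"
    if "x \<in> carrier G" "y \<in> carrier G" for x y using assms that by (auto simp: QF_iff)
  have one: "\<sigma> \<one> = 1" "\<sigma>' \<one> = 1"
    using m[of \<one> \<one>] u[of \<one>] by (auto simp: \<chi>_one)
  define \<psi> where "\<psi> x = \<sigma> x * \<sigma>' x" for x
  have "(\<Sum>v\<in>carrier G. \<Sum>x\<in>carrier G. \<psi> x * \<chi> v x) = (\<Sum>x\<in>carrier G. \<psi> x * (\<Sum>v\<in>carrier G. \<chi> x v))"
    by (subst sum.swap) (simp add: sum_distrib_left \<chi>_sym cong: sum.cong)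
  also have "\<dots> = (\<Sum>x\<in>carrier G. if x = \<one> then \<psi> x * real (card (carrier G)) else 0)"
    by (rule sum.cong) (auto simp: sum_\<chi>)
  also have "\<dots> = real (card (carrier G))"
    using fin one by (simp add: \<psi>_def)
  finally have "(\<Sum>v\<in>carrier G. \<Sum>x\<in>carrier G. \<psi> x * \<chi> v x) \<noteq> 0"
    using \<tau>_sq by (metis mult_zero_right zero_neq_one)
  then obtain v where v: "v \<in> carrier G" "(\<Sum>x\<in>carrier G. \<psi> x * \<chi> v x) \<noteq> 0"
    by (meson sum.not_neutral_contains_not_neutral)
  have "\<psi> (x \<otimes> y) * \<chi> v (x \<otimes> y) = \<psi> x * \<chi> v x * (\<psi> y * \<chi> v y)"
    if "x \<in> carrier G" "y \<in> carrier G" for x y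
    using that v(1) \<chi>_sq'[of x y] by (simp add: \<psi>_def m \<chi>_mult' mult_ac)
  then have "\<psi> x * \<chi> v x = 1" if "x \<in> carrier G" for x
    using sum_character[of "\<lambda>x. \<psi> x * \<chi> v x" x] v that by blast
  then have "\<sigma>' x = \<sigma> x * \<chi> v x" if "x \<in> carrier G" for x
    using u[OF that] \<chi>_unit[OF v(1) that] that by (force simp: \<psi>_def)
  then show ?thesis using v(1) by blast
qed

text \<open>Each summand is \<open>\<sigma> v * \<sigma> (v \<otimes> x)\<close>, and translation by
  \<open>v\<close> permutes the group.\<close>

lemma gauss_sum_shift:
  assumes \<sigma>: "\<sigma> \<in> QF G \<chi>" and v: "v \<in> carrier G"
  shows "(\<Sum>x\<in>carrier G. \<sigma> x * \<chi> v x) = \<sigma> v * gauss_sum G \<sigma>"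
proof -
  have m: "\<sigma> (v \<otimes> x) = \<sigma> v * \<sigma> x * \<chi> v x" if "x \<in> carrier G" for x using \<sigma> v that by (auto simp: QF_iff)
  have u: "\<sigma> v * \<sigma> v = 1" using \<sigma> v by (force simp: QF_iff)
  have shift: "(\<Sum>x\<in>carrier G. \<sigma> (v \<otimes> x)) = gauss_sum G \<sigma>"
    unfolding gauss_sum_def by (rule sum.reindex_bij_betw)
      (use v in \<open>auto intro!: bij_betw_byWitness[where f' = "\<lambda>z. v \<otimes> z"] simp: sq_cancel\<close>)
  have "\<sigma> v * gauss_sum G \<sigma> = \<sigma> v * (\<Sum>x\<in>carrier G. \<sigma> (v \<otimes> x))"
    by (simp add: shift)
  also have "\<dots> = (\<Sum>x\<in>carrier G. (\<sigma> v * \<sigma> v) * (\<sigma> x * \<chi> v x))"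
    by (simp add: sum_distrib_left m mult_ac cong: sum.cong)
  finally show ?thesis using u by simp
qed

lemma same_sign_braided_equivalent:
  assumes \<sigma>: "\<sigma> \<in> QF G \<chi>" and \<sigma>': "\<sigma>' \<in> QF G \<chi>"
    and sgn: "sgn (gauss_sum G \<sigma>) = sgn \<tau>" "sgn (gauss_sum G \<sigma>') = sgn \<tau>"
  shows "braided_equivalent C (gbraid G (cf \<sigma> \<epsilon>)) C (gbraid G (cf \<sigma>' \<epsilon>))"
proof -
  obtain v where v: "v \<in> carrier G" and eq: "\<And>x. x \<in> carrier G \<Longrightarrow> \<sigma>' x = \<sigma> x * \<chi> v x"
    using QF_ratio_character[OF \<sigma> \<sigma>'] by blast
  have "gauss_sum G \<sigma>' = \<sigma> v * gauss_sum G \<sigma>"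
    using gauss_sum_shift[OF \<sigma> v] eq by (simp add: gauss_sum_def)
  then have \<sigma>v: "\<sigma> v = 1"
    using \<tau>_gauss_sum(1)[OF \<sigma>] \<tau>_gauss_sum(1)[OF \<sigma>'] sgn by (metis mult.left_commute mult.right_neutral)
  \<comment> \<open>The transvection along \<open>v\<close>, which adds \<open>v\<close> to the
    elements not orthogonal to it. It is the identity outside the carrier, to be an involution of
    the type.\<close>
  define T where "T x = (if x \<in> carrier G \<and> \<chi> v x = - 1 then v \<otimes> x else x)" for x
  have m: "\<sigma> (x \<otimes> y) = \<sigma> x * \<sigma> y * \<chi> x y" if "x \<in> carrier G" "y \<in> carrier G" for x y
    using \<sigma> that by (auto simp: QF_iff)
  have vx: "\<chi> v x = 1 \<or> \<chi> v x = - 1" if "x \<in> carrier G" for x using \<chi>_unit v that by blast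
  interpret relabelling G \<chi> \<tau> T
  proof
    show "T (T x) = x" for x
      using v by (auto simp: T_def \<chi>_mult' \<chi>_self sq_cancel)
    show "T x \<in> carrier G" if "x \<in> carrier G" for x using that v by (auto simp: T_def)
    show "T (x \<otimes> y) = T x \<otimes> T y" if "x \<in> carrier G" "y \<in> carrier G" for x y
      using that v vx[of x] vx[of y] by (auto simp: T_def \<chi>_mult' m_ac sq_cancel)
    show "\<chi> (T x) (T y) = \<chi> x y" if "x \<in> carrier G" "y \<in> carrier G" for x y
      using that v vx[of x] vx[of y] \<chi>_sym[of x v] by (auto simp: T_def \<chi>_mult \<chi>_mult' \<chi>_self)
  qed
  show ?thesis
  proof (rule relabel_braided_equivalent)
    fix x assume x: "x \<in> carrier G"
    \<comment> \<open>If \<open>\<chi> v x = - 1\<close>, the factor \<open>\<chi> v x\<close> from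
      the quadratic relation cancels against the one from the twist, and
      \<open>\<sigma> v = 1\<close>.\<close>
    then show "\<sigma>' (T x) = \<sigma> x"
      using v vx[OF x] by (auto simp: T_def eq m \<sigma>v \<chi>_mult' \<chi>_self)
  qed
qed

subsection \<open>Invariance of \<open>\<epsilon>\<close>\<close>

lemma cmp_arr: "f \<in> arr C X Y \<Longrightarrow> g \<in> arr C Y Z \<Longrightarrow> g \<cdot>\<^bsub>C\<^esub> f \<in> arr C X Z"
  by (auto simp: C_simps intro: mult_carrier_mat)

lemma cmp_assoc:
  assumes "f \<in> arr C X Y" "g \<in> arr C Y Z" "k \<in> arr C Z W"
  shows "k \<cdot>\<^bsub>C\<^esub> g \<cdot>\<^bsub>C\<^esub> f = k \<cdot>\<^bsub>C\<^esub> (g \<cdot>\<^bsub>C\<^esub> f)"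
proof -
  have "k s * g s * f s = k s * (g s * f s)" for s
    by (rule assoc_mult_mat[of _ "W s" "Z s" _ "Y s" _ "X s"]) (use assms in \<open>auto simp: C_simps\<close>)
  then show ?thesis by (simp add: C_simps)
qed

lemma cmp_ident:
  assumes "f \<in> arr C X Y"
  shows "f \<cdot>\<^bsub>C\<^esub> ident C X = f" "ident C Y \<cdot>\<^bsub>C\<^esub> f = f"
proof -
  have "f s \<in> carrier_mat (Y s) (X s)" for s using assms by (simp add: C_simps)
  then have "1\<^sub>m (Y s) * f s = f s" "f s * 1\<^sub>m (X s) = f s" for s
    using left_mult_one_mat right_mult_one_mat by blast+
  then show "f \<cdot>\<^bsub>C\<^esub> ident C X = f" "ident C Y \<cdot>\<^bsub>C\<^esub> f = f" by (simp_all add: C_simps)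
qed

lemma ident_arr: "ident C X \<in> arr C X X"
  by (simp add: C_simps)

lemma inverse_arrowsD:
  assumes "inverse_arrows C X Y f g"
  shows "f \<in> arr C X Y" "g \<in> arr C Y X" "g \<cdot>\<^bsub>C\<^esub> f = ident C X" "f \<cdot>\<^bsub>C\<^esub> g = ident C Y"
  using assms by (auto simp: inverse_arrows_def)

lemma iso_cancel_right:
  assumes "iso_arrow C X Y e" "g \<in> arr C Y Z" "g' \<in> arr C Y Z" "g \<cdot>\<^bsub>C\<^esub> e = g' \<cdot>\<^bsub>C\<^esub> e"
  shows "g = g'"
proof -
  obtain e' where e': "inverse_arrows C X Y e e'" using assms(1) by (auto simp: iso_arrow_def)
  note e = inverse_arrowsD[OF e']
  have "g = g \<cdot>\<^bsub>C\<^esub> e \<cdot>\<^bsub>C\<^esub> e'" using cmp_assoc[OF e(2,1) assms(2)] e(4) cmp_ident[OF assms(2)] by simp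
  also have "\<dots> = g'" unfolding assms(4) using cmp_assoc[OF e(2,1) assms(3)] e(4) cmp_ident[OF assms(3)] by simp
  finally show ?thesis .
qed

lemma iso_cancel_left:
  assumes "iso_arrow C Y Z e" "g \<in> arr C X Y" "g' \<in> arr C X Y" "e \<cdot>\<^bsub>C\<^esub> g = e \<cdot>\<^bsub>C\<^esub> g'"
  shows "g = g'"
proof -
  obtain e' where e': "inverse_arrows C Y Z e e'" using assms(1) by (auto simp: iso_arrow_def)
  note e = inverse_arrowsD[OF e']
  have "g = e' \<cdot>\<^bsub>C\<^esub> (e \<cdot>\<^bsub>C\<^esub> g)" using cmp_assoc[OF assms(2) e(1,2)] e(3) cmp_ident[OF assms(2)] by simp
  also have "\<dots> = g'" unfolding assms(4) using cmp_assoc[OF assms(3) e(1,2)] e(3) cmp_ident[OF assms(3)] by simp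
  finally show ?thesis .
qed

text \<open>Skeletality by traces: \<open>g s * f s\<close> and \<open>f s * g s\<close> have the
  same trace, and both are identity matrices.\<close>

lemma iso_obj_eq:
  assumes "iso_arrow C X Y f"
  shows "X = Y"
proof
  fix s
  obtain g where "inverse_arrows C X Y f g" using assms by (auto simp: iso_arrow_def)
  then have c: "f s \<in> carrier_mat (Y s) (X s)" "g s \<in> carrier_mat (X s) (Y s)"
    and e: "g s * f s = 1\<^sub>m (X s)" "f s * g s = 1\<^sub>m (Y s)"
    by (auto simp: inverse_arrows_def C_simps fun_eq_iff)
  have "real (X s) = (\<Sum>i<X s. (g s * f s) $$ (i, i))" unfolding e by simp
  also have "\<dots> = (\<Sum>i<X s. \<Sum>j<Y s. g s $$ (i, j) * f s $$ (j, i))"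
    using c by (intro sum.cong) (auto simp: scalar_prod_def atLeast0LessThan)
  also have "\<dots> = (\<Sum>j<Y s. \<Sum>i<X s. f s $$ (j, i) * g s $$ (i, j))"
    by (subst sum.swap) (simp add: mult.commute)
  also have "\<dots> = (\<Sum>j<Y s. (f s * g s) $$ (j, j))"
    using c by (intro sum.cong) (auto simp: scalar_prod_def atLeast0LessThan)
  also have "\<dots> = real (Y s)" unfolding e by simp
  finally show "X s = Y s" by simp
qed

text \<open>Besides being fully faithful, \<open>F\<close> is injective on objects: \<open>X\<close>
  is isomorphic to its image under \<open>F\<close> followed by the quasi-inverse, and isomorphic
  objects are equal.\<close>

lemma equivalence_facts:
  assumes "equivalence_functor C C F M"
  shows "\<And>X Y f f'. \<lbrakk>X \<in> obj C; Y \<in> obj C; f \<in> arr C X Y; f' \<in> arr C X Y; M f = M f'\<rbrakk> \<Longrightarrow> f = f'"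
    and "\<And>X Y k. \<lbrakk>X \<in> obj C; Y \<in> obj C; k \<in> arr C (F X) (F Y)\<rbrakk> \<Longrightarrow> \<exists>f\<in>arr C X Y. M f = k"
    and "\<And>X Y. \<lbrakk>X \<in> obj C; Y \<in> obj C; F X = F Y\<rbrakk> \<Longrightarrow> X = Y"
proof -
  obtain H L \<eta> \<theta> where F: "functor_on C C F M" and H: "functor_on C C H L"
    and \<eta>: "\<And>X. X \<in> obj C \<Longrightarrow> iso_arrow C X (H (F X)) (\<eta> X)"
    and \<eta>_nat: "\<And>X X' f. X \<in> obj C \<Longrightarrow> X' \<in> obj C \<Longrightarrow> f \<in> arr C X X' \<Longrightarrow> \<eta> X' \<cdot>\<^bsub>C\<^esub> f = L (M f) \<cdot>\<^bsub>C\<^esub> \<eta> X"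
    and \<theta>: "\<And>Y. Y \<in> obj C \<Longrightarrow> iso_arrow C (F (H Y)) Y (\<theta> Y)"
    and \<theta>_nat: "\<And>Y Y' g. Y \<in> obj C \<Longrightarrow> Y' \<in> obj C \<Longrightarrow> g \<in> arr C Y Y' \<Longrightarrow> \<theta> Y' \<cdot>\<^bsub>C\<^esub> M (L g) = g \<cdot>\<^bsub>C\<^esub> \<theta> Y"
    using assms unfolding equivalence_functor_def by blast
  have Fo: "F X \<in> obj C" "H X \<in> obj C" if "X \<in> obj C" for X using F H that by (auto simp: functor_on_def)
  have Fm: "M f \<in> arr C (F X) (F Y)" "L f \<in> arr C (H X) (H Y)" if "X \<in> obj C" "Y \<in> obj C" "f \<in> arr C X Y" for X Y f
    using F H that by (auto simp: functor_on_def)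
  \<comment> \<open>Fullness of \<open>M\<close> is derived from faithfulness of the quasi-inverse:
    the preimage of \<open>k\<close> is built so that \<open>L (M f) = L k\<close>.\<close>
  have L_inj: "g = g'" if "X \<in> obj C" "Y \<in> obj C" "g \<in> arr C X Y" "g' \<in> arr C X Y" "L g = L g'" for X Y g g'
    using iso_cancel_right[OF \<theta>[OF that(1)] that(3,4)] \<theta>_nat[OF that(1,2)] that by metis
  show "f = f'" if "X \<in> obj C" "Y \<in> obj C" "f \<in> arr C X Y" "f' \<in> arr C X Y" "M f = M f'" for X Y f f'
    using iso_cancel_left[OF \<eta>[OF that(2)] that(3,4)] \<eta>_nat[OF that(1,2)] that by metis
  show "\<exists>f\<in>arr C X Y. M f = k" if XY: "X \<in> obj C" "Y \<in> obj C" "k \<in> arr C (F X) (F Y)" for X Y k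
  proof -
    obtain e' where e': "inverse_arrows C Y (H (F Y)) (\<eta> Y) e'" using \<eta>[OF XY(2)] by (auto simp: iso_arrow_def)
    note e = inverse_arrowsD[OF e']
    have \<eta>X: "\<eta> X \<in> arr C X (H (F X))" using \<eta>[OF XY(1)] by (auto simp: iso_arrow_def inverse_arrows_def)
    have Lk: "L k \<in> arr C (H (F X)) (H (F Y))" using Fm(2) Fo XY by blast
    define f where "f = e' \<cdot>\<^bsub>C\<^esub> (L k \<cdot>\<^bsub>C\<^esub> \<eta> X)"
    have Lke: "L k \<cdot>\<^bsub>C\<^esub> \<eta> X \<in> arr C X (H (F Y))" using cmp_arr[OF \<eta>X Lk] .
    have f: "f \<in> arr C X Y" unfolding f_def using cmp_arr[OF Lke e(2)] .
    have "\<eta> Y \<cdot>\<^bsub>C\<^esub> f = L k \<cdot>\<^bsub>C\<^esub> \<eta> X"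
      unfolding f_def using cmp_assoc[OF Lke e(2,1)] e(4) cmp_ident[OF Lke] by simp
    then have "L (M f) \<cdot>\<^bsub>C\<^esub> \<eta> X = L k \<cdot>\<^bsub>C\<^esub> \<eta> X" using \<eta>_nat[OF XY(1,2) f] by simp
    then have "L (M f) = L k"
      by (rule iso_cancel_right[OF \<eta>[OF XY(1)] Fm(2)[OF Fo(1)[OF XY(1)] Fo(1)[OF XY(2)] Fm(1)[OF XY(1,2) f]] Lk])
    then have "M f = k"
      by (rule L_inj[OF Fo(1)[OF XY(1)] Fo(1)[OF XY(2)] Fm(1)[OF XY(1,2) f] XY(3)])
    then show ?thesis using f by blast
  qed
  show "X = Y" if "X \<in> obj C" "Y \<in> obj C" "F X = F Y" for X Y
    using iso_obj_eq[OF \<eta>[OF that(1)]] iso_obj_eq[OF \<eta>[OF that(2)]] that by metis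
qed

lemma unit_simple_obj: "unit_obj C = simple_obj (Inv \<one>)"
  by (simp add: C_simps simple_obj_def fun_eq_iff)

lemma simple_obj_eq_iff: "simple_obj x = simple_obj y \<longleftrightarrow> x = y"
  by (auto simp: simple_obj_def fun_eq_iff split: if_splits)

lemma simple_endo:
  assumes "f \<in> arr C (simple_obj x) (simple_obj x)"
  shows "\<exists>r. f = scale_arr C r (ident C (simple_obj x))"
proof (intro exI ext)
  fix s
  have "f s \<in> carrier_mat (simple_obj x s) (simple_obj x s)" for s using assms by (simp add: C_simps)
  then have "dim_row (f s) = simple_obj x s" "dim_col (f s) = simple_obj x s" for s by auto
  then show "f s = scale_arr C (f x $$ (0, 0)) (ident C (simple_obj x)) s"
    by (intro eq_matI) (auto simp: C_simps simple_obj_def split: if_splits)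
qed

text \<open>Simple objects are those whose endomorphisms are the scalars and whose identity is not
  zero. A linear fully faithful functor preserves both properties.\<close>

lemma image_simple:
  assumes lin: "linear_functor C C F M" and eqv: "equivalence_functor C C F M" and x: "x \<in> set (simples G)"
  shows "\<exists>y\<in>set (simples G). F (simple_obj x) = simple_obj y"
proof -
  note x' = simple_obj_obj[OF x]
  define N where "N = F (simple_obj x)"
  have F: "functor_on C C F M" using lin by (simp add: linear_functor_def)
  have scale: "M (scale_arr C r f) = scale_arr C r (M f)" if "f \<in> arr C (simple_obj x) (simple_obj x)" for r f
    using lin x' that by (auto simp: linear_functor_def)
  have N: "N \<in> obj C" using F x' by (auto simp: functor_on_def N_def)
  have Mid: "M (ident C (simple_obj x)) = ident C N" using F x' by (auto simp: functor_on_def N_def)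
  have endo: "\<exists>r. k = scale_arr C r (ident C N)" if "k \<in> arr C N N" for k
  proof -
    obtain f where f: "f \<in> arr C (simple_obj x) (simple_obj x)" "M f = k"
      using equivalence_facts(2)[OF eqv x' x'] \<open>k \<in> arr C N N\<close> unfolding N_def by blast
    obtain r where "f = scale_arr C r (ident C (simple_obj x))" using simple_endo[OF f(1)] by blast
    then show ?thesis using f scale[OF ident_arr, of r] Mid by auto
  qed
  have "\<exists>s. N s \<noteq> 0"
  proof (rule ccontr)
    assume "\<not> (\<exists>s. N s \<noteq> 0)"
    then have "scale_arr C 0 (ident C N) = ident C N" by (auto simp: C_simps fun_eq_iff intro!: eq_matI)
    then have "M (scale_arr C 0 (ident C (simple_obj x))) = M (ident C (simple_obj x))"
      using scale[OF ident_arr] Mid by simp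
    then have "scale_arr C 0 (ident C (simple_obj x)) = ident C (simple_obj x)"
      by (rule equivalence_facts(1)[OF eqv x' x', rotated 2]) (auto simp: C_simps)
    then have "(0 \<cdot>\<^sub>m 1\<^sub>m 1 :: real mat) $$ (0, 0) = 1\<^sub>m 1 $$ (0, 0)"
      by (simp only: C_simps fun_eq_iff simple_obj_def) (metis (full_types))
    then show False by simp
  qed
  then obtain s where s: "N s \<noteq> 0" by blast
  \<comment> \<open>A matrix unit at the first copy of \<open>s\<close>. Being a scalar, it excludes
    a second copy of \<open>s\<close> and any copy of another simple object.\<close>
  define k where "k = (\<lambda>t. mat (N t) (N t) (\<lambda>(i, j). if t = s \<and> i = 0 \<and> j = 0 then 1 else 0 :: real))"
  obtain r where "k = scale_arr C r (ident C N)" using endo[of k] by (auto simp: C_simps k_def)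
  then have kr: "k t $$ (i, i) = r" if "i < N t" for t i using that by (simp add: C_simps)
  have r: "r = 1" using kr[of 0 s] s by (simp add: k_def)
  have "N t = (if t = s then 1 else 0)" for t
  proof (cases "t = s")
    case True
    then show ?thesis using kr[of 1 s] r s by (cases "N s > 1") (auto simp: k_def)
  next
    case False
    then show ?thesis using kr[of 0 t] r by (cases "N t > 0") (auto simp: k_def)
  qed
  then have "N = simple_obj s" by (simp add: fun_eq_iff simple_obj_def)
  moreover have "s \<in> set (simples G)" using s N by (auto simp: C_simps)
  ultimately show ?thesis unfolding N_def by blast
qed

lemma image_unit:
  assumes "monoidal_functor C C F M J \<phi>"
  shows "F (unit_obj C) = unit_obj C"
  using assms iso_obj_eq[of "unit_obj C" "F (unit_obj C)" \<phi>] by (auto simp: monoidal_functor_def)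

text \<open>Were the image of m an invertible object a, the image of m m would be a a, the unit, so
  m m would be the unit itself by injectivity on objects.\<close>

lemma image_Mid:
  assumes lin: "linear_functor C C F M" and eqv: "equivalence_functor C C F M"
    and mon: "monoidal_functor C C F M J \<phi>"
  shows "F (simple_obj Mid) = simple_obj Mid"
proof -
  have S: "Mid \<in> set (simples G)" "Inv \<one> \<in> set (simples G)" by (auto simp: set_simples)
  note M0 = simple_obj_obj[OF S(1)]
  have U: "unit_obj C \<in> obj C" using simple_obj_obj[OF S(2)] unit_simple_obj by simp
  obtain y where y: "y \<in> set (simples G)" "F (simple_obj Mid) = simple_obj y" using image_simple[OF lin eqv S(1)] by blast
  show ?thesis
  proof (cases y)
    case Mid
    then show ?thesis using y by simp
  next
    case (Inv a)
    then have a: "a \<in> carrier G" using y by (auto simp: set_simples)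
    have "ty_tens G (simple_obj (Inv a)) (simple_obj (Inv a)) = unit_obj C"
      using ty_tens_simple_obj[of "Inv a" "Inv a"] y(1) Inv a by (auto simp: fun_eq_iff sq_one C_simps)
    moreover have "iso_arrow C (F (simple_obj Mid) \<boxtimes>\<^bsub>C\<^esub> F (simple_obj Mid)) (F (simple_obj Mid \<boxtimes>\<^bsub>C\<^esub> simple_obj Mid)) (J (simple_obj Mid) (simple_obj Mid))"
      using mon M0 unfolding monoidal_functor_def by blast
    then have "ty_tens G (simple_obj y) (simple_obj y) = F (ty_tens G (simple_obj Mid) (simple_obj Mid))"
      using iso_obj_eq y(2) by (simp add: C_simps)
    ultimately have "F (ty_tens G (simple_obj Mid) (simple_obj Mid)) = F (unit_obj C)"
      using image_unit[OF mon] Inv by simp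
    then have tens: "ty_tens G (simple_obj Mid) (simple_obj Mid) = unit_obj C"
      using equivalence_facts(3)[OF eqv tens_obj[OF M0 M0] U] by blast
    have "unit_obj C (Inv a) = 1"
      unfolding tens[symmetric] ty_tens_simple_obj[OF S(1) S(1)] using a by simp
    \<comment> \<open>For the trivial group m m really is the unit, so there is no contradiction
      yet. It arises because m and the unit now have the same image.\<close>
    then have "a = \<one>" unfolding C_simps(9) by (metis simple.inject zero_neq_one)
    then have "F (simple_obj Mid) = F (unit_obj C)" using y(2) Inv unit_simple_obj image_unit[OF mon] by simp
    then have "simple_obj Mid = unit_obj C" using equivalence_facts(3)[OF eqv M0 U] by blast
    then show ?thesis by (simp add: unit_simple_obj simple_obj_eq_iff)
  qed
qed

text \<open>On the unit summand of m m the braiding is \<open>\<epsilon> * \<sigma> \<one>\<close>,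
  and the other components of an arrow out of the unit have no columns.\<close>

lemma gbraid_Mid_Mid:
  assumes \<sigma>: "\<sigma> \<one> = 1" and g: "g \<in> arr C (unit_obj C) (ty_tens G (simple_obj Mid) (simple_obj Mid))"
  shows "gbraid G (cf \<sigma> \<epsilon>) (simple_obj Mid) (simple_obj Mid) \<cdot>\<^bsub>C\<^esub> g = scale_arr C \<epsilon> g"
proof
  fix s
  have S: "Mid \<in> set (simples G)" by (auto simp: set_simples)
  have c: "g s \<in> carrier_mat (ty_tens G (simple_obj Mid) (simple_obj Mid) s) (unit_obj C s)"
    using g by (simp add: C_simps)
  show "(gbraid G (cf \<sigma> \<epsilon>) (simple_obj Mid) (simple_obj Mid) \<cdot>\<^bsub>C\<^esub> g) s = scale_arr C \<epsilon> g s"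
  proof (cases "s = Inv \<one>")
    case True
    have "gbraid G (cf \<sigma> \<epsilon>) (simple_obj Mid) (simple_obj Mid) s = mat 1 1 (\<lambda>_. \<epsilon>)"
      using \<sigma> unfolding gbraid_alt ty_tens_simple_obj[OF S S] ty_copies_simple_obj[OF S S]
      by (intro eq_matI) (auto simp: True)
    moreover have "g s \<in> carrier_mat 1 1" using c True by (simp add: ty_tens_simple_obj[OF S S] C_simps)
    ultimately show ?thesis by (auto simp: C_simps scalar_prod_def intro!: eq_matI)
  next
    case False
    then have "unit_obj C s = 0" by (simp add: C_simps)
    then show ?thesis using c by (auto simp: C_simps gbraid_alt intro!: eq_matI)
  qed
qed

lemma braided_equivalent_imp_eq:
  assumes equiv: "braided_equivalent C \<beta> C \<gamma>"
    and \<beta>: "\<And>N M. N \<in> obj C \<Longrightarrow> M \<in> obj C \<Longrightarrow> \<beta> N M = gbraid G (cf \<sigma> \<epsilon>) N M"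
    and \<gamma>: "\<And>N M. N \<in> obj C \<Longrightarrow> M \<in> obj C \<Longrightarrow> \<gamma> N M = gbraid G (cf \<sigma>' \<epsilon>') N M"
    and one: "\<sigma> \<one> = 1" "\<sigma>' \<one> = 1"
  shows "\<epsilon> = \<epsilon>'"
proof -
  obtain F M J \<phi> where lin: "linear_functor C C F M" and eqv: "equivalence_functor C C F M"
    and mon: "monoidal_functor C C F M J \<phi>"
    and br: "\<And>X Y. X \<in> obj C \<Longrightarrow> Y \<in> obj C \<Longrightarrow> M (\<beta> X Y) \<cdot>\<^bsub>C\<^esub> J X Y = J Y X \<cdot>\<^bsub>C\<^esub> \<gamma> (F X) (F Y)"
    using equiv unfolding braided_equivalent_def by blast
  let ?m = "simple_obj Mid :: 'a ty_obj"
  let ?mm = "ty_tens G ?m ?m" and ?u = "unit_obj C"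
  have S: "Mid \<in> set (simples G)" "Inv \<one> \<in> set (simples G)" by (auto simp: set_simples)
  note m = simple_obj_obj[OF S(1)]
  note mm = tens_obj[OF m m]
  have U: "?u \<in> obj C" using simple_obj_obj[OF S(2)] unit_simple_obj by simp
  have Fm: "F ?m = ?m" by (rule image_Mid[OF lin eqv mon])
  have Fu: "F ?u = ?u" by (rule image_unit[OF mon])
  have F: "functor_on C C F M" using lin by (simp add: linear_functor_def)
  \<comment> \<open>The inclusion of the unit into m m: its component at \<open>Inv \<one>\<close>
    is the 1 by 1 matrix 1, and all others have no columns.\<close>
  define i where "i = (\<lambda>s. mat (?mm s) (?u s) (\<lambda>_. 1 :: real))"
  have i: "i \<in> arr C ?u ?mm" by (simp add: C_simps i_def)
  obtain J' where J': "inverse_arrows C (ty_tens G (F ?m) (F ?m)) (F ?mm) (J ?m ?m) J'"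
    using mon m unfolding monoidal_functor_def iso_arrow_def by (metis C_simps(7))
  note J = inverse_arrowsD[OF J'[unfolded Fm]]
  have Mi: "M i \<in> arr C ?u (F ?mm)" using F U mm i Fu unfolding functor_on_def by metis
  \<comment> \<open>The image of this inclusion, transported along the monoidal structure to an
    arrow from the unit to m m, so that the second braiding can act on it.\<close>
  define g where "g = J' \<cdot>\<^bsub>C\<^esub> M i"
  have g: "g \<in> arr C ?u ?mm" unfolding g_def by (rule cmp_arr[OF Mi J(2)])
  have Jg: "J ?m ?m \<cdot>\<^bsub>C\<^esub> g = M i"
    unfolding g_def using cmp_assoc[OF Mi J(2,1)] J(4) cmp_ident[OF Mi] by simp
  have b: "gbraid G c ?m ?m \<in> arr C ?mm ?mm" for c by (simp add: C_simps gbraid_carrier)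
  have scale: "k \<cdot>\<^bsub>C\<^esub> scale_arr C r f = scale_arr C r (k \<cdot>\<^bsub>C\<^esub> f)" if "f \<in> arr C X Y" "k \<in> arr C Y Z" for k f r X Y Z
  proof -
    have "k s * (r \<cdot>\<^sub>m f s) = r \<cdot>\<^sub>m (k s * f s)" for s
      by (rule mult_smult_distrib[of _ "Z s" "Y s" _ "X s"]) (use that in \<open>auto simp: C_simps\<close>)
    then show ?thesis by (simp add: C_simps)
  qed
  have "J ?m ?m \<cdot>\<^bsub>C\<^esub> scale_arr C \<epsilon>' g = J ?m ?m \<cdot>\<^bsub>C\<^esub> (gbraid G (cf \<sigma>' \<epsilon>') ?m ?m \<cdot>\<^bsub>C\<^esub> g)"
    by (simp only: gbraid_Mid_Mid[of \<sigma>', OF one(2) g])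
  also have "\<dots> = M (\<beta> ?m ?m) \<cdot>\<^bsub>C\<^esub> J ?m ?m \<cdot>\<^bsub>C\<^esub> g"
    using br[OF m m] Fm \<gamma>[OF m m] cmp_assoc[OF g b J(1)] by simp
  also have "\<dots> = M (\<beta> ?m ?m) \<cdot>\<^bsub>C\<^esub> M i"
    using cmp_assoc[OF g J(1), of "M (\<beta> ?m ?m)" "F ?mm"] F mm b \<beta>[OF m m] Jg unfolding functor_on_def by metis
  also have "\<dots> = M (\<beta> ?m ?m \<cdot>\<^bsub>C\<^esub> i)"
    using F U mm i b \<beta>[OF m m] unfolding functor_on_def by metis
  also have "\<dots> = M (scale_arr C \<epsilon> i)" using \<beta>[OF m m] gbraid_Mid_Mid[of \<sigma>, OF one(1) i] by simp
  also have "\<dots> = scale_arr C \<epsilon> (M i)" using lin U mm i unfolding linear_functor_def by blast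
  finally have "scale_arr C \<epsilon>' (M i) = scale_arr C \<epsilon> (M i)"
    using scale[OF g J(1)] Jg by simp
  then have "M (scale_arr C \<epsilon>' i) = M (scale_arr C \<epsilon> i)"
    using lin U mm i unfolding linear_functor_def by metis
  then have "scale_arr C \<epsilon>' i = scale_arr C \<epsilon> i"
    by (rule equivalence_facts(1)[OF eqv U mm, rotated 2]) (use i in \<open>auto simp: C_simps\<close>)
  then have "(scale_arr C \<epsilon>' i) (Inv \<one>) $$ (0, 0) = (scale_arr C \<epsilon> i) (Inv \<one>) $$ (0, 0)" by simp
  then show ?thesis
    by (simp add: C_simps i_def ty_tens_simple_obj[OF S(1) S(1)])
qed

end

section \<open>Classification\<close>

text \<open>Braidings that agree on objects may differ as functions elsewhere, and the functor sends
  objects to objects, so such differences are invisible.\<close>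

lemma braided_equivalent_cong:
  assumes "\<And>X Y. X \<in> obj C \<Longrightarrow> Y \<in> obj C \<Longrightarrow> \<beta> X Y = \<beta>' X Y"
    and "\<And>X Y. X \<in> obj D \<Longrightarrow> Y \<in> obj D \<Longrightarrow> \<gamma> X Y = \<gamma>' X Y"
  shows "braided_equivalent C \<beta> D \<gamma> \<longleftrightarrow> braided_equivalent C \<beta>' D \<gamma>'"
proof -
  have "(\<forall>X\<in>obj C. \<forall>Y\<in>obj C. FM (\<beta> X Y) \<cdot>\<^bsub>D\<^esub> J X Y = J Y X \<cdot>\<^bsub>D\<^esub> \<gamma> (FO X) (FO Y)) \<longleftrightarrow>
      (\<forall>X\<in>obj C. \<forall>Y\<in>obj C. FM (\<beta>' X Y) \<cdot>\<^bsub>D\<^esub> J X Y = J Y X \<cdot>\<^bsub>D\<^esub> \<gamma>' (FO X) (FO Y))"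
    if "linear_functor C D FO FM" for FO FM J
  proof -
    have "FO X \<in> obj D" if "X \<in> obj C" for X
      using \<open>linear_functor C D FO FM\<close> that by (auto simp: linear_functor_def functor_on_def)
    then show ?thesis using assms by simp
  qed
  then show ?thesis unfolding braided_equivalent_def by blast
qed

context real_ty
begin

definition forms :: "('a \<Rightarrow> real) set" where
  "forms = {\<sigma> \<in> QF G \<chi>. sgn (gauss_sum G \<sigma>) = sgn \<tau>}"

lemma QF_one: "\<sigma> \<in> QF G \<chi> \<Longrightarrow> \<sigma> \<one> = 1"
proof -
  assume "\<sigma> \<in> QF G \<chi>"
  then have "\<sigma> (\<one> \<otimes> \<one>) = \<sigma> \<one> * \<sigma> \<one> * \<chi> \<one> \<one>" "\<sigma> \<one> = 1 \<or> \<sigma> \<one> = - 1"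
    unfolding QF_iff by blast+
  then show "\<sigma> \<one> = 1" by (auto simp: \<chi>_one)
qed

text \<open>Twisting by \<open>\<chi> v\<close> with \<open>\<sigma> v = - 1\<close> negates the
  Gauss sum, so the form or its twist has the sign of \<tau>.\<close>

lemma ex_form:
  assumes \<sigma>: "\<sigma> \<in> QF G \<chi>" and v: "v \<in> carrier G" "\<sigma> v = - 1"
  shows "\<exists>\<sigma>'. \<sigma>' \<in> forms"
proof -
  define \<sigma>' where "\<sigma>' = restrict (\<lambda>x. \<sigma> x * \<chi> v x) (carrier G)"
  have \<sigma>': "\<sigma>' \<in> QF G \<chi>"
    unfolding QF_iff
  proof (intro conjI ballI)
    show "\<sigma>' x = 1 \<or> \<sigma>' x = - 1" if "x \<in> carrier G" for x
      using \<sigma> that \<chi>_unit[OF v(1) that] by (auto simp: \<sigma>'_def QF_iff)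
    show "\<sigma>' (x \<otimes> y) = \<sigma>' x * \<sigma>' y * \<chi> x y" if "x \<in> carrier G" "y \<in> carrier G" for x y
      using \<sigma> that v(1) by (simp add: \<sigma>'_def QF_iff \<chi>_mult' mult_ac)
  qed (simp add: \<sigma>'_def)
  have "gauss_sum G \<sigma>' = - gauss_sum G \<sigma>"
    using gauss_sum_shift[OF \<sigma> v(1)] v(2) by (simp add: gauss_sum_def \<sigma>'_def)
  moreover have "(\<tau> * gauss_sum G \<sigma>) * (\<tau> * gauss_sum G \<sigma>) = 1"
    using \<tau>_sq gauss_sum_sq[OF \<sigma>] by (metis mult.assoc mult.left_commute)
  then have "\<tau> * gauss_sum G \<sigma> = 1 \<or> \<tau> * gauss_sum G \<sigma> = - 1"
    by (simp add: square_eq_1_iff)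
  ultimately have "\<tau> * gauss_sum G \<sigma> = 1 \<or> \<tau> * gauss_sum G \<sigma>' = 1" by auto
  then show ?thesis using \<sigma> \<sigma>' \<tau>_gauss_sum(1) unfolding forms_def by blast
qed

abbreviation "br \<equiv> ty_braid G \<chi>"

lemma br_braiding:
  assumes "\<sigma> \<in> forms" "\<epsilon> \<in> {1, - 1}"
  shows "br \<sigma> \<epsilon> \<in> braidings C"
proof -
  have \<sigma>: "\<sigma> \<in> QF G \<chi>" "sgn (gauss_sum G \<sigma>) = sgn \<tau>" using assms by (auto simp: forms_def)
  have u: "\<sigma> x \<noteq> 0" if "x \<in> carrier G" for x using \<sigma> that by (force simp: QF_iff)
  have c: "\<chi> x y \<noteq> 0" if "x \<in> carrier G" "y \<in> carrier G" for x y using \<chi>_unit[OF that] by auto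
  have "cf \<sigma> \<epsilon> x y s \<noteq> 0" if "x \<in> set (simples G)" "y \<in> set (simples G)" "s \<in> fusion G x y" for x y s
    by (cases x; cases y) (use that u c assms(2) in \<open>auto simp: set_simples\<close>)
  then show ?thesis
    using quadratic_form_hexagons[OF \<sigma> assms(2)] braiding_gbraid_iff[of "br \<sigma> \<epsilon>" "cf \<sigma> \<epsilon>"]
    by (simp add: braidings_def ty_braid_eq_gbraid)
qed

lemma braiding_cases:
  assumes "\<beta> \<in> braidings C"
  obtains \<sigma> \<epsilon> where "\<sigma> \<in> forms" "\<epsilon> \<in> {1, - 1}" "\<And>N M. N \<in> obj C \<Longrightarrow> M \<in> obj C \<Longrightarrow> \<beta> N M = br \<sigma> \<epsilon> N M"
proof -
  have b: "braiding C \<beta>" using assms by (simp add: braidings_def)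
  then obtain c where c: "\<And>N M. N \<in> obj C \<Longrightarrow> M \<in> obj C \<Longrightarrow> \<beta> N M = gbraid G c N M"
    using braiding_is_gbraid by blast
  have h: "(\<forall>x\<in>set (simples G). \<forall>y\<in>set (simples G). \<forall>s\<in>fusion G x y. c x y s \<noteq> 0) \<and>
    (\<forall>x\<in>set (simples G). \<forall>y\<in>set (simples G). \<forall>z\<in>set (simples G). \<forall>t. hex1 c x y z t \<and> hex2 c x y z t)"
    using b braiding_gbraid_iff[of \<beta> c, OF c] by blast
  obtain \<sigma> \<epsilon> where "\<sigma> \<in> QF G \<chi>" "\<epsilon> \<in> {1, - 1}" "sgn (gauss_sum G \<sigma>) = sgn \<tau>" "gbraid G c = gbraid G (cf \<sigma> \<epsilon>)"
    using hexagons_imp_quadratic_form[of c] h by blast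
  then show ?thesis using that[of \<sigma> \<epsilon>] c by (simp add: forms_def ty_braid_eq_gbraid)
qed

lemma braided_equivalent_iff:
  assumes "\<sigma> \<in> forms" "\<sigma>' \<in> forms"
    and "\<And>N M. N \<in> obj C \<Longrightarrow> M \<in> obj C \<Longrightarrow> \<beta> N M = br \<sigma> \<epsilon> N M"
    and "\<And>N M. N \<in> obj C \<Longrightarrow> M \<in> obj C \<Longrightarrow> \<gamma> N M = br \<sigma>' \<epsilon>' N M"
  shows "braided_equivalent C \<beta> C \<gamma> \<longleftrightarrow> \<epsilon> = \<epsilon>'"
proof
  assume "braided_equivalent C \<beta> C \<gamma>"
  then show "\<epsilon> = \<epsilon>'"
    by (rule braided_equivalent_imp_eq[where \<sigma> = \<sigma> and \<sigma>' = \<sigma>']) (use assms QF_one in \<open>auto simp: forms_def ty_braid_eq_gbraid\<close>)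
next
  assume "\<epsilon> = \<epsilon>'"
  then have "braided_equivalent C (br \<sigma> \<epsilon>) C (br \<sigma>' \<epsilon>')"
    using same_sign_braided_equivalent[of \<sigma> \<sigma>' \<epsilon>] assms(1,2) by (simp add: forms_def ty_braid_eq_gbraid)
  then show "braided_equivalent C \<beta> C \<gamma>"
    using braided_equivalent_cong[of C \<beta> "br \<sigma> \<epsilon>" C \<gamma> "br \<sigma>' \<epsilon>'"] assms(3,4) by blast
qed

text \<open>By \<open>braided_equivalent_iff\<close> the set of braidings related to a given one
  depends only on its \<epsilon>, so the two braidings on one fixed form represent all
  classes.\<close>

lemma card_braidings:
  assumes \<sigma>: "\<sigma> \<in> forms"
  shows "card (braidings C // braided_equiv_rel C) = 2"
proof -
  let ?r = "braided_equiv_rel C"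
  let ?cl = "\<lambda>\<epsilon>. ?r `` {br \<sigma> \<epsilon>}"
  have cl: "?r `` {\<beta>} = ?cl \<epsilon>"
    if \<beta>: "\<beta> \<in> braidings C" "\<sigma>1 \<in> forms" "\<epsilon> \<in> {1, - 1}" "\<And>N M. N \<in> obj C \<Longrightarrow> M \<in> obj C \<Longrightarrow> \<beta> N M = br \<sigma>1 \<epsilon> N M"
    for \<beta> \<sigma>1 \<epsilon>
  proof -
    have "braided_equivalent C \<beta> C \<gamma> \<longleftrightarrow> braided_equivalent C (br \<sigma> \<epsilon>) C \<gamma>" if \<gamma>: "\<gamma> \<in> braidings C" for \<gamma>
    proof -
      obtain \<sigma>2 \<delta> where g: "\<sigma>2 \<in> forms" "\<delta> \<in> {1, - 1}" "\<And>N M. N \<in> obj C \<Longrightarrow> M \<in> obj C \<Longrightarrow> \<gamma> N M = br \<sigma>2 \<delta> N M"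
        using braiding_cases[OF \<gamma>] by metis
      show ?thesis
        using braided_equivalent_iff[of \<sigma>1 \<sigma>2 \<beta> \<epsilon> \<gamma> \<delta>] braided_equivalent_iff[of \<sigma> \<sigma>2 "br \<sigma> \<epsilon>" \<epsilon> \<gamma> \<delta>] \<beta> g \<sigma> by simp
    qed
    then show ?thesis
      using \<beta>(1) br_braiding[OF \<sigma> \<beta>(3)] by (auto simp: braided_equiv_rel_def)
  qed
  have "braidings C // ?r = {?cl 1, ?cl (- 1)}"
  proof
    show "braidings C // ?r \<subseteq> {?cl 1, ?cl (- 1)}"
    proof
      fix K assume "K \<in> braidings C // ?r"
      then obtain \<beta> where \<beta>: "\<beta> \<in> braidings C" "K = ?r `` {\<beta>}" by (auto elim: quotientE)
      obtain \<sigma>1 \<epsilon> where s: "\<sigma>1 \<in> forms" "\<epsilon> \<in> {1, - 1}" "\<And>N M. N \<in> obj C \<Longrightarrow> M \<in> obj C \<Longrightarrow> \<beta> N M = br \<sigma>1 \<epsilon> N M"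
        using braiding_cases[OF \<beta>(1)] by metis
      show "K \<in> {?cl 1, ?cl (- 1)}" using cl[OF \<beta>(1) s] \<beta>(2) s(2) by auto
    qed
    show "{?cl 1, ?cl (- 1)} \<subseteq> braidings C // ?r"
      using br_braiding[OF \<sigma>] by (auto intro: quotientI)
  qed
  \<comment> \<open>The braiding with sign 1 is equivalent to itself and not to the one with sign
    -1, which separates the classes.\<close>
  moreover have "br \<sigma> 1 \<in> ?cl 1" "br \<sigma> 1 \<notin> ?cl (- 1)"
    using braided_equivalent_iff[OF \<sigma> \<sigma>, of "br \<sigma> 1" 1 "br \<sigma> 1" 1] br_braiding[OF \<sigma>]
      braided_equivalent_iff[OF \<sigma> \<sigma>, of "br \<sigma> (- 1)" "- 1" "br \<sigma> 1" 1]
    by (simp_all add: braided_equiv_rel_def)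
  then have "?cl 1 \<noteq> ?cl (- 1)" by metis
  ultimately show ?thesis by simp
qed

end

section \<open>The group $K_4^n$\<close>

lemma carrier_K4: "carrier K4 = {(0, 0), (0, 1), (1, 0), (1, 1)}"
proof -
  have "{0..<2 :: int} = {0, 1}" by auto
  then show ?thesis by (auto simp: K4_def carrier_integer_mod_group)
qed

lemma K4_group: "group K4"
  unfolding K4_def by (intro DirProd_group group_integer_mod_group)

lemma K4_one: "\<one>\<^bsub>K4\<^esub> = (0, 0)"
  by (simp add: K4_def)

lemma K4_mult: "x \<otimes>\<^bsub>K4\<^esub> y = ((fst x + fst y) mod 2, (snd x + snd y) mod 2)"
  by (simp add: K4_def mult_DirProd')

lemma h_K4:
  assumes "x \<in> carrier K4" "y \<in> carrier K4"
  shows "h x y = 1 \<or> h x y = - 1" "h x y = h y x" "h x x = 1"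
    "z \<in> carrier K4 \<Longrightarrow> h (x \<otimes>\<^bsub>K4\<^esub> y) z = h x z * h y z"
  using assms by (auto simp: carrier_K4 h_def K4_mult)

lemma h_K4_zero: "h x (0, 0) = 1"
  by (auto simp: h_def split: prod.splits)

lemma h_K4_nondeg: "x \<in> carrier K4 \<Longrightarrow> x \<noteq> (0, 0) \<Longrightarrow> \<exists>y\<in>carrier K4. h x y = - 1"
  by (auto simp: carrier_K4 h_def)

lemma K4_pow_simps:
  "carrier (K4_pow n) = ({..<n} \<rightarrow>\<^sub>E carrier K4)"
  "x \<otimes>\<^bsub>K4_pow n\<^esub> y = (\<lambda>i\<in>{..<n}. x i \<otimes>\<^bsub>K4\<^esub> y i)"
  "\<one>\<^bsub>K4_pow n\<^esub> = (\<lambda>i\<in>{..<n}. (0, 0))"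
  by (simp_all add: K4_pow_def K4_one)

lemma K4_pow_real_ty:
  assumes "\<tau> = 1 / 2 ^ n \<or> \<tau> = - (1 / 2 ^ n)"
  shows "real_ty (K4_pow n) (h_pow n) \<tau>"
proof -
  have g: "group (K4_pow n)" unfolding K4_pow_def by (intro product_group K4_group)
  have m: "x i \<in> carrier K4" if "x \<in> carrier (K4_pow n)" "i < n" for x i
    using that by (auto simp: K4_pow_simps)
  interpret group "K4_pow n" by (rule g)
  have "comm_group (K4_pow n)"
  proof (rule group_comm_groupI)
    fix x y assume "x \<in> carrier (K4_pow n)" "y \<in> carrier (K4_pow n)"
    then show "x \<otimes>\<^bsub>K4_pow n\<^esub> y = y \<otimes>\<^bsub>K4_pow n\<^esub> x"
      by (simp add: K4_pow_simps K4_mult add.commute)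
  qed
  moreover have "finite (carrier (K4_pow n))"
    unfolding K4_pow_simps by (intro finite_PiE) (auto simp: carrier_K4)
  ultimately have "ty_group (K4_pow n)" by (simp add: ty_group_def ty_group_axioms_def)
  moreover have "real_ty_axioms (K4_pow n) (h_pow n) \<tau>"
  proof
    fix x y assume x: "x \<in> carrier (K4_pow n)" and y: "y \<in> carrier (K4_pow n)"
    have "(\<Prod>i\<in>I. h (x i) (y i)) = 1 \<or> (\<Prod>i\<in>I. h (x i) (y i)) = - 1" if "I \<subseteq> {..<n}" "finite I" for I
      using that(2,1)
    proof (induction I)
      case (insert j I)
      then show ?case using h_K4(1)[OF m[OF x] m[OF y], of j j] by auto
    qed simp
    then show "h_pow n x y = 1 \<or> h_pow n x y = - 1" by (simp add: h_pow_def)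
    show "h_pow n x y = h_pow n y x"
      unfolding h_pow_def by (intro prod.cong refl h_K4(2)) (use m x y in auto)
    show "h_pow n x x = 1"
      unfolding h_pow_def by (intro prod.neutral ballI h_K4(3)) (use m x in auto)
    show "h_pow n (x \<otimes>\<^bsub>K4_pow n\<^esub> y) z = h_pow n x z * h_pow n y z" if "z \<in> carrier (K4_pow n)" for z
      unfolding h_pow_def prod.distrib[symmetric]
      by (intro prod.cong refl) (use m x y that h_K4(4) in \<open>auto simp: K4_pow_simps(2)\<close>)
  next
    fix x assume x: "x \<in> carrier (K4_pow n)" and H: "\<And>y. y \<in> carrier (K4_pow n) \<Longrightarrow> h_pow n x y = 1"
    have "x i = (0, 0)" if i: "i < n" for i
    proof (rule ccontr)
      assume "x i \<noteq> (0, 0)"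
      then obtain z where z: "z \<in> carrier K4" "h (x i) z = - 1" using h_K4_nondeg m[OF x i] by blast
      \<comment> \<open>Supported at the coordinate \<open>i\<close> alone, so that all other
        factors of \<open>h_pow n x y\<close> are 1.\<close>
      define y where "y = (\<lambda>j\<in>{..<n}. if j = i then z else (0, 0))"
      have "y \<in> carrier (K4_pow n)" using z by (auto simp: K4_pow_simps y_def carrier_K4)
      moreover have "h_pow n x y = (\<Prod>j<n. if j = i then - 1 else 1)"
        unfolding h_pow_def by (intro prod.cong refl) (auto simp: y_def z h_K4_zero)
      ultimately show False using H i by (simp add: prod.delta)
    qed
    then show "x = \<one>\<^bsub>K4_pow n\<^esub>"
      using x by (intro extensionalityI[of _ "{..<n}"]) (auto simp: K4_pow_simps PiE_def)
  next
    have "card (carrier K4) = 4" by (simp add: carrier_K4)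
    then have "card (carrier (K4_pow n)) = 4 ^ n" by (simp add: K4_pow_simps card_PiE)
    moreover have "(2 :: real) ^ n * 2 ^ n = 4 ^ n" using power_mult_distrib[of "2 :: real" 2 n] by simp
    ultimately show "\<tau> * \<tau> * real (card (carrier (K4_pow n))) = 1" using assms by auto
  qed
  ultimately show ?thesis by (simp add: real_ty_def)
qed

text \<open>The form $a^i b^j \mapsto (-1)^{ij}$ in each coordinate.\<close>

definition std_form :: "nat \<Rightarrow> (nat \<Rightarrow> int \<times> int) \<Rightarrow> real" where
  "std_form n = (\<lambda>x\<in>carrier (K4_pow n). \<Prod>i<n. if x i = (1, 1) then - 1 else 1)"

text \<open>The quadratic relation holds in each coordinate, by inspection of the elements of
  \<open>K4\<close>, and is multiplicative over coordinates.\<close>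

lemma std_form_QF:
  assumes "real_ty (K4_pow n) (h_pow n) \<tau>"
  shows "std_form n \<in> QF (K4_pow n) (h_pow n)"
proof -
  interpret real_ty "K4_pow n" "h_pow n" \<tau> by (rule assms)
  let ?q = "\<lambda>x :: int \<times> int. if x = (1, 1) then - 1 else 1 :: real"
  have q: "?q (x \<otimes>\<^bsub>K4\<^esub> y) = ?q x * ?q y * h x y" if "x \<in> carrier K4" "y \<in> carrier K4" for x y
    using that by (auto simp: carrier_K4 K4_mult h_def)
  show ?thesis
    unfolding QF_iff
  proof (intro conjI ballI)
    show "std_form n \<in> extensional (carrier (K4_pow n))" by (simp add: std_form_def)
    fix x assume x: "x \<in> carrier (K4_pow n)"
    have "(\<Prod>i\<in>I. ?q (x i)) = 1 \<or> (\<Prod>i\<in>I. ?q (x i)) = - 1" if "finite I" for I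
      using that by (induction I) auto
    then show "std_form n x = 1 \<or> std_form n x = - 1" using x by (simp add: std_form_def)
    fix y assume y: "y \<in> carrier (K4_pow n)"
    have m: "x i \<in> carrier K4" "y i \<in> carrier K4" if "i < n" for i
      using that x y by (auto simp: K4_pow_simps)
    have "(\<Prod>i<n. ?q ((x \<otimes>\<^bsub>K4_pow n\<^esub> y) i)) = (\<Prod>i<n. ?q (x i) * ?q (y i) * h (x i) (y i))"
      by (intro prod.cong refl) (use m q in \<open>simp add: K4_pow_simps(2)\<close>)
    then show "std_form n (x \<otimes>\<^bsub>K4_pow n\<^esub> y) = std_form n x * std_form n y * h_pow n x y"
      using x y by (simp add: std_form_def h_pow_def prod.distrib)
  qed
qed

theorem theorem4p9:
  fixes n :: nat and \<tau> :: real
  assumes "\<tau> = 1 / 2 ^ n \<or> \<tau> = - (1 / 2 ^ n)"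
  shows "(\<forall>\<sigma>\<in>QF_sgn n (sgn \<tau>). \<forall>\<sigma>'\<in>QF_sgn n (sgn \<tau>). \<forall>\<epsilon>\<in>{1, - 1}. \<forall>\<epsilon>'\<in>{1, - 1}.
            braided_equivalent (TY_K4 n \<tau>) (K4_braid n \<sigma> \<epsilon>) (TY_K4 n \<tau>) (K4_braid n \<sigma>' \<epsilon>')
              \<longleftrightarrow> \<epsilon> = \<epsilon>')
       \<and> (if n > 0 \<or> (n = 0 \<and> \<tau> > 0)
          then card (braidings (TY_K4 n \<tau>) // braided_equiv_rel (TY_K4 n \<tau>)) = 2
          else braidings (TY_K4 n \<tau>) = {})"
proof -
  note K = K4_pow_real_ty[OF assms]
  interpret real_ty "K4_pow n" "h_pow n" \<tau> by (rule K)
  have forms: "QF_sgn n (sgn \<tau>) = forms" by (simp add: QF_sgn_def forms_def)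
  note std = std_form_QF[OF K]
  \<comment> \<open>For \<open>n = 0\<close> the group is trivial and the Gauss sum is the value at
    the identity, so the sign is always positive.\<close>
  have gauss0: "gauss_sum (K4_pow n) \<sigma> = 1" if "n = 0" "\<sigma> \<in> QF (K4_pow n) (h_pow n)" for \<sigma>
  proof -
    have "carrier (K4_pow n) = {\<one>\<^bsub>K4_pow n\<^esub>}" using that by (auto simp: K4_pow_simps)
    then show ?thesis using QF_one[OF that(2)] by (simp add: gauss_sum_def)
  qed
  have ex: "\<exists>\<sigma>. \<sigma> \<in> forms" if "n > 0 \<or> (n = 0 \<and> \<tau> > 0)"
  proof (cases "n = 0")
    case True
    then have "sgn \<tau> = 1" using that by simp
    then have "std_form n \<in> forms" unfolding forms_def using gauss0[OF True std] std by simp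
    then show ?thesis by blast
  next
    case False
    \<comment> \<open>The element ab in the first coordinate, at which the standard form is -1, as
      \<open>ex_form\<close> requires.\<close>
    define v where "v = (\<lambda>i\<in>{..<n}. if i = 0 then (1, 1) else (0, 0) :: int \<times> int)"
    have v: "v \<in> carrier (K4_pow n)" by (auto simp: v_def K4_pow_simps carrier_K4)
    have "(\<Prod>i<n. if v i = (1, 1) then - 1 else 1 :: real) = (\<Prod>i<n. if i = 0 then - 1 else 1)"
      by (intro prod.cong) (auto simp: v_def)
    then have "std_form n v = - 1" using False v by (simp add: std_form_def prod.delta)
    then show ?thesis using ex_form[OF std v] by blast
  qed
  have none: "forms = {}" if "\<not> (n > 0 \<or> (n = 0 \<and> \<tau> > 0))"
  proof -
    have "n = 0" "sgn \<tau> = - 1" using that assms by auto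
    then show ?thesis unfolding forms_def using gauss0 by auto
  qed
  have "braidings (TY_K4 n \<tau>) = {}" if "forms = {}"
    using braiding_cases that by blast
  then show ?thesis
    using braided_equivalent_iff card_braidings ex none unfolding forms by (auto split: if_splits)
qed

end
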